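(* Let $N \ge 3$ and $1 \le \eta \le \theta$ be integers, and let $f: \mathbb{N} \to [0,\infty )$ be a non-decreasing function with $f(\theta) > 0$. Let \[ A_{f,\eta, \theta} = \frac{12}{\pi^2} \sum_{m=\eta}^{\theta} f(m) \log \left( 1 +\frac{1}{m(m+2)} \right), \quad B_{f,\eta,\theta}= A_{f,\eta,\theta} + \frac{f(\theta)}{\theta}, \quad C_{f,\eta,\theta}= \frac{5 f(\theta)}{B_{f,\eta,\theta}} . \] Then \[ \frac{1}{\varphi(N)} \sum_{a \in \mathbb{Z}_N^*} S_{f,\eta,\theta} \left( \frac{a}{N} \right) \ll B_{f,\eta,\theta} \log N \log \log N \] with an absolute implied constant. Assuming moreover that $\sqrt{N} > \theta +2$, we also have \[ \frac{1}{\varphi (N)} \sum_{a \in \mathbb{Z}_N^*} S_{f,\eta,\theta} \left( \frac{a}{N} \right) = A_{f,\eta,\theta} \log N + O \left( B_{f,\eta,\theta} \left( \frac{(\log (C_{f,\eta,\theta}\log N))^2}{\log \log (C_{f,\eta,\theta}\log N)} + \log \theta \right) \log \log N \right) \] with an absolute implied constant.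
   Context: For an integer $N\ge 2$, $\mathbb{Z}_N^*$ denotes the set of integers $1\le a\le N$ coprime to $N$, and $\varphi$ is Euler's totient function. For $a\in\mathbb{Z}_N^*$, $a/N=[0;a_1,\ldots,a_r]$ is the canonical continued fraction expansion (with $a_r>1$). For integers $1\le\eta\le\theta$ and a function $f:\mathbb{N}\to[0,\infty)$, the restricted sum is $S_{f,\eta,\theta}(a/N)=\sum_{i=1}^r \mathds{1}_{\{\eta\le a_i\le\theta\}}f(a_i)$. *)

theory Defs
  imports Complex_Main "HOL-Number_Theory.Totient"
begin

text \<open>The value of \<open>[0; a\<^sub>1, \<dots>, a\<^sub>r]\<close>; the integer part 0 is not stored in the list.\<close>

fun cf_value :: "nat list \<Rightarrow> real" where
  "cf_value [] = 0"
| "cf_value (a # as) = 1 / (real a + cf_value as)"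

definition canonical_cf :: "nat list \<Rightarrow> bool" where
  "canonical_cf as \<longleftrightarrow> (\<forall>a\<in>set as. a \<ge> 1) \<and> (as \<noteq> [] \<longrightarrow> last as > 1)"

text \<open>Well defined for rational arguments in \<open>[0, 1)\<close>, see \<open>ex1_canonical_cf\<close>.\<close>

definition partial_quotients :: "real \<Rightarrow> nat list" where
  "partial_quotients x = (THE as. canonical_cf as \<and> cf_value as = x)"

definition S_restricted :: "(nat \<Rightarrow> real) \<Rightarrow> nat \<Rightarrow> nat \<Rightarrow> real \<Rightarrow> real" where
  "S_restricted f \<eta> \<theta> x = (\<Sum>m\<leftarrow>partial_quotients x. of_bool (\<eta> \<le> m \<and> m \<le> \<theta>) * f m)"

definition mean_S :: "(nat \<Rightarrow> real) \<Rightarrow> nat \<Rightarrow> nat \<Rightarrow> nat \<Rightarrow> real" where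
  "mean_S f \<eta> \<theta> N =
     1 / real (totient N) * (\<Sum>a\<in>totatives N. S_restricted f \<eta> \<theta> (real a / real N))"

definition A_const :: "(nat \<Rightarrow> real) \<Rightarrow> nat \<Rightarrow> nat \<Rightarrow> real" where
  "A_const f \<eta> \<theta> = 12 / pi\<^sup>2 * (\<Sum>m=\<eta>..\<theta>. f m * ln (1 + 1 / (real m * (real m + 2))))"

definition B_const :: "(nat \<Rightarrow> real) \<Rightarrow> nat \<Rightarrow> nat \<Rightarrow> real" where
  "B_const f \<eta> \<theta> = A_const f \<eta> \<theta> + f \<theta> / real \<theta>"

definition C_const :: "(nat \<Rightarrow> real) \<Rightarrow> nat \<Rightarrow> nat \<Rightarrow> real" where
  "C_const f \<eta> \<theta> = 5 * f \<theta> / B_const f \<eta> \<theta>"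

lemma canonical_cf_Cons:
  "canonical_cf (a # as) \<longleftrightarrow> a \<ge> 1 \<and> canonical_cf as \<and> (as = [] \<longrightarrow> a > 1)"
  by (auto simp: canonical_cf_def)

lemma cf_value_bounds:
  assumes "canonical_cf as"
  shows "0 \<le> cf_value as \<and> cf_value as < 1 \<and> (cf_value as = 0 \<longleftrightarrow> as = [])"
  using assms
proof (induction as)
  case Nil
  then show ?case by simp
next
  case (Cons a as)
  then have IH: "0 \<le> cf_value as" "cf_value as < 1" "cf_value as = 0 \<longleftrightarrow> as = []"
    and a: "a \<ge> 1" "as = [] \<longrightarrow> a > 1"
    by (auto simp: canonical_cf_Cons)
  have "real a + cf_value as > 1"
  proof (cases "as = []")
    case False
    then have "cf_value as > 0" using IH by linarith
    then show ?thesis using a(1) by linarith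
  qed (use a in auto)
  then show ?case by simp
qed

lemma canonical_cf_unique:
  assumes "canonical_cf as" "canonical_cf bs" "cf_value as = cf_value bs"
  shows "as = bs"
  using assms
proof (induction as arbitrary: bs)
  case Nil
  then show ?case using cf_value_bounds[of bs] by simp
next
  case (Cons a as)
  have "cf_value bs \<noteq> 0"
    using cf_value_bounds[OF Cons.prems(1)] Cons.prems(3) by (metis list.distinct(1))
  then obtain b bs' where bs: "bs = b # bs'"
    by (cases bs) auto
  have c: "canonical_cf as" "canonical_cf bs'"
    using Cons.prems bs by (auto simp: canonical_cf_Cons)
  have "1 / (real a + cf_value as) = 1 / (real b + cf_value bs')"
    using Cons.prems(3) bs by simp
  then have eq: "real a + cf_value as = real b + cf_value bs'"
    by (metis inverse_eq_divide inverse_inverse_eq)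
  have "a = b"
    using eq cf_value_bounds[OF c(1)] cf_value_bounds[OF c(2)] by linarith
  then show ?case using Cons.IH[OF c] eq bs by simp
qed

lemma canonical_cf_exists:
  "a < N \<Longrightarrow> \<exists>as. canonical_cf as \<and> cf_value as = real a / real N"
proof (induction a arbitrary: N rule: less_induct)
  case (less a)
  show ?case
  proof (cases "a = 0")
    case True
    then show ?thesis by (intro exI[of _ "[]"]) (simp add: canonical_cf_def)
  next
    case False
    then have "N mod a < a" by simp
    then obtain as where as: "canonical_cf as" "cf_value as = real (N mod a) / real a"
      using less.IH by blast
    have q: "N div a \<ge> 1"
      using False less.prems by (simp add: Suc_leI div_greater_zero_iff)
    have "N div a > 1" if "as = []"
    proof -
      have "N mod a = 0" using as that False by simp
      then have "N = a * (N div a)" by (metis add.right_neutral mult_div_mod_eq)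
      then show ?thesis using less.prems q by (metis le_neq_implies_less mult.right_neutral nat_neq_iff)
    qed
    then have can: "canonical_cf (N div a # as)"
      using q as by (simp add: canonical_cf_Cons)
    have "real N = real a * real (N div a) + real (N mod a)"
      by (metis mult_div_mod_eq of_nat_add of_nat_mult)
    then have "real (N div a) + cf_value as = real N / real a"
      using False as by (simp add: field_simps)
    then have "cf_value (N div a # as) = real a / real N" by simp
    then show ?thesis using can by blast
  qed
qed

lemma ex1_canonical_cf:
  "a < N \<Longrightarrow> \<exists>!as. canonical_cf as \<and> cf_value as = real a / real N"
  using canonical_cf_exists canonical_cf_unique by metis

end

theory Submission
  imports Defs "HOL-Analysis.Gamma_Function" "HOL-Real_Asymp.Real_Asymp"
begin

text \<open>
  By partial summation in \<open>f\<close> it suffices to count, over all \<open>a\<close>, the partial quotients that are at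
  least \<open>k\<close>. Up to an error \<open>O(N/k)\<close> this number is twice the number of solutions of
  \<open>s u + t v = N\<close> with \<open>1 \<le> t \<le> s\<close>, \<open>k v \<le> u\<close>, and \<open>gcd s t = gcd u v = 1\<close>, where \<open>u div v\<close> is the
  partial quotient.

  Fixing \<open>v\<close> and \<open>s\<close> shows that there are \<open>O(N/k log N)\<close> solutions, which with \<open>N/\<phi>(N) \<lless> log log N\<close>
  gives the first claim. For the second claim, the solutions with \<open>s \<le> \<surd>(N/k)/Z\<close> are
  counted by fixing \<open>(s,t)\<close>, those with \<open>u \<le> \<surd>N/Z\<close> by fixing \<open>(u,v)\<close>, and the remaining ones
  contribute only \<open>O(N/k (log Z + log k))\<close>. With one pair fixed, the coprimality of the other pair removes
  one residue class for each prime dividing \<open>N\<close>; Brun's pure sieve evaluates the count with relative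
  error \<open>1/log N\<close> if \<open>log Z\<close> is of order \<open>(log log N)\<^sup>2/log log log N\<close>.
\<close>

section \<open>Euclidean quotients as splittings of N\<close>

text \<open>The factor two comes from the two continued fraction expansions of \<open>s / t\<close>:
  a quadruple with \<open>1 \<le> t < s\<close> is met in the algorithm for some \<open>a\<close>
  and again for \<open>N - a\<close>. The sieve works because \<open>s * u + t * v = N\<close>
  forces common divisors of \<open>u\<close> and \<open>v\<close>, or of \<open>s\<close> and
  \<open>t\<close>, to divide \<open>N\<close>: only the few primes of \<open>N\<close> matter, and
  they thin out the solutions by the factor \<open>totient N / N\<close>. The obstacle is that the
  sieve error for one fixed pair is about the number \<open>Z\<close> of sieve terms. Both pairs are
  therefore cut off a factor \<open>Z\<close> below the natural square root, which keeps the number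
  of pairs times \<open>Z\<close> at O(N/k). The price is a middle range that is only bounded from
  above; its \<open>ln Z\<close> is the source of the quotient of iterated logarithms, and dividing
  N/k by \<open>totient N\<close> produces the outer log log N. Each sieved range supplies half of
  log N times 6/pi^2, the density of coprime pairs, times \<open>ln (1 + 1 / k)\<close>; the factor
  two then gives 12/pi^2. The constant C is at least 2 under the size condition on \<open>N\<close>;
  it keeps the iterated logarithm in the error term positive.\<close>

fun euclid_sum :: "(nat \<Rightarrow> real) \<Rightarrow> nat \<Rightarrow> nat \<Rightarrow> real" where
  "euclid_sum h u v = (if v = 0 then 0 else h (u div v) + euclid_sum h v (u mod v))"

declare euclid_sum.simps [simp del]

lemma euclid_sum_0 [simp]: "euclid_sum h u 0 = 0"
  by (simp add: euclid_sum.simps)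

lemma partial_quotients_eqI:
  assumes "canonical_cf as" "cf_value as = x"
  shows "partial_quotients x = as"
  unfolding partial_quotients_def
  using assms canonical_cf_unique by (intro the_equality) auto

lemma partial_quotients_rec:
  assumes "0 < v" "v < u"
  shows "partial_quotients (real v / real u) =
    (u div v) # partial_quotients (real (u mod v) / real v)"
proof -
  have "u mod v < v" using assms by simp
  then obtain as where as: "canonical_cf as" "cf_value as = real (u mod v) / real v"
    using canonical_cf_exists by blast
  have q: "u div v \<ge> 1"
    using assms by (simp add: Suc_leI div_greater_zero_iff)
  have "u div v > 1" if "as = []"
  proof -
    have "u mod v = 0" using as that assms by simp
    then have "u = v * (u div v)" by (metis add.right_neutral mult_div_mod_eq)
    then show ?thesis using assms q
      by (metis le_neq_implies_less mult.right_neutral nat_neq_iff)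
  qed
  then have can: "canonical_cf (u div v # as)"
    using q as by (simp add: canonical_cf_Cons)
  have "real u = real v * real (u div v) + real (u mod v)"
    by (metis mult_div_mod_eq of_nat_add of_nat_mult)
  then have "real (u div v) + cf_value as = real u / real v"
    using assms as by (simp add: field_simps)
  then have "cf_value (u div v # as) = real v / real u" by simp
  then show ?thesis using can as partial_quotients_eqI by metis
qed

lemma sum_list_partial_quotients:
  assumes "v < u"
  shows "(\<Sum>m\<leftarrow>partial_quotients (real v / real u). h m) = euclid_sum h u v"
  using assms
proof (induction v arbitrary: u rule: less_induct)
  case (less v)
  show ?case
  proof (cases "v = 0")
    case True
    have "partial_quotients 0 = []"
      by (intro partial_quotients_eqI) (auto simp: canonical_cf_def)
    then show ?thesis using True by simp
  next
    case False
    then show ?thesis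
      using less by (simp add: partial_quotients_rec euclid_sum.simps[of h u v])
  qed
qed

text \<open>In the Euclidean algorithm for \<open>a / N\<close>, \<open>(u,v)\<close> are consecutive remainders and \<open>(s,t)\<close>
  the denominators of two consecutive convergents; the corresponding partial quotient is \<open>u div v\<close>.\<close>
definition continuant_splits :: "nat \<Rightarrow> (nat \<times> nat \<times> nat \<times> nat) set" where
  "continuant_splits N = {(s,t,u,v). t \<le> s \<and> 1 \<le> v \<and> v < u \<and> coprime s t \<and> coprime u v \<and> s * u + t * v = N}"

text \<open>A division step on \<open>(u,v)\<close> coupled with the recurrence for denominators on
  \<open>(s,t)\<close>. It preserves \<open>s * u + t * v\<close>: the multiple of \<open>v\<close>
  that \<open>u\<close> loses is handed to the coefficient of \<open>v\<close>.\<close>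

definition euclid_step :: "nat \<times> nat \<times> nat \<times> nat \<Rightarrow> nat \<times> nat \<times> nat \<times> nat" where
  "euclid_step = (\<lambda>(s,t,u,v). (s * (u div v) + t, s, v, u mod v))"

lemma finite_continuant_splits: "finite (continuant_splits N)"
proof (rule finite_subset)
  show "continuant_splits N \<subseteq> {..N} \<times> {..N} \<times> {..N} \<times> {..N}"
  proof
    fix q assume "q \<in> continuant_splits N"
    then obtain s t u v where q: "q = (s,t,u,v)" "(s,t,u,v) \<in> continuant_splits N"
      by (cases q) auto
    then have *: "t \<le> s" "1 \<le> v" "v < u" "coprime s t" "s * u + t * v = N"
      by (auto simp: continuant_splits_def)
    have "s \<ge> 1" using * by (cases s) auto
    have "s \<le> s * u" "u \<le> s * u" using * \<open>s \<ge> 1\<close> by auto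
    then have "s \<le> N" "t \<le> N" "u \<le> N" "v \<le> N" using * by linarith+
    then show "q \<in> {..N} \<times> {..N} \<times> {..N} \<times> {..N}" using q by simp
  qed
qed auto

lemma coprime_mult_add_left: "coprime (s * m + t) s \<longleftrightarrow> coprime s (t::nat)"
  by (metis add.commute coprime_iff_gcd_eq_1 gcd.commute gcd_add_mult mult.commute)

text \<open>\<open>euclid_step\<close> is a bijection from the splittings with \<open>t < s\<close>
  and non-zero remainder onto those with \<open>1 \<le> t\<close>: because \<open>t < s\<close>,
  dividing the new first entry by the second returns the quotient and the old \<open>t\<close>.
  Terms with remainder zero vanish by \<open>D0\<close>. For \<open>D = euclid_sum h\<close> this is
  half of a telescoping argument.\<close>

lemma sum_euclid_step_lt:
  fixes D :: "nat \<Rightarrow> nat \<Rightarrow> real"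
  assumes D0: "\<And>u. D u 0 = 0"
  shows "(\<Sum>(s,t,u,v)\<in>{(s,t,u,v)\<in>continuant_splits N. t < s}. D v (u mod v)) =
         (\<Sum>(s,t,u,v)\<in>{(s,t,u,v)\<in>continuant_splits N. 1 \<le> t}. D u v)"
proof -
  have "(\<Sum>(s,t,u,v)\<in>{(s,t,u,v)\<in>continuant_splits N. t < s}. D v (u mod v)) =
        (\<Sum>(s,t,u,v)\<in>{(s,t,u,v)\<in>continuant_splits N. t < s \<and> u mod v \<noteq> 0}. D v (u mod v))"
    by (rule sum.mono_neutral_right)
      (use D0 in \<open>auto intro: finite_subset[OF _ finite_continuant_splits] Nat.gr0I\<close>)
  also have "\<dots> = (\<Sum>(s,t,u,v)\<in>{(s,t,u,v)\<in>continuant_splits N. 1 \<le> t}. D u v)"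
  proof (rule sum.reindex_bij_witness[where j = euclid_step and
        i = "\<lambda>(s,t,u,v). (t, s mod t, (s div t) * u + v, u)"])
    fix q assume "q \<in> {(s,t,u,v)\<in>continuant_splits N. t < s \<and> u mod v \<noteq> 0}"
    then obtain s t u v where q: "q = (s,t,u,v)"
      and *: "(s,t,u,v) \<in> continuant_splits N" "t < s" "u mod v \<noteq> 0" by auto
    then have c: "1 \<le> v" "v < u" "coprime s t" "coprime u v" "s * u + t * v = N"
      by (auto simp: continuant_splits_def)
    show "(case euclid_step q of (s,t,u,v) \<Rightarrow> (t, s mod t, (s div t) * u + v, u)) = q"
      using * q by (simp add: euclid_step_def)
    have m: "u div v \<ge> 1" using c by (simp add: Suc_leI div_greater_zero_iff)
    have u: "u = v * (u div v) + u mod v" by simp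
    have "coprime v (u mod v)" using c by (metis coprime_commute coprime_mod_right_iff not_one_le_zero)
    moreover have "(s * (u div v) + t) * v + s * (u mod v) = N"
    proof -
      have "(s * (u div v) + t) * v + s * (u mod v) = s * (v * (u div v) + u mod v) + t * v"
        by (simp only: algebra_simps)
      then show ?thesis using c by simp
    qed
    moreover have "s \<le> s * (u div v) + t"
      using m by (metis le_add1 le_trans mult.right_neutral mult_le_mono2)
    ultimately show "euclid_step q \<in> {(s,t,u,v)\<in>continuant_splits N. 1 \<le> t}"
      using * c q by (auto simp: euclid_step_def continuant_splits_def coprime_mult_add_left)
    show "(case euclid_step q of (s,t,u,v) \<Rightarrow> D u v) = (case q of (s,t,u,v) \<Rightarrow> D v (u mod v))"
      using q by (simp add: euclid_step_def)
  next
    fix q assume "q \<in> {(s,t,u,v)\<in>continuant_splits N. 1 \<le> t}"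
    then obtain s t u v where q: "q = (s,t,u,v)"
      and *: "(s,t,u,v) \<in> continuant_splits N" "1 \<le> t" by auto
    then have c: "1 \<le> v" "v < u" "coprime s t" "coprime u v" "s * u + t * v = N" "t \<le> s"
      by (auto simp: continuant_splits_def)
    have 1: "(s div t * u + v) div u = s div t" "(s div t * u + v) mod u = v" using c by auto
    show "euclid_step (case q of (s,t,u,v) \<Rightarrow> (t, s mod t, (s div t) * u + v, u)) = q"
      using 1 q by (simp add: euclid_step_def)
    have m: "s div t \<ge> 1" using c * by (simp add: Suc_leI div_greater_zero_iff)
    have "coprime t (s mod t)" using c * by (metis coprime_commute coprime_mod_right_iff not_one_le_zero)
    moreover have "t * (s div t * u + v) + s mod t * u = N"
    proof -
      have "t * (s div t * u + v) + s mod t * u = (t * (s div t) + s mod t) * u + t * v"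
        by (simp only: algebra_simps)
      then show ?thesis using c by simp
    qed
    moreover have "u < s div t * u + v" using m c by (cases "s div t") auto
    moreover have "coprime (s div t * u + v) u"
      using coprime_mult_add_left[of u "s div t" v] c by (simp add: mult.commute)
    moreover have "s mod t < t" using * by simp
    ultimately show "(case q of (s,t,u,v) \<Rightarrow> (t, s mod t, (s div t) * u + v, u))
        \<in> {(s,t,u,v)\<in>continuant_splits N. t < s \<and> u mod v \<noteq> 0}"
      using * c 1 q by (auto simp: continuant_splits_def)
  qed
  finally show ?thesis .
qed

text \<open>The same step on the range \<open>1 \<le> t \<le> s\<close>. As \<open>t = s\<close> is
  now possible, the old \<open>t\<close> is the residue in \<open>{1..s}\<close> instead of
  \<open>{0..<s}\<close>, whence the \<open>s - 1\<close> and \<open>Suc\<close> in the inverse.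
  This is the second way of tracing an expansion backwards.\<close>

lemma sum_euclid_step_pos:
  fixes D :: "nat \<Rightarrow> nat \<Rightarrow> real"
  assumes D0: "\<And>u. D u 0 = 0"
  shows "(\<Sum>(s,t,u,v)\<in>{(s,t,u,v)\<in>continuant_splits N. 1 \<le> t}. D v (u mod v)) =
         (\<Sum>(s,t,u,v)\<in>{(s,t,u,v)\<in>continuant_splits N. 1 \<le> t \<and> t < s}. D u v)"
proof -
  have "(\<Sum>(s,t,u,v)\<in>{(s,t,u,v)\<in>continuant_splits N. 1 \<le> t}. D v (u mod v)) =
        (\<Sum>(s,t,u,v)\<in>{(s,t,u,v)\<in>continuant_splits N. 1 \<le> t \<and> u mod v \<noteq> 0}. D v (u mod v))"
    by (rule sum.mono_neutral_right)
      (use D0 in \<open>auto intro: finite_subset[OF _ finite_continuant_splits] Nat.gr0I\<close>)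
  also have "\<dots> = (\<Sum>(s,t,u,v)\<in>{(s,t,u,v)\<in>continuant_splits N. 1 \<le> t \<and> t < s}. D u v)"
  proof (rule sum.reindex_bij_witness[where j = euclid_step and
        i = "\<lambda>(s,t,u,v). (t, Suc ((s-1) mod t), ((s-1) div t) * u + v, u)"])
    fix q assume "q \<in> {(s,t,u,v)\<in>continuant_splits N. 1 \<le> t \<and> u mod v \<noteq> 0}"
    then obtain s t u v where q: "q = (s,t,u,v)"
      and *: "(s,t,u,v) \<in> continuant_splits N" "1 \<le> t" "u mod v \<noteq> 0" by auto
    then have c: "1 \<le> v" "v < u" "coprime s t" "coprime u v" "s * u + t * v = N" "t \<le> s"
      by (auto simp: continuant_splits_def)
    have m: "u div v \<ge> 1" using c by (simp add: Suc_leI div_greater_zero_iff)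
    have e: "s * (u div v) + t - 1 = s * (u div v) + (t - 1)" using * by simp
    have t1: "t - 1 < s" using * c by linarith
    have "(s * (u div v) + t - 1) div s = u div v" "(s * (u div v) + t - 1) mod s = t - 1"
      unfolding e using t1 by auto
    then show "(case euclid_step q of (s,t,u,v) \<Rightarrow>
        (t, Suc ((s-1) mod t), ((s-1) div t) * u + v, u)) = q"
      using * q by (simp add: euclid_step_def)
    have "coprime v (u mod v)" using c by (metis coprime_commute coprime_mod_right_iff not_one_le_zero)
    moreover have "(s * (u div v) + t) * v + s * (u mod v) = N"
    proof -
      have "(s * (u div v) + t) * v + s * (u mod v) = s * (v * (u div v) + u mod v) + t * v"
        by (simp only: algebra_simps)
      then show ?thesis using c by simp
    qed
    moreover have "s < s * (u div v) + t"
    proof -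
      have "s * 1 \<le> s * (u div v)" using m mult_le_mono2 by blast
      then show ?thesis using * by linarith
    qed
    ultimately show "euclid_step q \<in> {(s,t,u,v)\<in>continuant_splits N. 1 \<le> t \<and> t < s}"
      using * c q by (auto simp: euclid_step_def continuant_splits_def coprime_mult_add_left)
    show "(case euclid_step q of (s,t,u,v) \<Rightarrow> D u v) = (case q of (s,t,u,v) \<Rightarrow> D v (u mod v))"
      using q by (simp add: euclid_step_def)
  next
    fix q assume "q \<in> {(s,t,u,v)\<in>continuant_splits N. 1 \<le> t \<and> t < s}"
    then obtain s t u v where q: "q = (s,t,u,v)"
      and *: "(s,t,u,v) \<in> continuant_splits N" "1 \<le> t" "t < s" by auto
    then have c: "1 \<le> v" "v < u" "coprime s t" "coprime u v" "s * u + t * v = N"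
      by (auto simp: continuant_splits_def)
    have s: "t * ((s-1) div t) + Suc ((s-1) mod t) = s" using * by simp
    have 1: "((s-1) div t * u + v) div u = (s-1) div t" "((s-1) div t * u + v) mod u = v" using c by auto
    show "euclid_step (case q of (s,t,u,v) \<Rightarrow>
        (t, Suc ((s-1) mod t), ((s-1) div t) * u + v, u)) = q"
      using 1 s unfolding euclid_step_def q prod.case by simp
    have m: "(s-1) div t \<ge> 1" using c * by (simp add: Suc_leI div_greater_zero_iff)
    have "coprime t (Suc ((s-1) mod t))"
      using c s coprime_mult_add_left[of t "(s-1) div t" "Suc ((s-1) mod t)"] by simp
    moreover have "t * ((s-1) div t * u + v) + Suc ((s-1) mod t) * u = N"
    proof -
      have "t * ((s-1) div t * u + v) + Suc ((s-1) mod t) * u =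
          (t * ((s-1) div t) + Suc ((s-1) mod t)) * u + t * v"
        by (simp only: algebra_simps)
      then show ?thesis using c s by simp
    qed
    moreover have "u < (s-1) div t * u + v" using m c by (cases "(s-1) div t") auto
    moreover have "coprime ((s-1) div t * u + v) u"
      using coprime_mult_add_left[of u "(s-1) div t" v] c by (simp add: mult.commute)
    moreover have "Suc ((s-1) mod t) \<le> t"
      using * by (metis Suc_leI mod_less_divisor not_one_le_zero gr0I)
    ultimately show "(case q of (s,t,u,v) \<Rightarrow> (t, Suc ((s-1) mod t), ((s-1) div t) * u + v, u))
        \<in> {(s,t,u,v)\<in>continuant_splits N. 1 \<le> t \<and> u mod v \<noteq> 0}"
      using * c 1 q by (auto simp: continuant_splits_def)
  qed
  finally show ?thesis .
qed

text \<open>As \<open>h (u div v) = euclid_sum h u v - euclid_sum h v (u mod v)\<close>, both sums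
  telescope: the first to the range \<open>t < s\<close> minus the range \<open>1 \<le> t\<close>,
  the second to \<open>1 \<le> t\<close> minus \<open>1 \<le> t \<and> t < s\<close>. Together only
  \<open>t = 0\<close> survives, where coprimality forces \<open>s = 1\<close>, so
  \<open>u = N\<close> and \<open>v\<close> runs through the totatives.\<close>

lemma sum_totatives_euclid_sum:
  assumes "N \<ge> 2"
  shows "(\<Sum>a\<in>totatives N. euclid_sum h N a) =
     (\<Sum>(s,t,u,v)\<in>{(s,t,u,v)\<in>continuant_splits N. t < s}. h (u div v)) +
     (\<Sum>(s,t,u,v)\<in>{(s,t,u,v)\<in>continuant_splits N. 1 \<le> t}. h (u div v))"
proof -
  let ?Q = "continuant_splits N"
  let ?D = "euclid_sum h"
  have fin: "finite {(s,t,u,v). (s,t,u,v) \<in> ?Q \<and> P s t}" for P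
    using finite_continuant_splits by (rule rev_finite_subset) auto
  have h: "h (u div v) = ?D u v - ?D v (u mod v)" if "(s,t,u,v) \<in> ?Q" for s t u v
    using that by (subst euclid_sum.simps) (auto simp: continuant_splits_def)
  have eq: "(\<Sum>(s,t,u,v)\<in>{(s,t,u,v)\<in>?Q. P s t}. h (u div v)) =
    (\<Sum>(s,t,u,v)\<in>{(s,t,u,v)\<in>?Q. P s t}. ?D u v) -
    (\<Sum>(s,t,u,v)\<in>{(s,t,u,v)\<in>?Q. P s t}. ?D v (u mod v))" for P
    unfolding sum_subtractf[symmetric] by (rule sum.cong) (auto dest: h)
  have lt: "{(s,t,u,v)\<in>?Q. t < s} = {(s,t,u,v)\<in>?Q. t = 0} \<union> {(s,t,u,v)\<in>?Q. 1 \<le> t \<and> t < s}"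
    by (auto simp: continuant_splits_def Suc_le_eq intro: Nat.gr0I)
  have "(\<Sum>(s,t,u,v)\<in>{(s,t,u,v)\<in>?Q. t < s}. ?D u v) =
      (\<Sum>(s,t,u,v)\<in>{(s,t,u,v)\<in>?Q. t = 0}. ?D u v) + (\<Sum>(s,t,u,v)\<in>{(s,t,u,v)\<in>?Q. 1 \<le> t \<and> t < s}. ?D u v)"
    unfolding lt by (rule sum.union_disjoint[OF fin fin]) auto
  moreover have "(\<Sum>(s,t,u,v)\<in>{(s,t,u,v)\<in>?Q. t = 0}. ?D u v) = (\<Sum>a\<in>totatives N. ?D N a)"
  proof (rule sum.reindex_bij_witness[where i = "\<lambda>a. (1,0,N,a)" and j = "\<lambda>(s,t,u,v). v"])
    fix a assume "a \<in> totatives N"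
    then show "(1,0,N,a) \<in> {(s,t,u,v)\<in>?Q. t = 0}"
      using assms totatives_less[of a N]
      by (auto simp: continuant_splits_def in_totatives_iff coprime_commute)
  qed (auto simp: continuant_splits_def in_totatives_iff coprime_commute)
  ultimately show ?thesis
    using eq[of "\<lambda>s t. t < s"] eq[of "\<lambda>s t. 1 \<le> t"]
      sum_euclid_step_lt[of ?D N] sum_euclid_step_pos[of ?D N] by simp
qed

section \<open>Counting splittings with coprimality conditions\<close>

text \<open>In contrast to \<open>continuant_splits\<close>, both pairs obey conditions of one form:
  \<open>(s,t)\<close> has ratio at least 1, \<open>(u,v)\<close> ratio at least \<open>k\<close>.
  Either pair can be fixed and the other counted by the same function
  \<open>split_count\<close>.\<close>

definition coprime_splits :: "nat \<Rightarrow> nat \<Rightarrow> (nat \<times> nat \<times> nat \<times> nat) set" where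
  "coprime_splits k N = {(s,t,u,v). 1 \<le> t \<and> t \<le> s \<and> 1 \<le> v \<and> k * v \<le> u \<and>
     coprime s t \<and> coprime u v \<and> s * u + t * v = N}"

definition digits_ge_mean :: "nat \<Rightarrow> nat \<Rightarrow> real" where
  "digits_ge_mean k N =
     (\<Sum>a\<in>totatives N. euclid_sum (\<lambda>m. of_bool (k \<le> m)) N a) / real (totient N)"

lemma finite_coprime_splits: "1 \<le> k \<Longrightarrow> finite (coprime_splits k N)"
proof (rule finite_subset)
  assume k: "1 \<le> k"
  show "coprime_splits k N \<subseteq> {..N} \<times> {..N} \<times> {..N} \<times> {..N}"
  proof
    fix q assume "q \<in> coprime_splits k N"
    then obtain s t u v where q: "q = (s,t,u,v)" "(s,t,u,v) \<in> coprime_splits k N"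
      by (cases q) auto
    then have *: "1 \<le> t" "t \<le> s" "1 \<le> v" "k * v \<le> u" "s * u + t * v = N"
      by (auto simp: coprime_splits_def)
    have "1 * v \<le> k * v" using k mult_le_mono1 by blast
    then have "v \<le> u" using * by linarith
    have "s \<le> s * u" "u \<le> s * u" using * \<open>v \<le> u\<close> by auto
    then have "s \<le> N" "t \<le> N" "u \<le> N" "v \<le> N" using * \<open>v \<le> u\<close> by linarith+
    then show "q \<in> {..N} \<times> {..N} \<times> {..N} \<times> {..N}" using q by simp
  qed
qed auto

lemma of_nat_div_le_divide: "real (m div n) \<le> real m / real n"
  by (metis floor_divide_of_nat_eq of_int_floor_le of_int_of_nat_eq)

text \<open>The two ranges of \<open>sum_totatives_euclid_sum\<close> differ from
  \<open>coprime_splits\<close> only by degenerate families: \<open>t = 0\<close>,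
  \<open>s = t = 1\<close>, and, for \<open>k = 1\<close>, \<open>u = v = 1\<close>. Each is
  parametrized by a single number in \<open>{1..N div k}\<close>.\<close>

lemma digits_ge_mean_coprime_splits:
  assumes "N \<ge> 2" "1 \<le> k"
  shows "\<bar>digits_ge_mean k N * real (totient N) - 2 * real (card (coprime_splits k N))\<bar> \<le> 4 * real N / real k"
proof -
  let ?Q = "continuant_splits N"
  let ?R = "coprime_splits k N"
  let ?h = "\<lambda>m. of_bool (k \<le> m) :: real"
  define A where "A = {(s,t,u,v). (s,t,u,v) \<in> ?Q \<and> t < s \<and> k * v \<le> u}"
  define B where "B = {(s,t,u,v). (s,t,u,v) \<in> ?Q \<and> 1 \<le> t \<and> k * v \<le> u}"
  have finA: "finite A" and finB: "finite B"
    using finite_continuant_splits[of N] by (auto simp: A_def B_def intro: rev_finite_subset)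
  have finR: "finite ?R" using finite_coprime_splits assms by blast
  have dv: "k \<le> u div v \<longleftrightarrow> k * v \<le> u" if "1 \<le> v" for u v
    using that by (simp add: less_eq_div_iff_mult_less_eq)
  have eq: "(\<Sum>(s,t,u,v)\<in>{(s,t,u,v). (s,t,u,v) \<in> ?Q \<and> P s t}. ?h (u div v)) =
      real (card {(s,t,u,v). (s,t,u,v) \<in> ?Q \<and> P s t \<and> k * v \<le> u})" for P
  proof -
    have fin: "finite {(s,t,u,v). (s,t,u,v) \<in> ?Q \<and> P s t}"
      using finite_continuant_splits[of N] by (rule rev_finite_subset) auto
    have "(\<Sum>(s,t,u,v)\<in>{(s,t,u,v). (s,t,u,v) \<in> ?Q \<and> P s t}. ?h (u div v)) =
      (\<Sum>q\<in>{(s,t,u,v). (s,t,u,v) \<in> ?Q \<and> P s t}. of_bool (case q of (s,t,u,v) \<Rightarrow> k * v \<le> u))"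
      by (rule sum.cong) (auto simp: continuant_splits_def dv)
    also have "\<dots> = real (card ({(s,t,u,v). (s,t,u,v) \<in> ?Q \<and> P s t} \<inter> {q. case q of (s,t,u,v) \<Rightarrow> k * v \<le> u}))"
      using fin by (simp add: sum_of_bool_eq)
    also have "{(s,t,u,v). (s,t,u,v) \<in> ?Q \<and> P s t} \<inter> {q. case q of (s,t,u,v) \<Rightarrow> k * v \<le> u} =
      {(s,t,u,v). (s,t,u,v) \<in> ?Q \<and> P s t \<and> k * v \<le> u}" by auto
    finally show ?thesis .
  qed
  have "totient N > 0" using assms by simp
  then have M: "digits_ge_mean k N * real (totient N) = real (card A) + real (card B)"
    unfolding digits_ge_mean_def using sum_totatives_euclid_sum[OF assms(1), of ?h]
    by (simp add: eq A_def B_def)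
  have vk: "v \<in> {1..N div k}" if "1 \<le> v" "k * v \<le> N" for v
    using that assms by (simp add: less_eq_div_iff_mult_less_eq mult.commute)
  have c1: "real (card (X :: (nat \<times> nat \<times> nat \<times> nat) set)) \<le> real N / real k"
    if "X \<subseteq> g ` {1..N div k}" for X g
  proof -
    have "card X \<le> card (g ` {1..N div k})" using that by (intro card_mono) auto
    also have "\<dots> \<le> card {1..N div k}" by (rule card_image_le) auto
    finally have "real (card X) \<le> real (N div k)" by simp
    also have "\<dots> \<le> real N / real k" by (rule of_nat_div_le_divide)
    finally show ?thesis .
  qed
  have "A \<subseteq> ?R \<union> (\<lambda>v. (1,0,N,v)) ` {1..N div k}"
  proof
    fix q assume "q \<in> A"
    then obtain s t u v where q: "q = (s,t,u,v)" "(s,t,u,v) \<in> ?Q" "t < s" "k * v \<le> u"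
      by (auto simp: A_def)
    show "q \<in> ?R \<union> (\<lambda>v. (1,0,N,v)) ` {1..N div k}"
    proof (cases "t = 0")
      case True
      then have "s = 1" "u = N" "1 \<le> v" using q by (auto simp: continuant_splits_def)
      then show ?thesis using q vk[of v] True by auto
    next
      case False
      then show ?thesis using q by (auto simp: continuant_splits_def coprime_splits_def)
    qed
  qed
  then have "card A \<le> card (?R \<union> (\<lambda>v. (1,0,N,v)) ` {1..N div k})"
    using finR by (intro card_mono) auto
  also have "\<dots> \<le> card ?R + card ((\<lambda>v. (1::nat,0::nat,N,v)) ` {1..N div k})" by (rule card_Un_le)
  finally have A_up: "real (card A) \<le> real (card ?R) + real N / real k"
    using c1[of "(\<lambda>v. (1::nat,0::nat,N,v)) ` {1..N div k}"] by force
  have "B \<subseteq> ?R" by (auto simp: B_def continuant_splits_def coprime_splits_def)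
  then have B_up: "card B \<le> card ?R" using finR by (rule card_mono[rotated])
  have R_B: "?R \<subseteq> B \<union> (\<lambda>t. (N-t,t,1,1)) ` {1..N div k}"
  proof
    fix q assume "q \<in> ?R"
    then obtain s t u v where q: "q = (s,t,u,v)" "(s,t,u,v) \<in> ?R" by (cases q) auto
    then have *: "1 \<le> t" "t \<le> s" "1 \<le> v" "k * v \<le> u" "coprime s t" "coprime u v" "s * u + t * v = N"
      by (auto simp: coprime_splits_def)
    have "1 * v \<le> k * v" using assms mult_le_mono1 by blast
    then have "v \<le> u" using * by linarith
    show "q \<in> B \<union> (\<lambda>t. (N-t,t,1,1)) ` {1..N div k}"
    proof (cases "u = v")
      case True
      then have "u = 1" "v = 1" using * by auto
      then have "k = 1" using * assms by simp
      then show ?thesis using * q \<open>u = 1\<close> \<open>v = 1\<close> by force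
    next
      case False
      then show ?thesis using * q \<open>v \<le> u\<close> by (auto simp: B_def continuant_splits_def)
    qed
  qed
  have "card ?R \<le> card (B \<union> (\<lambda>t. (N-t,t,1,1)) ` {1..N div k})"
    using R_B finB by (intro card_mono) auto
  also have "\<dots> \<le> card B + card ((\<lambda>t. (N-t,t,1::nat,1::nat)) ` {1..N div k})" by (rule card_Un_le)
  finally have B_lo: "real (card ?R) \<le> real (card B) + real N / real k"
    using c1[of "(\<lambda>t. (N-t,t,1::nat,1::nat)) ` {1..N div k}"] by force
  have "B \<subseteq> A \<union> (\<lambda>v. (1,1,N-v,v)) ` {1..N div k}"
  proof
    fix q assume "q \<in> B"
    then obtain s t u v where q: "q = (s,t,u,v)" "(s,t,u,v) \<in> ?Q" "1 \<le> t" "k * v \<le> u"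
      by (auto simp: B_def)
    show "q \<in> A \<union> (\<lambda>v. (1,1,N-v,v)) ` {1..N div k}"
    proof (cases "t = s")
      case True
      then have "s = 1" "t = 1" "u + v = N" "1 \<le> v" using q by (auto simp: continuant_splits_def)
      then show ?thesis using q vk[of v] by force
    next
      case False
      then show ?thesis using q by (auto simp: continuant_splits_def A_def)
    qed
  qed
  then have "card B \<le> card (A \<union> (\<lambda>v. (1,1,N-v,v)) ` {1..N div k})"
    using finA by (intro card_mono) auto
  also have "\<dots> \<le> card A + card ((\<lambda>v. (1::nat,1::nat,N-v,v)) ` {1..N div k})" by (rule card_Un_le)
  finally have A_lo: "real (card B) \<le> real (card A) + real N / real k"
    using c1[of "(\<lambda>v. (1::nat,1::nat,N-v,v)) ` {1..N div k}"] by force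
  have "real N / real k \<ge> 0" by simp
  then show ?thesis using M A_up A_lo B_lo B_up by (simp add: abs_le_iff)
qed

text \<open>Every block of \<open>a\<close> consecutive integers contains exactly one solution, and
  \<open>{1..m}\<close> lies between \<open>m div a\<close> and \<open>m div a + 1\<close> full
  blocks.\<close>

lemma card_residue_class:
  fixes a b n m :: nat
  assumes "coprime a b" "a > 0"
  shows "m div a \<le> card {y\<in>{1..m}. [b * y = n] (mod a)}"
    and "card {y\<in>{1..m}. [b * y = n] (mod a)} \<le> m div a + 1"
proof -
  define S where "S = (\<lambda>m. {y\<in>{1..m}. [b * y = n] (mod a)})"
  obtain c where c: "[b * c = 1] (mod a)"
    using assms cong_solve_coprime_nat[of b a] by (auto simp: coprime_commute)
  have iff: "[b * y = n] (mod a) \<longleftrightarrow> y mod a = (c * n) mod a" for y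
  proof -
    have "[b * y = n] (mod a) \<longleftrightarrow> [b * y = b * (c * n)] (mod a)"
      using cong_scalar_right[OF c, of n] by (metis cong_sym cong_trans mult.assoc mult_1)
    also have "\<dots> \<longleftrightarrow> [y = c * n] (mod a)"
      using assms by (intro cong_mult_lcancel_nat) (simp add: coprime_commute)
    finally show ?thesis by (simp add: unique_euclidean_semiring_class.cong_def)
  qed
  have blk: "card (S (a * j)) = j" for j
  proof (induction j)
    case (Suc j)
    let ?r = "(c * n) mod a"
    have r: "?r < a" using assms by simp
    define y0 where "y0 = (if ?r = 0 then a * Suc j else a * j + ?r)"
    have "S (a * Suc j) = insert y0 (S (a * j))"
    proof (rule set_eqI)
      fix y
      have "y mod a = ?r \<and> a * j < y \<and> y \<le> a * Suc j \<longleftrightarrow> y = y0"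
      proof
        assume y: "y mod a = ?r \<and> a * j < y \<and> y \<le> a * Suc j"
        show "y = y0"
        proof (cases "y = a * Suc j")
          case True
          then show ?thesis using y by (simp add: y0_def)
        next
          case False
          then have "y div a = j"
            using y by (metis div_nat_eqI le_neq_implies_less less_imp_le mult.commute mult_Suc_right add.commute)
          then have "y = a * j + ?r" using y by (metis mult_div_mod_eq)
          then show ?thesis using y by (auto simp: y0_def)
        qed
      next
        assume "y = y0"
        then show "y mod a = ?r \<and> a * j < y \<and> y \<le> a * Suc j"
          using r assms by (auto simp: y0_def)
      qed
      then show "y \<in> S (a * Suc j) \<longleftrightarrow> y \<in> insert y0 (S (a * j))"
        by (auto simp: S_def iff)
    qed
    moreover have "y0 \<notin> S (a * j)" using assms by (auto simp: S_def y0_def)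
    moreover have "finite (S (a * j))" by (simp add: S_def)
    ultimately show ?case using Suc by simp
  qed (simp add: S_def)
  have mono: "S x \<subseteq> S y" if "x \<le> y" for x y using that by (auto simp: S_def)
  have fin: "finite (S x)" for x by (simp add: S_def)
  have "a * (m div a) \<le> m" by simp
  from card_mono[OF fin mono[OF this]] show "m div a \<le> card {y\<in>{1..m}. [b * y = n] (mod a)}"
    unfolding blk by (simp add: S_def)
  have "m \<le> a * (m div a + 1)"
    using assms by (metis add.commute dividend_less_times_div less_imp_le mult_Suc_right Suc_eq_plus1)
  from card_mono[OF fin mono[OF this]] show "card {y\<in>{1..m}. [b * y = n] (mod a)} \<le> m div a + 1"
    unfolding blk by (simp add: S_def)
qed

text \<open>If \<open>s u + t v = N\<close> and \<open>u\<close>, \<open>v\<close> are coprime, then \<open>gcd s v = gcd v N\<close>: the number of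
  solutions \<open>t\<close> for a given \<open>s\<close> is compensated by the divisibility of \<open>s\<close>.\<close>
lemma card_splits_fixed_v:
  assumes v: "1 \<le> v"
  shows "card {(s,t,u). 1 \<le> t \<and> t \<le> s \<and> s \<le> T \<and> coprime u v \<and> s * u + t * v = N} \<le> 2 * T"
proof -
  define g where "g = gcd v N"
  have g0: "g > 0" using v by (simp add: g_def)
  define Sg where "Sg = (\<lambda>j. g * j) ` {1..T div g}"
  define Ts where "Ts = (\<lambda>s. {t\<in>{1..s}. [v * t = N] (mod s)})"
  let ?X = "{(s,t,u). 1 \<le> t \<and> t \<le> s \<and> s \<le> T \<and> coprime u v \<and> s * u + t * v = N}"
  have key: "g dvd s \<and> gcd s v = g \<and> t \<in> Ts s" if "(s,t,u) \<in> ?X" for s t u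
  proof -
    have *: "1 \<le> t" "t \<le> s" "coprime u v" "s * u + t * v = N" using that by auto
    have "gcd v N = gcd v (s * u)" using *(4)
      by (metis add.commute gcd_add_mult mult.commute)
    also have "\<dots> = gcd v s" using *(3)
      by (metis coprime_commute gcd_mult_right_right_cancel)
    finally have "gcd s v = g" by (simp add: g_def gcd.commute)
    moreover have "[v * t = N] (mod s)" using *(4)
      by (metis add.commute unique_euclidean_semiring_class.cong_def mod_mult_self2 mult.commute)
    ultimately show ?thesis using * by (auto simp: Ts_def)
  qed
  \<comment> \<open>Dividing the congruence by \<open>g\<close> leaves a modulus
    \<open>s div g\<close> coprime to \<open>v div g\<close>, so the interval \<open>{1..s}\<close>
    contains at most \<open>g + 1\<close> solutions.\<close>
  have Ts: "card {t\<in>Ts s. gcd s v = g} \<le> 2 * g" if s: "s \<in> Sg" for s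
  proof (cases "gcd s v = g \<and> s > 0")
    case True
    have dv: "g dvd s" "g dvd v" "g dvd N" using True g_def gcd_dvd1 gcd_dvd2 by metis+
    have "coprime (s div g) (v div g)" using True div_gcd_coprime[of s v] by auto
    moreover have "s div g > 0" using True dv by (metis dvd_div_eq_0_iff not_gr_zero)
    ultimately have "card {y\<in>{1..s}. [v div g * y = N div g] (mod (s div g))} \<le> s div (s div g) + 1"
      by (rule card_residue_class)
    moreover have "s div (s div g) = g" using dv True
      by (metis dvd_div_eq_0_iff dvd_div_mult_self nonzero_mult_div_cancel_left not_gr_zero)
    moreover have "[v * y = N] (mod s) \<longleftrightarrow> [v div g * y = N div g] (mod (s div g))" for y
    proof -
      obtain v' s' n' where e: "v = g * v'" "s = g * s'" "N = g * n'" using dv by (auto elim!: dvdE)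
      show ?thesis using g0 unfolding e
        by (simp add: unique_euclidean_semiring_class.cong_def mult.assoc mult_mod_right[symmetric])
    qed
    ultimately have "card {y\<in>{1..s}. [v * y = N] (mod s)} \<le> g + 1" by simp
    then show ?thesis using True g0 by (simp add: Ts_def)
  qed (use s g0 in \<open>auto simp: Ts_def Sg_def\<close>)
  have "?X \<subseteq> (\<lambda>(s,t). (s, t, (N - t * v) div s)) ` (SIGMA s:Sg. {t\<in>Ts s. gcd s v = g})"
  proof
    fix q assume q: "q \<in> ?X"
    obtain s t u where q': "q = (s,t,u)" by (cases q) auto
    have *: "1 \<le> t" "t \<le> s" "s \<le> T" "s * u + t * v = N" using q q' by auto
    have k: "g dvd s" "gcd s v = g" "t \<in> Ts s" using key q q' by auto
    have "u = (N - t * v) div s" using * by auto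
    moreover have "s \<in> Sg"
    proof -
      obtain j where j: "s = g * j" using k by (auto elim: dvdE)
      have "j \<ge> 1" using * j by (cases j) auto
      moreover have "j \<le> T div g" using * j g0 by (simp add: less_eq_div_iff_mult_less_eq mult.commute)
      ultimately show ?thesis using j by (auto simp: Sg_def)
    qed
    ultimately show "q \<in> (\<lambda>(s,t). (s, t, (N - t * v) div s)) ` (SIGMA s:Sg. {t\<in>Ts s. gcd s v = g})"
      using k q' by force
  qed
  moreover have fin: "finite (SIGMA s:Sg. {t\<in>Ts s. gcd s v = g})" by (auto simp: Sg_def Ts_def)
  ultimately have "card ?X \<le> card (SIGMA s:Sg. {t\<in>Ts s. gcd s v = g})"
    by (meson surj_card_le)
  also have "\<dots> = (\<Sum>s\<in>Sg. card {t\<in>Ts s. gcd s v = g})"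
    by (rule card_SigmaI) (auto simp: Sg_def Ts_def)
  also have "\<dots> \<le> (\<Sum>s\<in>Sg. 2 * g)" by (rule sum_mono) (rule Ts)
  also have "\<dots> = card Sg * (2 * g)" by simp
  also have "\<dots> \<le> (T div g) * (2 * g)"
    using card_image_le[of "{1..T div g}" "\<lambda>j. g * j"] by (auto simp: Sg_def)
  also have "\<dots> \<le> 2 * T" by (simp add: mult.assoc mult.left_commute)
  finally show ?thesis .
qed

section \<open>Brun's pure sieve\<close>

lemma sum_alternating_binomial:
  "(\<Sum>i\<le>r. (-1) ^ i * real (Suc n choose i)) = (-1) ^ r * real (n choose r)"
  by (induction r) (simp_all add: algebra_simps)

text \<open>For a set of \<open>Suc n\<close> elements the truncated alternating sum collapses to
  \<open>n choose r\<close> up to sign, which is at most \<open>Suc n choose Suc r\<close>, the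
  number of subsets at the first omitted level. As an absolute value the estimate serves both
  parities of \<open>r\<close>.\<close>

lemma bonferroni:
  assumes "finite T"
  shows "\<bar>of_bool (T = {}) - (\<Sum>D | D \<subseteq> T \<and> card D \<le> r. (-1) ^ card D)\<bar>
           \<le> real (card {D. D \<subseteq> T \<and> card D = Suc r})"
proof -
  have fin: "finite {D. D \<subseteq> T \<and> P D}" for P
    using finite_Pow_iff[THEN iffD2, OF assms] by (rule rev_finite_subset) auto
  have "(\<Sum>D | D \<subseteq> T \<and> card D \<le> r. (-1) ^ card D) =
      (\<Sum>i\<in>{..r}. \<Sum>D\<in>{D\<in>{D. D \<subseteq> T \<and> card D \<le> r}. card D = i}. (-1) ^ card D :: real)"
    by (rule sum.group[symmetric]) (use fin in auto)
  also have "\<dots> = (\<Sum>i\<le>r. (-1) ^ i * real (card T choose i))"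
  proof (rule sum.cong)
    fix i assume "i \<in> {..r}"
    then have e: "{D\<in>{D. D \<subseteq> T \<and> card D \<le> r}. card D = i} = {D. D \<subseteq> T \<and> card D = i}" by auto
    have "(\<Sum>D\<in>{D. D \<subseteq> T \<and> card D = i}. (-1) ^ card D) = (\<Sum>D\<in>{D. D \<subseteq> T \<and> card D = i}. (-1) ^ i :: real)"
      by (rule sum.cong) auto
    then show "(\<Sum>D\<in>{D\<in>{D. D \<subseteq> T \<and> card D \<le> r}. card D = i}. (-1) ^ card D) = (-1) ^ i * real (card T choose i)"
      using assms by (simp only: e) (simp add: n_subsets)
  qed simp
  finally have S: "(\<Sum>D | D \<subseteq> T \<and> card D \<le> r. (-1) ^ card D) = (\<Sum>i\<le>r. (-1) ^ i * real (card T choose i))" .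
  show ?thesis
  proof (cases "T = {}")
    case True
    have "(\<Sum>i\<le>r. (-1) ^ i * real (0 choose i)) = (\<Sum>i\<in>{0}. (-1) ^ i * real (0 choose i))"
      by (rule sum.mono_neutral_right) (auto simp: binomial_eq_0)
    then show ?thesis unfolding S using True by simp
  next
    case False
    then obtain n where n: "card T = Suc n" using assms by (metis card_0_eq not0_implies_Suc)
    show ?thesis unfolding S n sum_alternating_binomial
      using False assms n by (simp add: n_subsets abs_mult)
  qed
qed

text \<open>Used with \<open>c = k\<close> and \<open>(a,b) = (s,t)\<close> to count the
  \<open>(u,v)\<close>, and with \<open>c = 1\<close> and \<open>(a,b) = (u,v)\<close> to count the
  \<open>(s,t)\<close>.\<close>

definition split_count :: "nat \<Rightarrow> nat \<Rightarrow> nat \<Rightarrow> nat \<Rightarrow> nat" where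
  "split_count c a b N = card {(x,y). 1 \<le> y \<and> c * y \<le> x \<and> coprime x y \<and> a * x + b * y = N}"

lemma prod_primes_dvd_iff:
  fixes x :: nat
  assumes "finite D" "\<And>p. p \<in> D \<Longrightarrow> prime p"
  shows "\<Prod>D dvd x \<longleftrightarrow> (\<forall>p\<in>D. p dvd x)"
  using assms
proof (induction D)
  case (insert p D)
  have "coprime p (\<Prod>D)"
    using insert.prems insert.hyps by (intro prod_coprime_right primes_coprime) auto
  then show ?case using insert
    by (auto intro: divides_mult dvd_mult_left dvd_mult_right)
qed auto

text \<open>Dividing by \<open>d\<close> gives the same problem for \<open>N div d\<close>. There
  \<open>x\<close> is determined by \<open>y\<close>, the ratio condition says that \<open>y\<close>
  is at most \<open>N / d\<close> divided by \<open>c * a + b\<close>, and the equation places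
  \<open>y\<close> in one residue class modulo \<open>a\<close>. For the sieve it is essential that
  the error is bounded independently of \<open>d\<close>.\<close>

lemma card_multiples_in_splits:
  fixes a b c d N :: nat
  assumes ab: "coprime a b" and a: "a \<ge> 1" and b: "b \<ge> 1" and d: "d dvd N" and N: "N > 0"
  shows "\<bar>real (card {(x,y). 1 \<le> y \<and> c * y \<le> x \<and> a * x + b * y = N \<and> d dvd x \<and> d dvd y})
           - real N / real (a * (c * a + b)) / real d\<bar> \<le> 2"
proof -
  obtain n where n: "N = d * n" using d by (auto elim: dvdE)
  have d0: "d > 0" "n > 0" using n N by auto
  define e where "e = c * a + b"
  have e0: "e > 0" using b by (simp add: e_def)
  define m where "m = n div e"
  let ?Y = "{y\<in>{1..m}. [b * y = n] (mod a)}"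
  let ?X = "{(x,y). 1 \<le> y \<and> c * y \<le> x \<and> a * x + b * y = N \<and> d dvd x \<and> d dvd y}"
  have "bij_betw (\<lambda>y. (d * ((n - b * y) div a), d * y)) ?Y ?X"
  proof (rule bij_betw_byWitness[where f' = "\<lambda>(x,y). y div d"])
    show "(\<lambda>y. (d * ((n - b * y) div a), d * y)) ` ?Y \<subseteq> ?X"
    proof clarify
      fix y assume y: "y \<in> {1..m}" "[b * y = n] (mod a)"
      have "e * y \<le> n" using y e0
        by (simp add: m_def less_eq_div_iff_mult_less_eq mult.commute)
      then have le: "c * a * y + b * y \<le> n" by (simp add: e_def algebra_simps)
      then have "a dvd n - b * y" using y(2)
        by (metis add_leD2 cong_altdef_nat cong_sym)
      then obtain x where x: "n - b * y = a * x" by (auto elim: dvdE)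
      have "a * (c * y) \<le> a * x" unfolding x[symmetric] using le by (simp add: mult_ac)
      then have cx: "c * y \<le> x" using a by simp
      have nx: "a * x + b * y = n" using x le by linarith
      have "(n - b * y) div a = x" using x a by simp
      moreover have "c * (d * y) \<le> d * x" using cx by (metis mult.left_commute mult_le_mono2)
      moreover have "a * (d * x) + b * (d * y) = N"
        unfolding n nx[symmetric] by (simp add: algebra_simps)
      ultimately show "1 \<le> d * y \<and> c * (d * y) \<le> d * ((n - b * y) div a) \<and>
         a * (d * ((n - b * y) div a)) + b * (d * y) = N \<and> d dvd d * ((n - b * y) div a) \<and> d dvd d * y"
        using y d0 by (auto simp: Suc_le_eq)
    qed
    have inverse: "y div d \<in> ?Y \<and> (d * ((n - b * (y div d)) div a), d * (y div d)) = (x,y)"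
      if h: "1 \<le> y" "c * y \<le> x" "a * x + b * y = N" "d dvd x" "d dvd y" for x y
    proof -
      obtain x' y' where xy: "x = d * x'" "y = d * y'" using h by (auto elim!: dvdE)
      have "d * (a * x' + b * y') = d * n" using h n xy by (simp add: algebra_simps)
      then have nx: "a * x' + b * y' = n" using d0 by simp
      have "d * (c * y') \<le> d * x'" using h xy by (simp add: mult_ac)
      then have "c * y' \<le> x'" using d0 by simp
      then have "a * (c * y') \<le> a * x'" by simp
      then have "a * (c * y') + b * y' \<le> n" using nx by linarith
      then have "y' * e \<le> n" by (simp add: e_def algebra_simps)
      then have "y' \<le> m" using e0 by (simp add: m_def less_eq_div_iff_mult_less_eq)
      moreover have "y' \<ge> 1" using h xy by (cases y') auto
      moreover have "[b * y' = n] (mod a)" using nx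
        by (metis add.commute unique_euclidean_semiring_class.cong_def mod_mult_self2 mult.commute)
      moreover have "(n - b * y') div a = x'" using nx a by auto
      ultimately show ?thesis using xy d0 by simp
    qed
    show "(\<lambda>(x,y). y div d) ` ?X \<subseteq> ?Y" using inverse by fast
    show "\<forall>q\<in>?X. (\<lambda>y. (d * ((n - b * y) div a), d * y)) ((\<lambda>(x,y). y div d) q) = q"
      using inverse by fast
    show "\<forall>y\<in>?Y. (\<lambda>(x,y). y div d) (d * ((n - b * y) div a), d * y) = y" using d0 by simp
  qed
  then have X: "card ?X = card ?Y" by (rule bij_betw_same_card[symmetric])
  have lo: "m div a \<le> card ?Y" and up: "card ?Y \<le> m div a + 1"
    using card_residue_class[OF ab, of m n] a by auto
  have q: "m div a = n div (a * e)" unfolding m_def by (metis div_mult2_eq mult.commute)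
  have r: "real N / real (a * e) / real d = real n / real (a * e)" using n d0 by simp
  have "real (n div (a * e)) \<le> real n / real (a * e)" by (rule of_nat_div_le_divide)
  moreover have "real n / real (a * e) \<le> real (n div (a * e)) + 1"
  proof -
    have "n \<le> a * e * (n div (a * e) + 1)"
      using e0 a by (metis Suc_eq_plus1 dividend_less_times_div less_imp_le mult_Suc_right add.commute mult_pos_pos less_le_trans zero_less_one)
    then have "real n \<le> real (a * e) * (real (n div (a * e)) + 1)"
      by (metis of_nat_1 of_nat_add of_nat_le_iff of_nat_mult)
    then show ?thesis using e0 a by (simp add: pos_divide_le_eq mult.commute)
  qed
  moreover have "real (n div (a * e)) \<le> real (card ?Y)" "real (card ?Y) \<le> real (n div (a * e)) + 1"
    using lo up unfolding q by linarith+
  ultimately show ?thesis unfolding X r e_def[symmetric] by linarith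
qed

definition sieve_tail :: "nat \<Rightarrow> nat \<Rightarrow> real" where
  "sieve_tail r N = (\<Sum>D | D \<subseteq> prime_factors N \<and> r < card D. 1 / real (\<Prod>D))"

text \<open>The level is \<open>Suc r\<close> because the error term of \<open>bonferroni\<close>
  uses the subsets of that size as well; each of them has to be counted with its own rounding
  error.\<close>

definition sieve_terms :: "nat \<Rightarrow> nat \<Rightarrow> nat" where
  "sieve_terms r N = card {D. D \<subseteq> prime_factors N \<and> card D \<le> Suc r}"

text \<open>Inclusion-exclusion over the primes dividing both \<open>x\<close> and \<open>y\<close>,
  all of which divide \<open>N\<close>. Every set of primes costs a rounding error of at most 2. The
  tail enters twice: for completing the truncated main term to the full product, and for the
  remainder of \<open>bonferroni\<close>.\<close>

lemma split_count_sieve: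
  fixes a b c N r :: nat
  assumes ab: "coprime a b" and a: "a \<ge> 1" and b: "b \<ge> 1" and N: "N > 0"
  defines "X \<equiv> real N / real (a * (c * a + b))"
  shows "\<bar>real (split_count c a b N) - real (totient N) / real (a * (c * a + b))\<bar>
           \<le> 2 * real (sieve_terms r N) + 2 * X * sieve_tail r N"
proof -
  define P where "P = prime_factors N"
  define U where "U = {(x,y). 1 \<le> y \<and> c * y \<le> x \<and> a * x + b * y = N}"
  define T where "T = (\<lambda>(x,y). {p\<in>P. p dvd x \<and> p dvd y})"
  define F where "F = {D. D \<subseteq> P \<and> card D \<le> r}"
  define F1 where "F1 = {D. D \<subseteq> P \<and> card D = Suc r}"
  define G where "G = {D. D \<subseteq> P \<and> r < card D}"
  define g where "g = (\<lambda>D. real (card {q\<in>U. D \<subseteq> T q}))"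
  have finP: "finite P" by (simp add: P_def)
  have finPow: "finite {D. D \<subseteq> P \<and> Q D}" for Q
    using finite_Pow_iff[THEN iffD2, OF finP] by (rule rev_finite_subset) auto
  have finF: "finite F" "finite F1" "finite G" by (auto simp: F_def F1_def G_def finPow)
  have finT: "finite (T q)" for q using finP by (cases q) (auto simp: T_def)
  have TP: "T q \<subseteq> P" for q by (cases q) (auto simp: T_def)
  have X0: "X \<ge> 0" by (simp add: X_def)
  have finU: "finite U"
  proof (rule finite_subset)
    show "U \<subseteq> {..N} \<times> {..N}"
    proof clarify
      fix x y assume "(x,y) \<in> U"
      then have "a * x + b * y = N" by (simp add: U_def)
      moreover have "x \<le> a * x" "y \<le> b * y" using a b by auto
      ultimately show "x \<in> {..N} \<and> y \<in> {..N}" by (simp only: atMost_iff) linarith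
    qed
  qed auto
  have cop: "coprime x y \<longleftrightarrow> T (x,y) = {}" if "(x,y) \<in> U" for x y
  proof
    assume *: "coprime x y"
    show "T (x,y) = {}"
    proof (rule ccontr)
      assume "T (x,y) \<noteq> {}"
      then obtain p where "p \<in> P" "p dvd x" "p dvd y" by (auto simp: T_def)
      then have "p dvd 1" using * coprime_common_divisor by blast
      moreover have "prime p" using \<open>p \<in> P\<close> by (auto simp: P_def)
      ultimately show False by simp
    qed
  next
    assume *: "T (x,y) = {}"
    show "coprime x y"
    proof (rule ccontr)
      assume "\<not> coprime x y"
      then have "gcd x y \<noteq> 1" by (simp add: coprime_iff_gcd_eq_1)
      then obtain p where p: "prime p" "p dvd gcd x y" using prime_factor_nat by blast
      then have "p dvd x" "p dvd y" by auto
      moreover from this have "p dvd N" using that by (auto simp: U_def)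
      ultimately have "p \<in> T (x,y)" using p N by (auto simp: T_def P_def prime_factors_dvd)
      then show False using * by simp
    qed
  qed
  have "split_count c a b N = card (U \<inter> {q. T q = {}})"
    unfolding split_count_def using cop by (intro arg_cong[of _ _ card]) (auto simp: U_def)
  then have sc: "real (split_count c a b N) = (\<Sum>q\<in>U. of_bool (T q = {}))"
    using finU by (simp add: sum_of_bool_eq)
  have swap: "(\<Sum>q\<in>U. \<Sum>D\<in>{D\<in>H. D \<subseteq> T q}. f D) = (\<Sum>D\<in>H. f D * g D)"
    if "finite H" for H and f :: "nat set \<Rightarrow> real"
  proof -
    have "(\<Sum>q\<in>U. \<Sum>D\<in>{D\<in>H. D \<subseteq> T q}. f D) = (\<Sum>q\<in>U. \<Sum>D\<in>H. f D * of_bool (D \<subseteq> T q))"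
    proof (rule sum.cong)
      fix q
      have "(\<Sum>D\<in>{D\<in>H. D \<subseteq> T q}. f D) = (\<Sum>D\<in>H. if D \<subseteq> T q then f D else 0)"
        using that by (rule sum.inter_filter)
      then show "(\<Sum>D\<in>{D\<in>H. D \<subseteq> T q}. f D) = (\<Sum>D\<in>H. f D * of_bool (D \<subseteq> T q))"
        by (simp add: of_bool_def if_distrib cong: if_cong)
    qed simp
    also have "\<dots> = (\<Sum>D\<in>H. \<Sum>q\<in>U. f D * of_bool (D \<subseteq> T q))" by (rule sum.swap)
    also have "\<dots> = (\<Sum>D\<in>H. f D * g D)"
      using finU by (intro sum.cong) (auto simp: g_def sum_distrib_left[symmetric] sum_of_bool_eq Int_def)
    finally show ?thesis .
  qed
  have sub: "{D. D \<subseteq> T q \<and> card D \<le> r} = {D\<in>F. D \<subseteq> T q}"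
            "{D. D \<subseteq> T q \<and> card D = Suc r} = {D\<in>F1. D \<subseteq> T q}" for q
    using TP[of q] by (auto simp: F_def F1_def)
  have bonf: "\<bar>of_bool (T q = {}) - (\<Sum>D\<in>{D\<in>F. D \<subseteq> T q}. (-1) ^ card D)\<bar>
      \<le> (\<Sum>D\<in>{D\<in>F1. D \<subseteq> T q}. (1::real))" for q
    using bonferroni[OF finT, of q r] unfolding sub by simp
  have 1: "\<bar>real (split_count c a b N) - (\<Sum>D\<in>F. (-1) ^ card D * g D)\<bar> \<le> (\<Sum>D\<in>F1. g D)"
  proof -
    have "real (split_count c a b N) - (\<Sum>D\<in>F. (-1) ^ card D * g D) =
      (\<Sum>q\<in>U. of_bool (T q = {}) - (\<Sum>D\<in>{D\<in>F. D \<subseteq> T q}. (-1) ^ card D))"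
      unfolding sc swap[OF finF(1), symmetric] by (simp add: sum_subtractf)
    also have "\<bar>\<dots>\<bar> \<le> (\<Sum>q\<in>U. \<bar>of_bool (T q = {}) - (\<Sum>D\<in>{D\<in>F. D \<subseteq> T q}. (-1) ^ card D)\<bar>)"
      by (rule sum_abs)
    also have "\<dots> \<le> (\<Sum>q\<in>U. \<Sum>D\<in>{D\<in>F1. D \<subseteq> T q}. (1::real))"
      by (rule sum_mono) (rule bonf)
    also have "\<dots> = (\<Sum>D\<in>F1. g D)" using swap[OF finF(2), of "\<lambda>_. 1"] by simp
    finally show ?thesis .
  qed
  have g: "\<bar>g D - X / real (\<Prod>D)\<bar> \<le> 2" if "D \<subseteq> P" for D
  proof -
    have D: "finite D" "\<And>p. p \<in> D \<Longrightarrow> prime p" "\<And>p. p \<in> D \<Longrightarrow> p dvd N"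
      using that finP finite_subset by (auto simp: P_def)
    have iff: "\<Prod>D dvd x \<longleftrightarrow> (\<forall>p\<in>D. p dvd x)" for x
      using D by (intro prod_primes_dvd_iff) auto
    have "{q\<in>U. D \<subseteq> T q} = {(x,y). 1 \<le> y \<and> c * y \<le> x \<and> a * x + b * y = N \<and> \<Prod>D dvd x \<and> \<Prod>D dvd y}"
      using that unfolding iff by (auto simp: U_def T_def)
    moreover have "\<Prod>D dvd N" using iff D by blast
    ultimately show ?thesis
      using card_multiples_in_splits[OF ab a b _ N, of "\<Prod>D" c] by (simp add: g_def X_def)
  qed
  \<comment> \<open>Expanding the Euler product of the totient function over all sets of primes of
    \<open>N\<close>.\<close>
  have mu: "(\<Sum>D\<in>Pow P. (-1) ^ card D / real (\<Prod>D)) = real (totient N) / real N"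
  proof -
    have "(\<Prod>p\<in>P. 1 - 1 / real p) = (\<Prod>p\<in>P. - (1 / real p) + 1)" by simp
    also have "\<dots> = (\<Sum>D\<in>Pow P. (\<Prod>p\<in>D. - (1 / real p)) * (\<Prod>p\<in>P-D. 1))"
      by (rule prod_add[OF finP])
    also have "\<dots> = (\<Sum>D\<in>Pow P. (-1) ^ card D / real (\<Prod>D))"
      by (intro sum.cong) (auto simp: prod_uminus prod_dividef)
    finally show ?thesis using N by (simp add: totient_formula2 P_def)
  qed
  have PF: "Pow P = F \<union> G" "F \<inter> G = {}" by (auto simp: F_def G_def)
  have tail: "\<bar>(\<Sum>D\<in>F. (-1) ^ card D / real (\<Prod>D)) - real (totient N) / real N\<bar> \<le> sieve_tail r N"
  proof -
    have "(\<Sum>D\<in>F. (-1) ^ card D / real (\<Prod>D)) - real (totient N) / real N =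
        - (\<Sum>D\<in>G. (-1) ^ card D / real (\<Prod>D))"
      unfolding mu[symmetric] PF(1) using finF PF(2) by (simp add: sum.union_disjoint)
    also have "\<bar>\<dots>\<bar> \<le> (\<Sum>D\<in>G. \<bar>(-1) ^ card D / real (\<Prod>D)\<bar>)"
      by (simp only: abs_minus_cancel sum_abs)
    also have "\<dots> = sieve_tail r N"
      unfolding sieve_tail_def G_def P_def by (intro sum.cong) (auto simp: abs_mult prod_nonneg)
    finally show ?thesis .
  qed
  have 2: "\<bar>(\<Sum>D\<in>F. (-1) ^ card D * g D) - X * (\<Sum>D\<in>F. (-1) ^ card D / real (\<Prod>D))\<bar> \<le> 2 * real (card F)"
  proof -
    have "(\<Sum>D\<in>F. (-1) ^ card D * g D) - X * (\<Sum>D\<in>F. (-1) ^ card D / real (\<Prod>D)) =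
       (\<Sum>D\<in>F. (-1) ^ card D * (g D - X / real (\<Prod>D)))"
      unfolding sum_distrib_left sum_subtractf[symmetric] by (intro sum.cong) (auto simp: algebra_simps)
    also have "\<bar>\<dots>\<bar> \<le> (\<Sum>D\<in>F. \<bar>(-1) ^ card D * (g D - X / real (\<Prod>D))\<bar>)" by (rule sum_abs)
    also have "\<dots> \<le> (\<Sum>D\<in>F. 2)"
      by (rule sum_mono) (use g in \<open>auto simp: abs_mult F_def\<close>)
    finally show ?thesis by simp
  qed
  \<comment> \<open>Level \<open>Suc r\<close> is part of the tail \<open>G\<close>, so its main
    terms are absorbed by \<open>sieve_tail\<close>.\<close>
  have 3: "(\<Sum>D\<in>F1. g D) \<le> X * sieve_tail r N + 2 * real (card F1)"
  proof -
    have "(\<Sum>D\<in>F1. g D) \<le> (\<Sum>D\<in>F1. X * (1 / real (\<Prod>D)) + 2)"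
      using g by (intro sum_mono) (force simp: F1_def abs_le_iff)
    also have "\<dots> = X * (\<Sum>D\<in>F1. 1 / real (\<Prod>D)) + 2 * real (card F1)"
      by (simp add: sum.distrib sum_distrib_left)
    also have "(\<Sum>D\<in>F1. 1 / real (\<Prod>D)) \<le> (\<Sum>D\<in>G. 1 / real (\<Prod>D))"
      by (rule sum_mono2[OF finF(3)]) (auto simp: F1_def G_def prod_nonneg)
    finally show ?thesis using X0 by (simp add: sieve_tail_def G_def P_def mult_left_mono)
  qed
  have "{D. D \<subseteq> P \<and> card D \<le> Suc r} = F \<union> F1" "F \<inter> F1 = {}" by (auto simp: F_def F1_def)
  then have 4: "real (sieve_terms r N) = real (card F) + real (card F1)"
    using finF by (simp add: sieve_terms_def P_def[symmetric] card_Un_disjoint)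
  have "X * (real (totient N) / real N) = real (totient N) / real (a * (c * a + b))"
    using N by (simp add: X_def)
  moreover have "\<bar>X * (\<Sum>D\<in>F. (-1) ^ card D / real (\<Prod>D)) - X * (real (totient N) / real N)\<bar>
      \<le> X * sieve_tail r N"
    unfolding right_diff_distrib[symmetric] abs_mult using mult_left_mono[OF tail X0] X0 by simp
  ultimately show ?thesis using 1 2 3 4 by linarith
qed

text \<open>Rankin's trick: on sets with more than \<open>r\<close> primes the weight
  \<open>l ^ card D / l ^ (r + 1)\<close> is at least 1. The sum over all sets is then an Euler
  product, and Bernoulli's inequality bounds \<open>1 + l / p\<close> by the \<open>l\<close>-th
  power of \<open>1 / (1 - 1 / p)\<close>. Hence a bound for \<open>N / totient N\<close> is all
  that is needed to control the tail.\<close>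

lemma sieve_tail_bound:
  fixes l :: nat
  assumes N: "N > 0" and l: "l \<ge> 1"
  shows "sieve_tail r N \<le> (real N / real (totient N)) ^ l / real l ^ (r + 1)"
proof -
  define P where "P = prime_factors N"
  have finP: "finite P" by (simp add: P_def)
  have p2: "p \<ge> 2" if "p \<in> P" for p using that prime_ge_2_nat by (auto simp: P_def dest: in_prime_factors_imp_prime)
  define G where "G = {D. D \<subseteq> P \<and> r < card D}"
  have "sieve_tail r N * real l ^ (r + 1) = (\<Sum>D\<in>G. real l ^ (r + 1) / real (\<Prod>D))"
    by (simp add: sieve_tail_def G_def P_def sum_distrib_right)
  also have "\<dots> \<le> (\<Sum>D\<in>G. real l ^ card D / real (\<Prod>D))"
    using l by (intro sum_mono divide_right_mono power_increasing) (auto simp: G_def prod_nonneg)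
  also have "\<dots> \<le> (\<Sum>D\<in>Pow P. real l ^ card D / real (\<Prod>D))"
    using finP by (intro sum_mono2) (auto simp: G_def prod_nonneg)
  also have "\<dots> = (\<Sum>D\<in>Pow P. (\<Prod>p\<in>D. real l / real p) * (\<Prod>p\<in>P-D. 1))"
    by (intro sum.cong) (auto simp: prod_dividef)
  also have "\<dots> = (\<Prod>p\<in>P. real l / real p + 1)"
    by (rule prod_add[OF finP, symmetric])
  also have "\<dots> \<le> (\<Prod>p\<in>P. (1 / (1 - 1 / real p)) ^ l)"
  proof (intro prod_mono conjI)
    fix p assume "p \<in> P"
    then have p: "real p \<ge> 2" using p2 by fastforce
    have "real l / real p + 1 \<le> (1 + 1 / real p) ^ l"
      using Bernoulli_inequality[of "1 / real p" l] p by (simp add: add.commute order_trans[of _ 0])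
    also have "\<dots> \<le> (1 / (1 - 1 / real p)) ^ l"
    proof (rule power_mono)
      have "(1 + 1 / real p) * (1 - 1 / real p) \<le> 1" using p by (simp add: field_simps)
      then show "1 + 1 / real p \<le> 1 / (1 - 1 / real p)" using p by (simp add: pos_le_divide_eq)
    qed simp
    finally show "real l / real p + 1 \<le> (1 / (1 - 1 / real p)) ^ l" .
  qed auto
  also have "\<dots> = (1 / (\<Prod>p\<in>P. 1 - 1 / real p)) ^ l"
    by (simp only: prod_power_distrib[symmetric] prod_dividef prod.neutral_const)
  also have "(1 / (\<Prod>p\<in>P. 1 - 1 / real p)) = real N / real (totient N)"
    using N by (simp add: totient_formula2 P_def)
  finally show ?thesis using l by (simp add: pos_le_divide_eq)
qed

text \<open>A set of at most \<open>m\<close> elements arises from \<open>m\<close> choices, each of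
  which adds an element of \<open>P\<close> or nothing.\<close>

lemma card_subsets_le:
  assumes "finite P"
  shows "card {D. D \<subseteq> P \<and> card D \<le> m} \<le> (card P + 1) ^ m"
proof (induction m)
  case 0
  have "{D. D \<subseteq> P \<and> card D \<le> 0} = {{}}" using assms by (auto dest: finite_subset)
  then show ?case by simp
next
  case (Suc m)
  let ?F = "\<lambda>m. {D. D \<subseteq> P \<and> card D \<le> m}"
  have fin: "finite (?F m)" for m using finite_Pow_iff[THEN iffD2, OF assms] by (rule rev_finite_subset) auto
  have "?F (Suc m) \<subseteq> (\<lambda>(D,x). case x of None \<Rightarrow> D | Some p \<Rightarrow> insert p D) ` (?F m \<times> (insert None (Some ` P)))"
  proof
    fix D assume D: "D \<in> ?F (Suc m)"
    show "D \<in> (\<lambda>(D,x). case x of None \<Rightarrow> D | Some p \<Rightarrow> insert p D) ` (?F m \<times> (insert None (Some ` P)))"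
    proof (cases "D = {}")
      case True
      then show ?thesis by (intro image_eqI[where x = "({}, None)"]) auto
    next
      case False
      then obtain p where p: "p \<in> D" by auto
      have fD: "finite D" using D assms finite_subset by auto
      then have "card (D - {p}) \<le> m" using D p by auto
      then show ?thesis using D p
        by (intro image_eqI[where x = "(D - {p}, Some p)"]) auto
    qed
  qed
  then have "card (?F (Suc m)) \<le> card (?F m \<times> (insert None (Some ` P)))"
    using fin assms by (intro surj_card_le) auto
  also have "\<dots> = card (?F m) * (card P + 1)"
    using assms by (simp add: card_cartesian_product card_image)
  also have "\<dots> \<le> (card P + 1) ^ m * (card P + 1)" using Suc by (rule mult_le_mono1)
  finally show ?case by (simp add: mult.commute)
qed

lemma card_prime_factors_le:
  fixes N :: nat
  assumes "N > 0"
  shows "2 ^ card (prime_factors N) \<le> N"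
proof -
  have "\<Prod>(prime_factors N) dvd N"
    using prod_primes_dvd_iff[of "prime_factors N" N] assms by auto
  then have "\<Prod>(prime_factors N) \<le> N" using assms by (simp add: dvd_imp_le)
  moreover have "(\<Prod>p\<in>prime_factors N. 2) \<le> \<Prod>(prime_factors N)"
    by (rule prod_mono) (auto dest: in_prime_factors_imp_prime simp: prime_ge_2_nat)
  ultimately show ?thesis by simp
qed

section \<open>A lower bound for the totient function\<close>

lemma prod_prime_powers_dvd:
  fixes x :: nat
  assumes "finite D" "\<And>p. p \<in> D \<Longrightarrow> prime p" "\<And>p. p \<in> D \<Longrightarrow> p ^ e p dvd x"
  shows "(\<Prod>p\<in>D. p ^ e p) dvd x"
  using assms
proof (induction D)
  case (insert p D)
  have "coprime (p ^ e p) (\<Prod>p\<in>D. p ^ e p)"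
    using insert.prems insert.hyps
    by (intro prod_coprime_right) (auto intro!: primes_coprime coprime_power_left_iff[THEN iffD2] coprime_power_right_iff[THEN iffD2])
  then show ?case using insert by (auto intro: divides_mult)
qed auto

text \<open>The induction of Erdos. For odd \<open>n = 2 * m + 1\<close> the primes in
  \<open>{m + 2..n}\<close> all divide \<open>n choose m\<close>, which is at most
  \<open>4 ^ m\<close> since it occurs twice in its row of sum \<open>2 ^ n\<close>; the smaller
  primes are left to the induction. An even \<open>n > 2\<close> is not prime.\<close>

lemma primorial_le: "\<Prod>{p. prime p \<and> p \<le> n} \<le> (4::nat) ^ n"
proof (induction n rule: less_induct)
  case (less n)
  have fin: "finite {p. prime p \<and> p \<le> n \<and> Q p}" for Q and n :: nat
    by (rule finite_subset[of _ "{..n}"]) auto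
  show ?case
  proof (cases "n \<le> 2")
    case True
    then consider "n = 0" | "n = 1" | "n = 2" by linarith
    then show ?thesis
    proof cases
      case 3
      have "{p. prime p \<and> p \<le> 2} = {2::nat}" by (auto dest: prime_ge_2_nat)
      then show ?thesis using 3 by simp
    next
      case 1
      then have "{p. prime p \<and> p \<le> n} = {}" by auto
      then show ?thesis by (simp only: prod.empty) simp
    next
      case 2
      then have "{p. prime p \<and> p \<le> n} = {}" by (auto dest: prime_ge_2_nat)
      then show ?thesis by (simp only: prod.empty) simp
    qed
  next
    case n2: False
    show ?thesis
    proof (cases "even n")
      case True
      have "\<not> prime n" using True n2 prime_odd_nat[of n] by auto
      then have "{p. prime p \<and> p \<le> n} = {p. prime p \<and> p \<le> n - 1}"
        by (metis (mono_tags, lifting) Suc_pred' le_Suc_eq less_imp_le_nat n2 nle_le not_gr_zero zero_le)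
      then have "\<Prod>{p. prime p \<and> p \<le> n} \<le> 4 ^ (n - 1)" using less[of "n - 1"] n2 by simp
      also have "\<dots> \<le> 4 ^ n" by (intro power_increasing) auto
      finally show ?thesis .
    next
      case False
      then obtain m where m: "n = 2 * m + 1" by (auto elim: oddE)
      have m1: "m \<ge> 1" using m n2 by simp
      let ?A = "{p. prime p \<and> p \<le> m + 1}" and ?B = "{p. prime p \<and> p \<le> n \<and> m + 1 < p}"
      have "{p. prime p \<and> p \<le> n} = ?A \<union> ?B" using m by auto
      then have "\<Prod>{p. prime p \<and> p \<le> n} = \<Prod>?A * \<Prod>?B"
        using fin[of "m+1" "\<lambda>_. True"] fin[of n] by (simp add: prod.union_disjoint disjoint_iff)
      moreover have "\<Prod>?A \<le> 4 ^ (m + 1)" using less[of "m + 1"] m m1 by simp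
      moreover have "\<Prod>?B \<le> 4 ^ m"
      proof -
        have "p dvd (n choose m)" if "p \<in> ?B" for p
        proof -
          have p: "prime p" "p \<le> n" "m + 1 < p" using that by auto
          have "fact m * fact (n - m) * (n choose m) = fact n"
            using m by (intro binomial_fact_lemma) auto
          moreover have "p dvd fact n" using p by (simp add: prime_dvd_fact_iff)
          moreover have "\<not> p dvd fact m" "\<not> p dvd fact (n - m)"
            unfolding prime_dvd_fact_iff[OF p(1)] using p m by auto
          ultimately show ?thesis using p by (metis prime_dvd_mult_iff)
        qed
        then have "\<Prod>?B dvd (n choose m)"
          using prod_primes_dvd_iff[OF fin[of n], of "\<lambda>p. m + 1 < p" "n choose m"] by auto
        moreover have "n choose m > 0" using m by simp
        ultimately have "\<Prod>?B \<le> n choose m" by (rule dvd_imp_le)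
        moreover have "2 * (n choose m) \<le> 2 ^ n"
        proof -
          have "n choose (m + 1) = n choose m"
            using binomial_symmetric[of m n] m by simp
          then have "2 * (n choose m) = (\<Sum>i\<in>{m, m+1}. n choose i)" by simp
          also have "\<dots> \<le> (\<Sum>i\<le>n. n choose i)" using m by (intro sum_mono2) auto
          also have "\<dots> = 2 ^ n" by (rule choose_row_sum)
          finally show ?thesis .
        qed
        moreover have "(2::nat) ^ n = 2 * 4 ^ m" by (simp add: m power_mult)
        ultimately show ?thesis by simp
      qed
      ultimately have "\<Prod>{p. prime p \<and> p \<le> n} \<le> 4 ^ (m + 1) * 4 ^ m" by (simp add: mult_le_mono)
      also have "\<dots> = 4 ^ n" by (simp add: m mult_2 flip: power_add)
      finally show ?thesis .
    qed
  qed
qed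

lemma prime_power_dvd_fact: "p > 0 \<Longrightarrow> p ^ (n div p) dvd (fact n :: nat)"
proof -
  assume p: "p > 0"
  have "p ^ k dvd (fact (p * k) :: nat)" for k
  proof (induction k)
    case (Suc k)
    obtain j where j: "p * Suc k = Suc j" using p by (metis mult_pos_pos not0_implies_Suc not_gr0 zero_less_Suc less_not_refl)
    have "p * k \<le> j" using j p by auto
    then have "fact (p * k) dvd (fact j :: nat)" by (rule fact_dvd)
    then have "p ^ k dvd (fact j :: nat)" using Suc dvd_trans by blast
    moreover have "p dvd Suc j" by (metis dvd_triv_left j)
    ultimately have "p * p ^ k dvd Suc j * fact j" by (rule mult_dvd_mono[rotated])
    then show ?case unfolding j by simp
  qed simp
  then have "p ^ (n div p) dvd (fact (p * (n div p)) :: nat)" .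
  moreover have "fact (p * (n div p)) dvd (fact n :: nat)" by (rule fact_dvd) simp
  ultimately show ?thesis using dvd_trans by blast
qed

text \<open>The upper half of Mertens' first theorem. Each prime \<open>p\<close> divides
  \<open>fact n\<close> at least \<open>n div p\<close> times, and
  \<open>fact n \<le> n ^ n\<close>. Replacing \<open>n div p\<close> by \<open>n / p\<close> costs
  at most the sum of \<open>ln p\<close>, which \<open>primorial_le\<close> bounds by
  \<open>n * ln 4\<close>.\<close>

lemma sum_ln_prime_over_prime_le:
  assumes n: "n \<ge> 1"
  shows "(\<Sum>p | prime p \<and> p \<le> n. ln (real p) / real p) \<le> ln (real n) + ln 4"
proof -
  let ?P = "{p. prime p \<and> p \<le> n}"
  have fin: "finite ?P" by (rule finite_subset[of _ "{..n}"]) auto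
  have p1: "real p > 1" if "p \<in> ?P" for p using that prime_gt_1_nat by auto
  have "ln (real (\<Prod>?P)) = (\<Sum>p\<in>?P. ln (real p))"
    unfolding of_nat_prod using p1 by (subst ln_prod[OF fin]) force+
  moreover have "ln (real (\<Prod>?P)) \<le> ln (4 ^ n)"
  proof -
    have "real (\<Prod>?P) > 0" unfolding of_nat_0_less_iff by (rule prod_pos) (auto simp: prime_gt_0_nat)
    moreover have "real (\<Prod>?P) \<le> 4 ^ n" using primorial_le[of n] by (metis of_nat_le_iff of_nat_numeral of_nat_power)
    ultimately show ?thesis by (intro ln_mono) auto
  qed
  ultimately have theta: "(\<Sum>p\<in>?P. ln (real p)) \<le> real n * ln 4" by (simp add: ln_realpow)
  have "(\<Prod>p\<in>?P. p ^ (n div p)) dvd fact n"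
    using fin by (rule prod_prime_powers_dvd) (auto simp: prime_power_dvd_fact prime_gt_0_nat)
  then have "(\<Prod>p\<in>?P. p ^ (n div p)) \<le> fact n" by (simp add: dvd_imp_le)
  also have "fact n \<le> n ^ n" using fact_le_power[of n, where ?'a = nat] by simp
  finally have "(\<Prod>p\<in>?P. p ^ (n div p)) \<le> n ^ n" .
  then have "real (\<Prod>p\<in>?P. p ^ (n div p)) \<le> real (n ^ n)" by (simp only: of_nat_le_iff)
  moreover have "0 < real (\<Prod>p\<in>?P. p ^ (n div p))"
    unfolding of_nat_0_less_iff by (rule prod_pos) (auto simp: prime_gt_0_nat)
  ultimately have "ln (real (\<Prod>p\<in>?P. p ^ (n div p))) \<le> ln (real (n ^ n))"
    by (intro ln_mono)
  moreover have "ln (real (\<Prod>p\<in>?P. p ^ (n div p))) = (\<Sum>p\<in>?P. real (n div p) * ln (real p))"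
  proof -
    have "ln (\<Prod>p\<in>?P. real p ^ (n div p)) = (\<Sum>p\<in>?P. ln (real p ^ (n div p)))"
      using p1 by (subst ln_prod[OF fin]) force+
    also have "\<dots> = (\<Sum>p\<in>?P. real (n div p) * ln (real p))"
      using p1 by (intro sum.cong) (force simp: ln_realpow)+
    finally show ?thesis by simp
  qed
  ultimately have 1: "(\<Sum>p\<in>?P. real (n div p) * ln (real p)) \<le> real n * ln (real n)"
    using n by (simp add: ln_realpow)
  have "real n * (\<Sum>p\<in>?P. ln (real p) / real p) = (\<Sum>p\<in>?P. real n / real p * ln (real p))"
    by (simp add: sum_distrib_left)
  also have "\<dots> \<le> (\<Sum>p\<in>?P. (real (n div p) + 1) * ln (real p))"
  proof (intro sum_mono mult_right_mono)
    fix p assume p: "p \<in> ?P"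
    have "n \<le> p * (n div p + 1)" using p1[OF p]
      by (metis Suc_eq_plus1 dividend_less_times_div less_imp_le mult_Suc_right add.commute of_nat_0 of_nat_less_iff less_trans zero_less_one)
    then have "real n \<le> real p * (real (n div p) + 1)"
      by (metis of_nat_1 of_nat_add of_nat_le_iff of_nat_mult)
    then show "real n / real p \<le> real (n div p) + 1" using p1[OF p] by (simp add: pos_divide_le_eq mult.commute)
    show "ln (real p) \<ge> 0" using p1[OF p] by simp
  qed
  also have "\<dots> = (\<Sum>p\<in>?P. real (n div p) * ln (real p)) + (\<Sum>p\<in>?P. ln (real p))"
    by (simp add: algebra_simps sum.distrib)
  also have "\<dots> \<le> real n * (ln (real n) + ln 4)" using 1 theta by (simp add: algebra_simps)
  finally show ?thesis using n by simp
qed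

text \<open>The upper half of Mertens' second theorem. The partial summation against
  \<open>1 / ln n\<close> is carried out as an induction on \<open>B n - A n / ln n\<close>, whose
  increment is \<open>A n\<close> times the decrease of \<open>1 / ln n\<close>.\<close>

lemma sum_inverse_primes_le:
  obtains C where "C > 0" "\<And>n. n \<ge> 2 \<Longrightarrow> (\<Sum>p | prime p \<and> p \<le> n. 1 / real p) \<le> ln (ln (real n)) + C"
proof -
  define a where "a = (\<lambda>m. if prime m then ln (real m) / real m else 0)"
  define A where "A = (\<lambda>n. \<Sum>m=2..n. a m)"
  define B where "B = (\<lambda>n. \<Sum>m=2..n. a m / ln (real m))"
  define c where "c = ln (4::real)"
  have c0: "c > 0" by (simp add: c_def)
  have conv: "(\<Sum>m=2..n. if prime m then f m else 0) = (\<Sum>p | prime p \<and> p \<le> n. f p)" for f :: "nat \<Rightarrow> real" and n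
  proof -
    have "{2..n} \<inter> Collect prime = {p. prime p \<and> p \<le> n}" by (auto dest: prime_ge_2_nat)
    then show ?thesis by (simp add: sum.If_cases)
  qed
  have A: "A n \<le> ln (real n) + c" if "n \<ge> 1" for n
    unfolding A_def a_def conv c_def using sum_ln_prime_over_prime_le[OF that] .
  have B: "B n = (\<Sum>p | prime p \<and> p \<le> n. 1 / real p)" for n
    unfolding B_def conv[symmetric] a_def by (intro sum.cong) auto
  have key: "B n - A n / ln (real n) \<le> ln (ln (real n)) - ln (ln 2) + c * (1 / ln 2 - 1 / ln (real n))"
    if "n \<ge> 2" for n
    using that
  proof (induction n rule: dec_induct)
    case base
    then show ?case by (simp add: A_def B_def)
  next
    case (step n)
    have l: "ln (real n) > 0" "ln (real (Suc n)) > 0" "ln (real n) \<le> ln (real (Suc n))" using step by auto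
    have S: "A (Suc n) = A n + a (Suc n)" "B (Suc n) = B n + a (Suc n) / ln (real (Suc n))"
      using step by (auto simp: A_def B_def)
    define x y where "x = 1 / ln (real n)" and "y = 1 / ln (real (Suc n))"
    have xy: "x \<ge> y" unfolding x_def y_def using l by (intro divide_left_mono) auto
    have "B (Suc n) - A (Suc n) * y = (B n - A n * x) + A n * (x - y)"
      unfolding S y_def by (simp add: algebra_simps add_divide_distrib)
    also have "A n * (x - y) \<le> (ln (real n) + c) * (x - y)"
      using A[of n] step xy by (intro mult_right_mono) auto
    also have "(ln (real n) + c) * (x - y) = (1 - ln (real n) / ln (real (Suc n))) + c * (x - y)"
      using l by (simp add: x_def y_def field_simps)
    \<comment> \<open>The inequality \<open>ln q \<le> q - 1\<close> turns the increment into a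
      difference of values of \<open>ln (ln n)\<close>, so no integral is required.\<close>
    also have "1 - ln (real n) / ln (real (Suc n)) \<le> ln (ln (real (Suc n))) - ln (ln (real n))"
    proof -
      have "ln (ln (real n) / ln (real (Suc n))) \<le> ln (real n) / ln (real (Suc n)) - 1"
        using l by (intro ln_le_minus_one divide_pos_pos)
      then show ?thesis using l by (simp add: ln_div)
    qed
    finally show ?case using step.IH by (simp add: x_def y_def algebra_simps)
  qed
  define C where "C = 1 + 2 * (c / ln 2) + \<bar>ln (ln 2)\<bar>"
  show ?thesis
  proof (rule that[of C])
    show "C > 0" using c0 by (simp add: C_def add_pos_nonneg)
    fix n :: nat assume n: "n \<ge> 2"
    have l: "ln (real n) \<ge> ln 2" "ln (real n) > 0" "ln (2::real) > 0" using n by auto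
    have "A n / ln (real n) \<le> (ln (real n) + c) / ln (real n)"
      using A[of n] n l by (intro divide_right_mono) auto
    also have "\<dots> = 1 + c / ln (real n)" using l(2) by (simp add: add_divide_distrib)
    also have "\<dots> \<le> 1 + c / ln 2" 
      using c0 by (intro add_left_mono divide_left_mono l mult_pos_pos) auto
    finally have "B n \<le> 1 + c / ln 2 + ln (ln (real n)) - ln (ln 2) + c * (1 / ln 2 - 1 / ln (real n))"
      using key[OF n] by linarith
    moreover have "c * (1 / ln 2 - 1 / ln (real n)) \<le> c / ln 2"
    proof -
      have "c / ln (real n) \<ge> 0" using c0 l(2) by (intro divide_nonneg_pos) auto
      then show ?thesis by (simp add: algebra_simps)
    qed
    ultimately show "(\<Sum>p | prime p \<and> p \<le> n. 1 / real p) \<le> ln (ln (real n)) + C"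
      unfolding B[symmetric] C_def by linarith
  qed
qed

lemma sum_inverse_pred_mult_le: "(\<Sum>m=2..n. 1 / (real m * (real m - 1))) \<le> 1"
proof -
  have "(\<Sum>m=2..n. 1 / (real m * (real m - 1))) \<le> 1 - 1 / real n" if "n \<ge> 2" for n
    using that
  proof (induction n rule: dec_induct)
    case (step n)
    have "1 - 1 / real n + 1 / (real (Suc n) * (real (Suc n) - 1)) = 1 - 1 / real (Suc n)"
      using step by (simp add: divide_simps) (simp add: algebra_simps)
    then show ?case using step by simp
  qed simp
  from this[of n] show ?thesis by (cases "n \<ge> 2") (auto elim!: order_trans)
qed

text \<open>For \<open>N \<ge> 3\<close> the factor \<open>ln (ln N)\<close> stays above this
  positive number and can absorb constants.\<close>

lemma ln_ln_3_pos: "0 < ln (ln (3::real))"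
  using ln3_gt_1 by simp

lemma ln_ln_ge_ln_ln_3: "N \<ge> 3 \<Longrightarrow> ln (ln 3) \<le> ln (ln (real N))"
  using ln3_gt_1 by simp

lemma card_prime_factors_le_ln:
  assumes N: "N \<ge> (1::nat)"
  shows "real (card (prime_factors N)) \<le> 2 * ln (real N)"
proof -
  have "real (2 ^ card (prime_factors N)) \<le> real N"
    using card_prime_factors_le[of N] N by (simp only: of_nat_le_iff)
  then have "ln ((2::real) ^ card (prime_factors N)) \<le> ln (real N)" by (intro ln_mono) auto
  then have "real (card (prime_factors N)) * ln 2 \<le> ln (real N)" by (simp add: ln_realpow)
  moreover have "real (card (prime_factors N)) * (1/2) \<le> real (card (prime_factors N)) * ln 2"
    using ln2_ge_two_thirds by (intro mult_left_mono) auto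
  ultimately show ?thesis by linarith
qed

text \<open>The logarithm of \<open>N / totient N\<close> is, up to the convergent sum of
  \<open>1 / (p * (p - 1))\<close>, the sum of \<open>1 / p\<close> over the primes of
  \<open>N\<close>. Primes up to \<open>y\<close>, about \<open>ln N\<close>, are handled by
  Mertens' estimate; of the larger ones there are at most \<open>2 * ln N\<close>, so they
  contribute at most 2.\<close>

lemma totient_lower_bound:
  obtains K where "K > 0" "\<And>N. N \<ge> 3 \<Longrightarrow> real N / real (totient N) \<le> K * ln (ln (real N))"
proof -
  obtain C where C: "C > 0" "\<And>n. n \<ge> 2 \<Longrightarrow> (\<Sum>p | prime p \<and> p \<le> n. 1 / real p) \<le> ln (ln (real n)) + C"
    using sum_inverse_primes_le by blast
  \<comment> \<open>The 3 collects the large primes (2) and the sum of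
    \<open>1 / (p * (p - 1))\<close> (1). The other factor absorbs the \<open>ln 2\<close> arising
    from \<open>y \<le> 2 * ln N\<close>.\<close>
  define K where "K = exp (C + 3) * (ln 2 / ln (ln 3) + 1)"
  show ?thesis
  proof (rule that[of K])
    show "K > 0" using ln_ln_3_pos by (simp add: K_def add_pos_pos)
    fix N :: nat assume N: "N \<ge> 3"
    define P where "P = prime_factors N"
    have finP: "finite P" by (simp add: P_def)
    have p2: "p \<ge> 2" "prime p" if "p \<in> P" for p using that prime_ge_2_nat by (auto simp: P_def)
    have "ln 3 \<le> ln (real N)" using N by simp
    then have lnN: "ln (real N) > 1" using ln3_gt_1 by linarith
    define y where "y = nat \<lceil>ln (real N)\<rceil>"
    have y: "real y \<ge> ln (real N)" "real y \<le> 2 * ln (real N)" "y \<ge> 2"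
      using lnN unfolding y_def by linarith+
    have cP: "real (card P) \<le> 2 * ln (real N)"
      unfolding P_def using N by (intro card_prime_factors_le_ln) simp
    have "(\<Sum>p\<in>P. 1 / real p) \<le> (\<Sum>p\<in>{p\<in>P. p \<le> y}. 1 / real p) + (\<Sum>p\<in>{p\<in>P. p > y}. 1 / real p)"
      using finP by (subst sum.union_disjoint[symmetric]) (auto intro!: sum_mono2)
    also have "(\<Sum>p\<in>{p\<in>P. p \<le> y}. 1 / real p) \<le> (\<Sum>p | prime p \<and> p \<le> y. 1 / real p)"
      by (rule sum_mono2) (auto intro: finite_subset[of _ "{..y}"] dest: p2)
    also have "\<dots> \<le> ln (ln (real y)) + C" by (rule C(2)[OF y(3)])
    also have "(\<Sum>p\<in>{p\<in>P. p > y}. 1 / real p) \<le> (\<Sum>p\<in>{p\<in>P. p > y}. 1 / ln (real N))"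
      using y lnN by (intro sum_mono divide_left_mono) (auto intro: mult_pos_pos)
    also have "\<dots> \<le> real (card P) * (1 / ln (real N))"
      using lnN finP by (auto intro!: divide_right_mono card_mono)
    also have "\<dots> \<le> 2" using cP lnN by (simp add: field_simps)
    finally have 1: "(\<Sum>p\<in>P. 1 / real p) \<le> ln (ln (real y)) + C + 2" by simp
    have 2: "(\<Sum>p\<in>P. 1 / (real p * (real p - 1))) \<le> 1"
    proof -
      have "(\<Sum>p\<in>P. 1 / (real p * (real p - 1))) \<le> (\<Sum>m=2..Max P. 1 / (real m * (real m - 1)))"
        using finP p2 by (intro sum_mono2) auto
      then show ?thesis using sum_inverse_pred_mult_le[of "Max P"] by linarith
    qed
    have pos: "(\<Prod>p\<in>P. 1 - 1 / real p) > 0" using p2 by (intro prod_pos) force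
    have "ln (real N / real (totient N)) = - ln (\<Prod>p\<in>P. 1 - 1 / real p)"
    proof -
      have "real N / real (totient N) = 1 / (\<Prod>p\<in>P. 1 - 1 / real p)"
        unfolding totient_formula2 P_def[symmetric] using N by simp
      then show ?thesis using pos by (simp only: ln_div ln_one) simp
    qed
    also have "\<dots> = (\<Sum>p\<in>P. - ln (1 - 1 / real p))"
      using p2 by (subst ln_prod[OF finP]) (force simp: sum_negf)+
    also have "\<dots> \<le> (\<Sum>p\<in>P. 1 / real p + 1 / (real p * (real p - 1)))"
    proof (rule sum_mono)
      fix p assume p: "p \<in> P"
      have r: "real p \<ge> 2" using p2[OF p] by simp
      have "- ln (1 - 1 / real p) = ln (real p / (real p - 1))"
        using r by (simp add: diff_divide_eq_iff ln_div)
      also have "\<dots> = ln (1 + 1 / (real p - 1))" using r by (simp add: field_simps)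
      also have "\<dots> \<le> 1 / (real p - 1)" using r by (intro ln_add_one_self_le_self) auto
      also have "\<dots> = 1 / real p + 1 / (real p * (real p - 1))" using r by (simp add: field_simps)
      finally show "- ln (1 - 1 / real p) \<le> 1 / real p + 1 / (real p * (real p - 1))" .
    qed
    also have "\<dots> \<le> ln (ln (real y)) + (C + 3)" using 1 2 by (simp add: sum.distrib)
    finally have "ln (real N / real (totient N)) \<le> ln (ln (real y)) + (C + 3)" .
    then have "exp (ln (real N / real (totient N))) \<le> exp (ln (ln (real y)) + (C + 3))" by simp
    then have "real N / real (totient N) \<le> ln (real y) * exp (C + 3)"
      using N y by (simp add: exp_add)
    also have "ln (real y) \<le> ln (2 * ln (real N))" using y by simp
    also have "\<dots> = ln 2 + ln (ln (real N))" using lnN by (simp add: ln_mult)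
    also have "ln 2 \<le> ln 2 / ln (ln 3) * ln (ln (real N))"
      using ln_ln_3_pos ln_ln_ge_ln_ln_3[OF N] by (simp add: pos_le_divide_eq)
    finally show "real N / real (totient N) \<le> K * ln (ln (real N))"
      by (simp add: K_def algebra_simps)
  qed
qed

section \<open>Sums over coprime pairs\<close>

lemma ln_succ_diff:
  fixes x :: real
  assumes "x > 0"
  shows "1 / (x + 1) \<le> ln (x + 1) - ln x" "ln (x + 1) - ln x \<le> 1 / x"
proof -
  have "ln (x / (x + 1)) \<le> x / (x + 1) - 1" using assms by (intro ln_le_minus_one) auto
  also have "\<dots> = - (1 / (x + 1))" using assms by (simp add: field_simps)
  finally show "1 / (x + 1) \<le> ln (x + 1) - ln x" using assms by (simp add: ln_div)
  have "ln ((x + 1) / x) \<le> (x + 1) / x - 1" using assms by (intro ln_le_minus_one) auto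
  also have "\<dots> = 1 / x" using assms by (simp add: field_simps)
  finally show "ln (x + 1) - ln x \<le> 1 / x" using assms by (simp add: ln_div)
qed

lemma sum_inverse_shift:
  fixes x :: real
  assumes "x > 0"
  shows "(\<Sum>t=1..m. 1 / (x + real t)) \<le> ln (x + real m) - ln x"
    and "ln (x + real m) - ln x - (1 / x - 1 / (x + real m)) \<le> (\<Sum>t=1..m. 1 / (x + real t))"
proof (induction m)
  case (Suc m)
  have p: "x + real m > 0" using assms by simp
  have e: "x + real (Suc m) = x + real m + 1" by simp
  note d = ln_succ_diff[OF p]
  have s: "(\<Sum>t=1..Suc m. 1 / (x + real t)) = (\<Sum>t=1..m. 1 / (x + real t)) + 1 / (x + real m + 1)"
    by (simp add: add_ac)
  { case 1 show ?case unfolding s e using Suc(1) d by linarith }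
  { case 2 show ?case unfolding s e using Suc(2) d by linarith }
qed auto

lemma inverse_square_succ_le:
  fixes x :: real
  assumes "x > 0"
  shows "1 / (x + 1)\<^sup>2 \<le> 1 / x - 1 / (x + 1)"
proof -
  have "1 / (x + 1)\<^sup>2 \<le> 1 / (x * (x + 1))"
    using assms unfolding power2_eq_square by (intro divide_left_mono mult_right_mono mult_pos_pos) auto
  also have "\<dots> = 1 / x - 1 / (x + 1)" using assms by (simp add: field_simps)
  finally show ?thesis .
qed

lemma harmonic_ge_ln:
  assumes "n \<ge> 1" shows "ln (real n) \<le> (\<Sum>s=1..n. 1 / real s)"
proof -
  have "(\<Sum>s=1..n. 1 / real s) \<ge> ln (real n + 1)"
  proof (induction n)
    case (Suc n)
    have "ln (real (Suc n) + 1) - ln (real (Suc n)) \<le> 1 / real (Suc n)"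
      by (rule ln_succ_diff(2)) simp
    moreover have "(\<Sum>s=1..Suc n. 1 / real s) = (\<Sum>s=1..n. 1 / real s) + 1 / real (Suc n)" by simp
    moreover have "real (Suc n) = real n + 1" by simp
    ultimately show ?case using Suc by (simp only:)
  qed simp
  moreover have "ln (real n) \<le> ln (real n + 1)" using assms by simp
  ultimately show ?thesis by linarith
qed

lemma harmonic_le_ln:
  assumes "n \<ge> 1" shows "(\<Sum>s=1..n. 1 / real s) \<le> 1 + ln (real n)"
  using assms
proof (induction n rule: nat_induct_at_least)
  case (Suc n)
  have "1 / (real n + 1) \<le> ln (real n + 1) - ln (real n)" using Suc by (intro ln_succ_diff) simp
  moreover have "(\<Sum>s=1..Suc n. 1 / real s) = (\<Sum>s=1..n. 1 / real s) + 1 / (real n + 1)" by (simp add: add.commute)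
  moreover have "real (Suc n) = real n + 1" by simp
  ultimately show ?case using Suc by (simp only:)
qed simp

lemma sum_inverse_squares_from_le:
  assumes "m \<ge> 1"
  shows "(\<Sum>s=m..n. 1 / (real s)\<^sup>2) \<le> 2 / real m"
proof -
  have "(\<Sum>s=m..n. 1 / (real s)\<^sup>2) \<le> 1 / (real m)\<^sup>2 + 1 / real m - 1 / real n" if "n \<ge> m" for n
    using that
  proof (induction n rule: nat_induct_at_least)
    case (Suc n)
    have "1 / (real n + 1)\<^sup>2 \<le> 1 / real n - 1 / (real n + 1)"
      using Suc assms by (intro inverse_square_succ_le) auto
    moreover have "real (Suc n) = real n + 1" by simp
    ultimately show ?case using Suc by (simp add: add.commute)
  qed simp
  from this[of n] have "n \<ge> m \<Longrightarrow> (\<Sum>s=m..n. 1 / (real s)\<^sup>2) \<le> 1 / (real m)\<^sup>2 + 1 / real m"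
    by (rule order_trans) auto
  moreover have "1 / (real m)\<^sup>2 \<le> 1 / real m"
    using assms self_le_power[of "real m" 2] by (intro divide_left_mono mult_pos_pos) auto
  moreover have "2 / real m = 1 / real m + 1 / real m" by simp
  ultimately show ?thesis
    by (cases "n \<ge> m") auto
qed

text \<open>Serves as the contraction factor in \<open>sum_over_gcd_inversion\<close>, where a value
  below 1 is essential. The bound is \<open>1/4 + 1/2\<close>, the first term plus the telescoped
  rest.\<close>

lemma sum_inverse_squares_from_2_le: "(\<Sum>s=2..n. 1 / (real s)\<^sup>2) \<le> 3 / 4"
proof -
  have "(\<Sum>s=2..n. 1 / (real s)\<^sup>2) \<le> 3 / 4 - 1 / real n" if "n \<ge> 2" for n
    using that
  proof (induction n rule: nat_induct_at_least)
    case (Suc n)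
    have "1 / (real n + 1)\<^sup>2 \<le> 1 / real n - 1 / (real n + 1)"
      using Suc by (intro inverse_square_succ_le) auto
    moreover have "real (Suc n) = real n + 1" by simp
    ultimately show ?case using Suc by (simp add: add.commute)
  qed simp
  from this[of n] have "n \<ge> 2 \<Longrightarrow> ?thesis" by (rule order_trans) auto
  then show ?thesis by (cases "n \<ge> 2") auto
qed

lemma sum_inverse_squares_bounds:
  shows "(\<Sum>g=1..n. 1 / (real g)\<^sup>2) \<le> pi\<^sup>2 / 6"
    and "n \<ge> 1 \<Longrightarrow> pi\<^sup>2 / 6 - 1 / real n \<le> (\<Sum>g=1..n. 1 / (real g)\<^sup>2)"
proof -
  have S: "(\<lambda>n. \<Sum>g=1..n. 1 / (real g)\<^sup>2) \<longlonglongrightarrow> pi\<^sup>2 / 6"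
  proof -
    have "(\<lambda>n. \<Sum>k<n. 1 / (real k + 1)\<^sup>2) \<longlonglongrightarrow> pi\<^sup>2 / 6"
      using inverse_squares_sums by (simp add: sums_def add.commute)
    moreover have "(\<Sum>k<n. 1 / (real k + 1)\<^sup>2) = (\<Sum>g=1..n. 1 / (real g)\<^sup>2)" for n
      by (rule sum.reindex_bij_witness[where i = "\<lambda>g. g - 1" and j = Suc]) (auto simp: add.commute)
    ultimately show ?thesis by simp
  qed
  have inc: "incseq (\<lambda>n. \<Sum>g=1..n. 1 / (real g)\<^sup>2)"
    by (intro incseq_SucI) simp
  show "(\<Sum>g=1..n. 1 / (real g)\<^sup>2) \<le> pi\<^sup>2 / 6" using incseq_le[OF inc S] .
  assume n: "n \<ge> 1"
  have bd: "(\<Sum>g=1..m. 1 / (real g)\<^sup>2) \<le> (\<Sum>g=1..n. 1 / (real g)\<^sup>2) + 1 / real n - 1 / real m" if "m \<ge> n" for m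
    using that
  proof (induction m rule: nat_induct_at_least)
    case (Suc m)
    have "1 / (real m + 1)\<^sup>2 \<le> 1 / real m - 1 / (real m + 1)"
      using Suc n by (intro inverse_square_succ_le) auto
    moreover have "real (Suc m) = real m + 1" by simp
    ultimately show ?case using Suc by (simp add: add.commute)
  qed simp
  have "eventually (\<lambda>m. (\<Sum>g=1..m. 1 / (real g)\<^sup>2) \<le> (\<Sum>g=1..n. 1 / (real g)\<^sup>2) + 1 / real n) sequentially"
  proof (rule eventually_sequentiallyI)
    fix m assume "m \<ge> n"
    from bd[OF this] show "(\<Sum>g=1..m. 1 / (real g)\<^sup>2) \<le> (\<Sum>g=1..n. 1 / (real g)\<^sup>2) + 1 / real n"
      by (rule order_trans) simp
  qed
  then show "pi\<^sup>2 / 6 - 1 / real n \<le> (\<Sum>g=1..n. 1 / (real g)\<^sup>2)"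
    using tendsto_upperbound[OF S] by (force simp: algebra_simps)
qed

text \<open>Comparison with the antiderivative \<open>- (ln (2 * x) + 1) / x\<close>, in which 1 is
  replaced by 2 to leave room for the discrete step.\<close>

lemma sum_ln_over_squares_le:
  "(\<Sum>g=1..n. ln (2 * real g) / (real g)\<^sup>2) \<le> 4"
proof -
  have "(\<Sum>g=1..n. ln (2 * real g) / (real g)\<^sup>2) \<le> 2 * ln 2 + 2 - (ln (2 * real n) + 2) / real n" if "n \<ge> 1" for n
    using that
  proof (induction n rule: nat_induct_at_least)
    case (Suc n)
    define x L where "x = real n" and "L = ln (2 * (x + 1))"
    have x: "x \<ge> 1" using Suc by (simp add: x_def)
    have L0: "L \<ge> 0" using x by (simp add: L_def)
    have "ln (2 * x) \<ge> L - 1 / x"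
    proof -
      have "L = ln 2 + ln (x + 1)" "ln (2 * x) = ln 2 + ln x" unfolding L_def using x by (intro ln_mult_pos; simp)+
      then show ?thesis using ln_succ_diff(2)[of x] x by linarith
    qed
    then have "(ln (2 * x) + 2) / x \<ge> (L - 1 / x + 2) / x" using x by (intro divide_right_mono) auto
    moreover have "(L - 1 / x + 2) / x - (L + 2) / (x + 1) - L / (x + 1)\<^sup>2 = (x * L + x\<^sup>2 - 1) / (x\<^sup>2 * (x + 1)\<^sup>2)"
      using x by (simp add: divide_simps) (simp add: algebra_simps power2_eq_square)
    moreover have "(x * L + x\<^sup>2 - 1) / (x\<^sup>2 * (x + 1)\<^sup>2) \<ge> 0"
      using x L0 by (intro divide_nonneg_nonneg) (auto simp: add_nonneg_nonneg add_diff_eq[symmetric])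
    ultimately have "L / (x + 1)\<^sup>2 \<le> (ln (2 * x) + 2) / x - (L + 2) / (x + 1)" by linarith
    moreover have "real (Suc n) = x + 1" by (simp add: x_def)
    ultimately show ?case using Suc by (simp add: L_def x_def add_ac)
  qed simp
  moreover have "(2::real) * ln 2 + 2 - (ln (2 * real n) + 2) / real n \<le> 4" if "n \<ge> 1" for n
  proof -
    have "(ln (2 * real n) + 2) / real n \<ge> 0" using that by (intro divide_nonneg_nonneg) auto
    moreover have "ln 2 \<le> (1::real)" using ln_add_one_self_le_self[of 1] by simp
    ultimately show ?thesis by linarith
  qed
  ultimately have "n \<ge> 1 \<Longrightarrow> ?thesis" using order_trans by blast
  then show ?thesis by (cases "n \<ge> 1") auto
qed

text \<open>Inversion without the Moebius function: \<open>\<Sum>\<^bsub>g\<ge>2\<^esub> 1/g\<^sup>2 < 1\<close> makes the error of \<open>G\<close>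
  controlled by that of \<open>H\<close> through a contraction.\<close>
lemma sum_over_gcd_inversion:
  fixes G H :: "nat \<Rightarrow> real"
  assumes H: "\<And>n. H n = (\<Sum>g=1..n. G (n div g) / (real g)\<^sup>2)"
    and asym: "\<And>n. n \<ge> 1 \<Longrightarrow> \<bar>H n - \<alpha> * ln (real n)\<bar> \<le> \<beta>"
    and \<alpha>: "\<alpha> \<ge> 0" and n: "n \<ge> 1"
  shows "\<bar>G n - 6 / pi\<^sup>2 * \<alpha> * ln (real n)\<bar> \<le> 4 * (\<beta> + 5 * \<alpha>)"
  using n
proof (induction n rule: less_induct)
  case (less n)
  define c where "c = 6 / pi\<^sup>2"
  have c: "c > 0" "c * (pi\<^sup>2 / 6) = 1" by (auto simp: c_def)
  have c1: "c \<le> 1"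
  proof -
    have "pi\<^sup>2 \<ge> 3\<^sup>2" using pi_gt3 by (intro power_mono) auto
    then show ?thesis by (simp add: c_def divide_simps)
  qed
  \<comment> \<open>The defect of the expected main term \<open>c * ln n\<close> in the convolution
    equation. It lies between 0 and 5: rounding in \<open>n div g\<close> costs at most
    \<open>ln (2 * g)\<close>, which sums to at most 4, and truncating the series for
    \<open>pi\<^sup>2 / 6\<close> costs \<open>ln n / n\<close>, at most 1.\<close>
  define \<Delta> where "\<Delta> = ln (real n) - c * (\<Sum>g=1..n. ln (real (n div g)) / (real g)\<^sup>2)"
  have lnn: "ln (real n) \<ge> 0" using less by simp
  have \<Delta>0: "\<Delta> \<ge> 0"
  proof -
    have "(\<Sum>g=1..n. ln (real (n div g)) / (real g)\<^sup>2) \<le> (\<Sum>g=1..n. ln (real n) * (1 / (real g)\<^sup>2))"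
    proof (rule sum_mono)
      fix g assume g: "g \<in> {1..n}"
      have "n div g \<ge> 1" using g by (simp add: Suc_leI div_greater_zero_iff)
      then have "ln (real (n div g)) \<le> ln (real n)" using less.prems by (intro ln_mono) auto
      then show "ln (real (n div g)) / (real g)\<^sup>2 \<le> ln (real n) * (1 / (real g)\<^sup>2)"
        by (simp add: divide_right_mono)
    qed
    also have "\<dots> = ln (real n) * (\<Sum>g=1..n. 1 / (real g)\<^sup>2)" by (simp only: sum_distrib_left)
    also have "\<dots> \<le> ln (real n) * (pi\<^sup>2 / 6)" using lnn by (intro mult_left_mono sum_inverse_squares_bounds)
    finally have "c * (\<Sum>g=1..n. ln (real (n div g)) / (real g)\<^sup>2) \<le> c * (ln (real n) * (pi\<^sup>2 / 6))"
      using c by (intro mult_left_mono) auto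
    also have "\<dots> = ln (real n)" using c by (metis mult.left_commute mult.right_neutral)
    finally show ?thesis by (simp add: \<Delta>_def)
  qed
  have \<Delta>1: "\<Delta> \<le> 5"
  proof -
    have "(\<Sum>g=1..n. ln (real (n div g)) / (real g)\<^sup>2) \<ge>
        (\<Sum>g=1..n. ln (real n) * (1 / (real g)\<^sup>2) - ln (2 * real g) / (real g)\<^sup>2)"
    proof (rule sum_mono)
      fix g assume g: "g \<in> {1..n}"
      have q: "n div g \<ge> 1" using g by (simp add: Suc_leI div_greater_zero_iff)
      have "n < g * (n div g + 1)" using g
        by (metis Suc_eq_plus1 atLeastAtMost_iff dividend_less_times_div less_le_trans mult_Suc_right zero_less_one)
      also have "\<dots> \<le> g * (2 * (n div g))" using q by (intro mult_le_mono2) auto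
      finally have "real n \<le> real (g * (2 * (n div g)))" by linarith
      then have "ln (real n) \<le> ln ((2 * real g) * real (n div g))"
        using less g q by (intro ln_mono) (auto simp: mult_ac)
      also have "\<dots> = ln (2 * real g) + ln (real (n div g))" using g q by (intro ln_mult_pos) auto
      finally have "ln (real n) - ln (2 * real g) \<le> ln (real (n div g))" by simp
      then have "(ln (real n) - ln (2 * real g)) / (real g)\<^sup>2 \<le> ln (real (n div g)) / (real g)\<^sup>2"
        by (intro divide_right_mono) auto
      then show "ln (real n) * (1 / (real g)\<^sup>2) - ln (2 * real g) / (real g)\<^sup>2 \<le> ln (real (n div g)) / (real g)\<^sup>2"
        by (simp add: diff_divide_distrib)
    qed
    also have "(\<Sum>g=1..n. ln (real n) * (1 / (real g)\<^sup>2) - ln (2 * real g) / (real g)\<^sup>2) =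
       ln (real n) * (\<Sum>g=1..n. 1 / (real g)\<^sup>2) - (\<Sum>g=1..n. ln (2 * real g) / (real g)\<^sup>2)"
      by (simp only: sum_subtractf sum_distrib_left)
    finally have "(\<Sum>g=1..n. ln (real (n div g)) / (real g)\<^sup>2) \<ge>
        ln (real n) * (\<Sum>g=1..n. 1 / (real g)\<^sup>2) - 4"
      using sum_ln_over_squares_le[of n] by linarith
    moreover have "ln (real n) * (\<Sum>g=1..n. 1 / (real g)\<^sup>2) \<ge> ln (real n) * (pi\<^sup>2 / 6 - 1 / real n)"
      using lnn less by (intro mult_left_mono sum_inverse_squares_bounds) auto
    moreover have "ln (real n) * (1 / real n) \<le> 1" using less ln_bound[of "real n"] by simp
    ultimately have "(\<Sum>g=1..n. ln (real (n div g)) / (real g)\<^sup>2) \<ge> ln (real n) * (pi\<^sup>2 / 6) - 5"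
      by (simp only: right_diff_distrib)
    then have "c * (\<Sum>g=1..n. ln (real (n div g)) / (real g)\<^sup>2) \<ge> c * (ln (real n) * (pi\<^sup>2 / 6) - 5)"
      using c by (intro mult_left_mono) auto
    moreover have "c * (ln (real n) * (pi\<^sup>2 / 6) - 5) = ln (real n) - 5 * c"
    proof -
      have "c * (ln (real n) * (pi\<^sup>2 / 6)) = ln (real n) * (c * (pi\<^sup>2 / 6))" by (rule mult.left_commute)
      then show ?thesis unfolding c(2) by (simp add: right_diff_distrib)
    qed
    ultimately show ?thesis using c1 by (simp add: \<Delta>_def)
  qed
  define R where "R = (\<lambda>n. G n - c * \<alpha> * ln (real n))"
  \<comment> \<open>The fixed point of \<open>M = \<beta> + 5 * \<alpha> + 3 / 4 * M\<close>, so
    that the induction reproduces its own bound.\<close>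
  define M where "M = 4 * (\<beta> + 5 * \<alpha>)"
  have \<beta>: "\<beta> \<ge> 0" using asym[of 1] by linarith
  have split: "(\<Sum>g=1..n. F g) = F 1 + (\<Sum>g=2..n. F g)" for F :: "nat \<Rightarrow> real"
    using less.prems by (subst sum.atLeast_Suc_atMost) (auto simp: numeral_2_eq_2)
  have "(\<Sum>g=1..n. R (n div g) / (real g)\<^sup>2) =
      (\<Sum>g=1..n. G (n div g) / (real g)\<^sup>2) - (\<Sum>g=1..n. c * \<alpha> * (ln (real (n div g)) / (real g)\<^sup>2))"
    unfolding R_def sum_subtractf[symmetric] by (intro sum.cong) (auto simp: diff_divide_distrib)
  also have "\<dots> = H n - c * \<alpha> * (\<Sum>g=1..n. ln (real (n div g)) / (real g)\<^sup>2)"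
    unfolding H sum_distrib_left ..
  also have "\<dots> = (H n - \<alpha> * ln (real n)) + \<alpha> * \<Delta>" by (simp add: \<Delta>_def algebra_simps)
  finally have "R n = (H n - \<alpha> * ln (real n)) + \<alpha> * \<Delta> - (\<Sum>g=2..n. R (n div g) / (real g)\<^sup>2)"
    unfolding split by simp
  moreover have "\<bar>\<alpha> * \<Delta>\<bar> \<le> 5 * \<alpha>" using \<Delta>0 \<Delta>1 \<alpha> mult_left_mono[of \<Delta> 5 \<alpha>] by (simp add: abs_mult mult.commute)
  moreover have "\<bar>\<Sum>g=2..n. R (n div g) / (real g)\<^sup>2\<bar> \<le> 3 / 4 * M"
  proof -
    have "\<bar>\<Sum>g=2..n. R (n div g) / (real g)\<^sup>2\<bar> \<le> (\<Sum>g=2..n. \<bar>R (n div g) / (real g)\<^sup>2\<bar>)" by (rule sum_abs)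
    also have "\<dots> \<le> (\<Sum>g=2..n. M * (1 / (real g)\<^sup>2))"
    proof (rule sum_mono)
      fix g assume g: "g \<in> {2..n}"
      have "n div g \<ge> 1" "n div g < n" using g by (auto simp: Suc_leI div_greater_zero_iff)
      then have "\<bar>R (n div g)\<bar> \<le> M" using less.IH by (simp add: R_def M_def c_def)
      then show "\<bar>R (n div g) / (real g)\<^sup>2\<bar> \<le> M * (1 / (real g)\<^sup>2)"
        by (simp add: abs_divide divide_right_mono)
    qed
    also have "\<dots> = M * (\<Sum>g=2..n. 1 / (real g)\<^sup>2)" by (simp only: sum_distrib_left)
    also have "\<dots> \<le> M * (3 / 4)"
      using \<beta> \<alpha> by (intro mult_left_mono sum_inverse_squares_from_2_le) (auto simp: M_def)
    finally show ?thesis by simp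
  qed
  moreover have "\<bar>H n - \<alpha> * ln (real n)\<bar> \<le> \<beta>" using asym less.prems by blast
  ultimately have "\<bar>R n\<bar> \<le> \<beta> + 5 * \<alpha> + 3 / 4 * M" by linarith
  also have "\<dots> = M" by (simp add: M_def)
  finally show ?case by (simp add: R_def M_def c_def)
qed

section \<open>Weighted sums over pairs of bounded ratio\<close>

definition ratio_pairs :: "nat \<Rightarrow> nat \<Rightarrow> (nat \<times> nat) set" where
  "ratio_pairs e n = {(s,t). 1 \<le> s \<and> s \<le> n \<and> 1 \<le> t \<and> e * t \<le> s}"

definition coprime_ratio_pairs :: "nat \<Rightarrow> nat \<Rightarrow> (nat \<times> nat) set" where
  "coprime_ratio_pairs e n = {(s,t)\<in>ratio_pairs e n. coprime s t}"

text \<open>Multiplied by \<open>totient N\<close>, this is the expected value of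
  \<open>split_count c s t N\<close>.\<close>

definition pair_weight :: "nat \<Rightarrow> nat \<times> nat \<Rightarrow> real" where
  "pair_weight c = (\<lambda>(s,t). 1 / real (s * (c * s + t)))"

lemma ratio_pairs_Sigma:
  assumes "e \<ge> 1"
  shows "ratio_pairs e n = (SIGMA s:{1..n}. {1..s div e})"
  using assms by (auto simp: ratio_pairs_def less_eq_div_iff_mult_less_eq mult.commute)

lemma finite_ratio_pairs: "e \<ge> 1 \<Longrightarrow> finite (ratio_pairs e n)"
  by (simp add: ratio_pairs_Sigma)

lemma finite_coprime_ratio_pairs: "e \<ge> 1 \<Longrightarrow> finite (coprime_ratio_pairs e n)"
  using finite_ratio_pairs[of e n] by (rule rev_finite_subset) (auto simp: coprime_ratio_pairs_def)

text \<open>The weight is homogeneous of degree -2 and the ratio condition is invariant under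
  scaling, so the pairs with gcd \<open>g\<close> contribute \<open>1 / g\<^sup>2\<close> times a
  sum over coprime pairs.\<close>

lemma sum_ratio_pairs_by_gcd:
  assumes e: "e \<ge> 1"
  shows "sum (pair_weight c) (ratio_pairs e n) =
    (\<Sum>g=1..n. sum (pair_weight c) (coprime_ratio_pairs e (n div g)) / (real g)\<^sup>2)"
proof -
  have "(\<Sum>g=1..n. sum (pair_weight c) (coprime_ratio_pairs e (n div g)) / (real g)\<^sup>2) =
    (\<Sum>g=1..n. \<Sum>q\<in>coprime_ratio_pairs e (n div g). pair_weight c q / (real g)\<^sup>2)"
    by (simp add: sum_divide_distrib)
  also have "\<dots> = (\<Sum>(g,q)\<in>(SIGMA g:{1..n}. coprime_ratio_pairs e (n div g)). pair_weight c q / (real g)\<^sup>2)"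
    using e by (intro sum.Sigma) (auto simp: finite_coprime_ratio_pairs)
  also have "\<dots> = sum (pair_weight c) (ratio_pairs e n)"
  proof (rule sum.reindex_bij_witness[where j = "\<lambda>(g,(s,t)). (g * s, g * t)" and
        i = "\<lambda>(s,t). (gcd s t, (s div gcd s t, t div gcd s t))"])
    fix q assume "q \<in> (SIGMA g:{1..n}. coprime_ratio_pairs e (n div g))"
    then obtain g s t where q: "q = (g,(s,t))" and g: "1 \<le> g" "g \<le> n"
      and st: "1 \<le> s" "s \<le> n div g" "1 \<le> t" "e * t \<le> s" "coprime s t"
      by (auto simp: coprime_ratio_pairs_def ratio_pairs_def)
    have gc: "gcd (g * s) (g * t) = g" using st by (simp add: gcd_mult_distrib_nat[symmetric] coprime_iff_gcd_eq_1)
    show "(case (case q of (g,(s,t)) \<Rightarrow> (g * s, g * t)) of (s,t) \<Rightarrow> (gcd s t, (s div gcd s t, t div gcd s t))) = q"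
      using q gc g by simp
    have "e * (g * t) \<le> g * s" using st by (metis mult.left_commute mult_le_mono2)
    moreover have "g * s \<le> n" using st g by (simp add: less_eq_div_iff_mult_less_eq mult.commute)
    ultimately show "(case q of (g,(s,t)) \<Rightarrow> (g * s, g * t)) \<in> ratio_pairs e n"
      using q st g by (auto simp: ratio_pairs_def Suc_le_eq)
    have "g * s * (c * (g * s) + g * t) = g\<^sup>2 * (s * (c * s + t))" by (simp add: algebra_simps power2_eq_square)
    then show "pair_weight c (case q of (g,(s,t)) \<Rightarrow> (g * s, g * t)) = (case q of (g,q) \<Rightarrow> pair_weight c q / (real g)\<^sup>2)"
      unfolding q by (simp add: pair_weight_def mult.commute[of "s * (c * s + t)"] del: mult_cancel_left of_nat_mult of_nat_add flip: of_nat_mult of_nat_power)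
  next
    fix q assume "q \<in> ratio_pairs e n"
    then obtain s t where q: "q = (s,t)" and st: "1 \<le> s" "s \<le> n" "1 \<le> t" "e * t \<le> s"
      by (auto simp: ratio_pairs_def)
    define g where "g = gcd s t"
    obtain s' t' where s': "s = g * s'" "t = g * t'" unfolding g_def by (metis dvdE gcd_dvd1 gcd_dvd2)
    have g0: "g \<ge> 1" using st by (simp add: g_def Suc_le_eq)
    have d: "s div g = s'" "t div g = t'" using s' g0 by auto
    show "(case (case q of (s,t) \<Rightarrow> (gcd s t, (s div gcd s t, t div gcd s t))) of (g,(s,t)) \<Rightarrow> (g * s, g * t)) = q"
      using q by simp
    have "coprime s' t'" using d div_gcd_coprime[of s t] st by (simp add: g_def)
    moreover have "s' \<ge> 1" "t' \<ge> 1" using st s' by (cases s'; cases t'; simp)+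
    moreover have "e * t' \<le> s'"
    proof -
      have "g * (e * t') \<le> g * s'" using st s' by (simp add: mult.left_commute)
      then show ?thesis using g0 by simp
    qed
    moreover have "s' \<le> n div g" using st s' g0 by (simp add: less_eq_div_iff_mult_less_eq mult.commute)
    moreover have "g \<le> n" using st unfolding g_def
      by (metis gcd_le1_nat le_trans not_one_le_zero)
    ultimately show "(case q of (s,t) \<Rightarrow> (gcd s t, (s div gcd s t, t div gcd s t)))
        \<in> (SIGMA g:{1..n}. coprime_ratio_pairs e (n div g))"
      unfolding q prod.case g_def[symmetric] d
      using g0 by (auto simp: coprime_ratio_pairs_def ratio_pairs_def)
  qed
  finally show ?thesis by simp
qed

lemma sum_ratio_pairs_nested:
  assumes "e \<ge> 1" "c \<ge> 1"
  shows "sum (pair_weight c) (ratio_pairs e n) =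
    (\<Sum>s=1..n. (\<Sum>t=1..s div e. 1 / (real (c * s) + real t)) / real s)"
proof -
  have "sum (pair_weight c) (ratio_pairs e n) = (\<Sum>s=1..n. \<Sum>t=1..s div e. pair_weight c (s,t))"
    unfolding ratio_pairs_Sigma[OF assms(1)] by (subst sum.Sigma) auto
  also have "\<dots> = (\<Sum>s=1..n. (\<Sum>t=1..s div e. 1 / (real (c * s) + real t)) / real s)"
    by (intro sum.cong refl) (simp add: pair_weight_def sum_divide_distrib mult.commute)
  finally show ?thesis .
qed

text \<open>For the weights at hand the inner sum over \<open>t\<close> is nearly the constant
  \<open>a = ln (1 + 1 / k)\<close>, so the outer sum behaves like \<open>a\<close> times a harmonic
  sum.\<close>

lemma sum_by_harmonic:
  fixes F e :: "nat \<Rightarrow> real"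
  assumes n: "n \<ge> 1" and a: "a \<ge> 0"
    and F: "\<And>s. s \<in> {1..n} \<Longrightarrow> \<bar>F s - a\<bar> \<le> e s"
    and E: "(\<Sum>s=1..n. e s / real s) \<le> E"
  shows "\<bar>(\<Sum>s=1..n. F s / real s) - a * ln (real n)\<bar> \<le> a + E"
proof -
  have "(\<Sum>s=1..n. F s / real s) - a * (\<Sum>s=1..n. 1 / real s) = (\<Sum>s=1..n. (F s - a) / real s)"
    by (simp add: sum_distrib_left sum_subtractf diff_divide_distrib)
  also have "\<bar>\<dots>\<bar> \<le> (\<Sum>s=1..n. \<bar>(F s - a) / real s\<bar>)" by (rule sum_abs)
  also have "\<dots> \<le> (\<Sum>s=1..n. e s / real s)"
    by (rule sum_mono) (use F in \<open>auto simp: abs_divide intro!: divide_right_mono\<close>)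
  finally have 1: "\<bar>(\<Sum>s=1..n. F s / real s) - a * (\<Sum>s=1..n. 1 / real s)\<bar> \<le> E" using E by linarith
  have "a * ln (real n) \<le> a * (\<Sum>s=1..n. 1 / real s)"
    using a harmonic_ge_ln[OF n] by (rule mult_left_mono[rotated])
  moreover have "a * (\<Sum>s=1..n. 1 / real s) \<le> a * (1 + ln (real n))"
    using a harmonic_le_ln[OF n] by (rule mult_left_mono[rotated])
  moreover have "a * (1 + ln (real n)) = a + a * ln (real n)" by (simp add: algebra_simps)
  ultimately show ?thesis using 1 by linarith
qed

lemma ln_1_plus_inverse_bounds:
  assumes "k \<ge> 1"
  shows "0 \<le> ln (1 + 1 / real k)" "ln (1 + 1 / real k) \<le> 1 / real k"
  using assms by (auto intro: ln_add_one_self_le_self)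

text \<open>The inner sum of \<open>1 / (k * s + t)\<close> over \<open>t \<le> s\<close> differs
  from \<open>ln ((k + 1) / k)\<close> by at most \<open>1 / (k * s)\<close>, which is summable
  against \<open>1 / s\<close>. Inversion with \<open>\<beta> = 3 / k\<close> and
  \<open>\<alpha> \<le> 1 / k\<close> yields \<open>4 * (3 + 5) / k\<close>.\<close>

lemma coprime_pair_sum_left:
  assumes k: "k \<ge> 1" and n: "n \<ge> 1"
  shows "\<bar>sum (pair_weight k) (coprime_ratio_pairs 1 n) - 6 / pi\<^sup>2 * ln (1 + 1 / real k) * ln (real n)\<bar>
     \<le> 32 / real k"
proof -
  define a where "a = ln (1 + 1 / real k)"
  have a: "0 \<le> a" "a \<le> 1 / real k" using ln_1_plus_inverse_bounds[OF k] by (auto simp: a_def)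
  have "\<bar>sum (pair_weight k) (ratio_pairs 1 n) - a * ln (real n)\<bar> \<le> 3 / real k" if n: "n \<ge> 1" for n
  proof -
    have "\<bar>(\<Sum>s=1..n. (\<Sum>t=1..s div 1. 1 / (real (k * s) + real t)) / real s) - a * ln (real n)\<bar> \<le> a + 2 / real k"
    proof (rule sum_by_harmonic[OF n a(1)])
      fix s assume s: "s \<in> {1..n}"
      have x: "real (k * s) > 0" using s k by simp
      have "ln (real (k * s) + real s) - ln (real (k * s)) = ln ((real (k * s) + real s) / real (k * s))"
        using x by (intro ln_divide_pos[symmetric] add_pos_nonneg) auto
      also have "(real (k * s) + real s) / real (k * s) = 1 + 1 / real k" using s k by (simp add: field_simps)
      finally have "ln (real (k * s) + real s) - ln (real (k * s)) = a" by (simp add: a_def)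
      moreover have "1 / (real (k * s) + real s) \<ge> 0" by simp
      ultimately show "\<bar>(\<Sum>t=1..s div 1. 1 / (real (k * s) + real t)) - a\<bar> \<le> 1 / real (k * s)"
        using sum_inverse_shift[OF x, of s] by (simp only: div_by_1)
    next
      have "(\<Sum>s=1..n. 1 / real (k * s) / real s) = 1 / real k * (\<Sum>s=1..n. 1 / (real s)\<^sup>2)"
        by (simp add: sum_distrib_left power2_eq_square mult.assoc)
      also have "\<dots> \<le> 1 / real k * 2" using sum_inverse_squares_from_le[of 1 n] by (intro mult_left_mono) auto
      finally show "(\<Sum>s=1..n. 1 / real (k * s) / real s) \<le> 2 / real k" by simp
    qed
    then show ?thesis unfolding sum_ratio_pairs_nested[OF order_refl k] using a
      by (smt (verit) add_divide_distrib)
  qed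
  from sum_over_gcd_inversion[OF sum_ratio_pairs_by_gcd[OF order_refl] this a(1) n]
  have "\<bar>sum (pair_weight k) (coprime_ratio_pairs 1 n) - 6 / pi\<^sup>2 * a * ln (real n)\<bar> \<le> 4 * (3 / real k + 5 * a)" .
  also have "\<dots> \<le> 32 / real k" using a by simp
  finally show ?thesis by (simp add: a_def)
qed

text \<open>Here \<open>t\<close> runs only up to \<open>s div k\<close>, so the inner sum is empty
  for \<open>s < k\<close> and misses its limit by up to \<open>1 / k\<close>. Summed against
  \<open>1 / s\<close> this gives \<open>ln k / k\<close>, one source of the \<open>ln k\<close> in
  the final error. From \<open>k\<close> on the deviation is at most \<open>2 / s\<close>.\<close>

lemma coprime_pair_sum_right:
  assumes k: "k \<ge> 1" and n: "n \<ge> 1"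
  shows "\<bar>sum (pair_weight 1) (coprime_ratio_pairs k n) - 6 / pi\<^sup>2 * ln (1 + 1 / real k) * ln (real n)\<bar>
     \<le> 4 * (11 + ln (real k)) / real k"
proof -
  define a where "a = ln (1 + 1 / real k)"
  have a: "0 \<le> a" "a \<le> 1 / real k" using ln_1_plus_inverse_bounds[OF k] by (auto simp: a_def)
  define e where "e = (\<lambda>s::nat. if s < k then 1 / real k else 2 / real s)"
  have "\<bar>sum (pair_weight 1) (ratio_pairs k n) - a * ln (real n)\<bar> \<le> (6 + ln (real k)) / real k" if n: "n \<ge> 1" for n
  proof -
    have "\<bar>(\<Sum>s=1..n. (\<Sum>t=1..s div k. 1 / (real (1 * s) + real t)) / real s) - a * ln (real n)\<bar>
        \<le> a + (5 + ln (real k)) / real k"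
    proof (rule sum_by_harmonic[OF n a(1)])
      fix s assume s: "s \<in> {1..n}"
      show "\<bar>(\<Sum>t=1..s div k. 1 / (real (1 * s) + real t)) - a\<bar> \<le> e s"
      proof (cases "s < k")
        case True
        then show ?thesis using a by (simp add: e_def)
      next
        case False
        have x: "real s > 0" using s by simp
        define m where "m = s div k"
        have m: "real m / real s \<le> 1 / real k" "1 / real k - real m / real s \<le> 1 / real s"
        proof -
          have "real m \<le> real s / real k" unfolding m_def by (rule of_nat_div_le_divide)
          then show "real m / real s \<le> 1 / real k" using x k by (simp add: field_simps)
          have "s < k * (m + 1)" unfolding m_def using k
            by (metis Suc_eq_plus1 dividend_less_times_div less_le_trans mult_Suc_right zero_less_one)
          then have "real s \<le> real k * (real m + 1)" by (metis less_imp_le of_nat_1 of_nat_add of_nat_le_iff of_nat_mult)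
          then have "real s / (real k * real s) \<le> (real k * (real m + 1)) / (real k * real s)"
            using x k by (intro divide_right_mono) auto
          then show "1 / real k - real m / real s \<le> 1 / real s" using x k by (simp add: add_divide_distrib)
        qed
        have "ln (real s + real m) - ln (real s) = ln ((real s + real m) / real s)"
          using x by (intro ln_divide_pos[symmetric]) auto
        also have "(real s + real m) / real s = 1 + real m / real s" using x by (simp add: field_simps)
        finally have l: "ln (real s + real m) - ln (real s) = ln (1 + real m / real s)" .
        have "ln (1 + real m / real s) \<le> a" unfolding a_def using m x by (intro ln_mono) (auto intro: add_pos_nonneg)
        moreover have "a - ln (1 + real m / real s) \<le> 1 / real s"
        proof -
          let ?y = "1 + real m / real s" and ?z = "1 + 1 / real k"
          have y: "?y \<ge> 1" by simp
          have z: "?z > 0" by (simp add: add_pos_nonneg)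
          have "a - ln ?y = ln (?z / ?y)" unfolding a_def using y z by (intro ln_divide_pos[symmetric]) linarith+
          also have "\<dots> \<le> ?z / ?y - 1" using y z by (intro ln_le_minus_one divide_pos_pos) linarith+
          also have "\<dots> = (?z - ?y) / ?y"
          proof -
            have "?y \<noteq> 0" using y by linarith
            then have "?y / ?y = 1" by (rule divide_self)
            then show ?thesis by (metis diff_divide_distrib)
          qed
          also have "\<dots> \<le> (?z - ?y) / 1" using y m by (intro divide_left_mono) (auto intro: add_pos_nonneg)
          finally show ?thesis using m by simp
        qed
        moreover have "1 / (real s + real m) \<ge> 0" by simp
        ultimately have "\<bar>(\<Sum>t=1..m. 1 / (real s + real t)) - a\<bar> \<le> 1 / real s + 1 / real s"
          using sum_inverse_shift[OF x, of m] l by linarith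
        then show ?thesis using False by (simp add: e_def m_def)
      qed
    next
      have "(\<Sum>s=1..n. e s / real s) \<le> (\<Sum>s\<in>{1..<k} \<union> {k..n}. e s / real s)"
        by (rule sum_mono2) (auto simp: e_def)
      also have "\<dots> = (\<Sum>s\<in>{1..<k}. e s / real s) + (\<Sum>s=k..n. e s / real s)"
        by (rule sum.union_disjoint) auto
      also have "(\<Sum>s=k..n. e s / real s) = 2 * (\<Sum>s=k..n. 1 / (real s)\<^sup>2)"
        unfolding sum_distrib_left by (intro sum.cong) (auto simp: e_def power2_eq_square)
      also have "\<dots> \<le> 2 * (2 / real k)" using k by (intro mult_left_mono sum_inverse_squares_from_le) auto
      also have "(\<Sum>s\<in>{1..<k}. e s / real s) = (\<Sum>s\<in>{1..<k}. 1 / real s) / real k"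
        unfolding sum_divide_distrib by (intro sum.cong) (auto simp: e_def)
      also have "\<dots> \<le> (\<Sum>s=1..k. 1 / real s) / real k"
        by (intro divide_right_mono sum_mono2) auto
      also have "\<dots> \<le> (1 + ln (real k)) / real k"
        using k by (intro divide_right_mono harmonic_le_ln) auto
      finally show "(\<Sum>s=1..n. e s / real s) \<le> (5 + ln (real k)) / real k"
        by (simp add: add_divide_distrib)
    qed
    then show ?thesis unfolding sum_ratio_pairs_nested[OF k order_refl] using a
      by (simp add: add_divide_distrib)
  qed
  from sum_over_gcd_inversion[OF sum_ratio_pairs_by_gcd[OF k] this a(1) n]
  have "\<bar>sum (pair_weight 1) (coprime_ratio_pairs k n) - 6 / pi\<^sup>2 * a * ln (real n)\<bar>
      \<le> 4 * ((6 + ln (real k)) / real k + 5 * a)" .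
  also have "\<dots> \<le> 4 * (11 + ln (real k)) / real k" using a by (simp add: add_divide_distrib)
  finally show ?thesis by (simp add: a_def)
qed

section \<open>Upper bounds for the number of splittings\<close>

lemma card_coprime_splits_by_v:
  assumes V: "finite V" "\<And>v. v \<in> V \<Longrightarrow> 1 \<le> v"
    and X: "X \<subseteq> coprime_splits k N"
      "\<And>s t u v. (s,t,u,v) \<in> X \<Longrightarrow> v \<in> V \<and> s \<le> T v"
  shows "card X \<le> (\<Sum>v\<in>V. 2 * T v)"
proof -
  define Y where "Y = (\<lambda>v. {(s,t,u). 1 \<le> t \<and> t \<le> s \<and> s \<le> T v \<and> coprime u v \<and> s * u + t * v = N})"
  have finY: "finite (Y v)" for v
  proof (rule finite_subset)
    show "Y v \<subseteq> {..T v} \<times> {..T v} \<times> {..N}"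
    proof
      fix q assume "q \<in> Y v"
      then obtain s t u where q: "q = (s,t,u)" "(s,t,u) \<in> Y v" by (cases q) auto
      then have *: "1 \<le> t" "t \<le> s" "s \<le> T v" "s * u + t * v = N" by (auto simp: Y_def)
      have "u \<le> s * u" using * by auto
      then have "u \<le> N" using * by linarith
      then show "q \<in> {..T v} \<times> {..T v} \<times> {..N}" using * q by simp
    qed
  qed auto
  have "X \<subseteq> (\<lambda>(v,(s,t,u)). (s,t,u,v)) ` (SIGMA v:V. Y v)"
  proof
    fix q assume q: "q \<in> X"
    obtain s t u v where e: "q = (s,t,u,v)" by (cases q) auto
    have "(s,t,u,v) \<in> coprime_splits k N" "v \<in> V" "s \<le> T v" using X q e by auto
    then have "(v,(s,t,u)) \<in> (SIGMA v:V. Y v)" by (auto simp: coprime_splits_def Y_def)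
    then show "q \<in> (\<lambda>(v,(s,t,u)). (s,t,u,v)) ` (SIGMA v:V. Y v)" using e by force
  qed
  then have "card X \<le> card (SIGMA v:V. Y v)"
    using V finY by (intro surj_card_le) auto
  also have "\<dots> = (\<Sum>v\<in>V. card (Y v))" using V finY by (intro card_SigmaI) auto
  also have "\<dots> \<le> (\<Sum>v\<in>V. 2 * T v)"
    unfolding Y_def using V by (intro sum_mono card_splits_fixed_v) auto
  finally show ?thesis .
qed

lemma coprime_splits_bounds:
  assumes "(s,t,u,v) \<in> coprime_splits k N" "1 \<le> k"
  shows "1 \<le> t" "t \<le> s" "1 \<le> v" "k * v \<le> u" "v \<le> u" "coprime s t" "coprime u v"
    "s * u + t * v = N" "s * u \<le> N" "s * (k * v) \<le> N" "N \<le> 2 * (s * u)"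
proof -
  show *: "1 \<le> t" "t \<le> s" "1 \<le> v" "k * v \<le> u" "coprime s t" "coprime u v" "s * u + t * v = N"
    using assms by (auto simp: coprime_splits_def)
  have "1 * v \<le> k * v" using assms mult_le_mono1 by blast
  then show vu: "v \<le> u" using * by linarith
  show su: "s * u \<le> N" using * by linarith
  have "s * (k * v) \<le> s * u" using * by simp
  then show "s * (k * v) \<le> N" using su by linarith
  have "t * v \<le> s * u" using * vu by (simp add: mult_le_mono)
  then show "N \<le> 2 * (s * u)" using * by linarith
qed

lemma real_of_div_mult_le: "real (N div (k * v)) \<le> real N / real k * (1 / real v)"
  using of_nat_div_le_divide[of N "k * v"] by simp

text \<open>Since \<open>s * (k * v) \<le> N\<close>, a fixed \<open>v\<close> leaves
  \<open>s \<le> N / (k * v)\<close>. The bound of \<open>card_splits_fixed_v\<close> is linear in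
  this range, so summing over \<open>v\<close> gives a harmonic sum.\<close>

lemma card_coprime_splits_le:
  assumes k: "1 \<le> k" and N: "N \<ge> 1"
  shows "real (card (coprime_splits k N)) \<le> 2 * real N / real k * (1 + ln (real N))"
proof (cases "N div k = 0")
  case True
  have "coprime_splits k N = {}"
  proof (rule ccontr)
    assume "coprime_splits k N \<noteq> {}"
    then obtain s t u v where "(s,t,u,v) \<in> coprime_splits k N" by auto
    note b = coprime_splits_bounds[OF this k]
    have "1 * (k * 1) \<le> s * (k * v)" using b k by (intro mult_le_mono) auto
    then have "k \<le> N" using b by linarith
    then show False using True k by (simp add: div_eq_0_iff)
  qed
  then show ?thesis using N by simp
next
  case False
  define m where "m = N div k"
  have m: "m \<ge> 1" "m \<le> N" using False by (auto simp: m_def Suc_le_eq)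
  have "card (coprime_splits k N) \<le> (\<Sum>v=1..m. 2 * (N div (k * v)))"
  proof (rule card_coprime_splits_by_v)
    fix s t u v assume "(s,t,u,v) \<in> coprime_splits k N"
    note b = coprime_splits_bounds[OF this k]
    have s1: "s \<ge> 1" using b by linarith
    have "s \<le> N div (k * v)" using b k by (simp add: less_eq_div_iff_mult_less_eq)
    moreover have "k * v \<le> N" using b(10) s1
      by (metis le_trans mult_le_mono1 nat_mult_1)
    then have "v \<le> m" using k by (simp add: m_def less_eq_div_iff_mult_less_eq mult.commute)
    ultimately show "v \<in> {1..m} \<and> s \<le> N div (k * v)" using b by simp
  qed auto
  then have "real (card (coprime_splits k N)) \<le> real (\<Sum>v=1..m. 2 * (N div (k * v)))" by (simp only: of_nat_le_iff)
  also have "\<dots> = (\<Sum>v=1..m. 2 * real (N div (k * v)))" by simp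
  also have "\<dots> \<le> (\<Sum>v=1..m. 2 * real N / real k * (1 / real v))"
  proof (rule sum_mono)
    fix v
    show "2 * real (N div (k * v)) \<le> 2 * real N / real k * (1 / real v)"
      using mult_left_mono[OF real_of_div_mult_le[of N k v], of 2] by simp
  qed
  also have "\<dots> = 2 * real N / real k * (\<Sum>v=1..m. 1 / real v)" by (simp only: sum_distrib_left)
  also have "\<dots> \<le> 2 * real N / real k * (1 + ln (real N))"
  proof (intro mult_left_mono)
    have "(\<Sum>v=1..m. 1 / real v) \<le> 1 + ln (real m)" by (rule harmonic_le_ln[OF m(1)])
    also have "ln (real m) \<le> ln (real N)" using m by (intro ln_mono) auto
    finally show "(\<Sum>v=1..m. 1 / real v) \<le> 1 + ln (real N)" by simp
  qed simp
  finally show ?thesis .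
qed

lemma sum_inverse_from_le:
  assumes "1 \<le> m" "m \<le> n"
  shows "(\<Sum>v=m..n. 1 / real v) \<le> 1 + ln (real n) - ln (real m)"
  using assms(2)
proof (induction n rule: nat_induct_at_least)
  case base
  show ?case using assms by simp
next
  case (Suc n)
  have "1 / (real n + 1) \<le> ln (real n + 1) - ln (real n)" using Suc assms by (intro ln_succ_diff) simp
  moreover have "(\<Sum>v=m..Suc n. 1 / real v) = (\<Sum>v=m..n. 1 / real v) + 1 / (real n + 1)"
    using Suc by (simp add: add.commute)
  moreover have "real (Suc n) = real n + 1" by simp
  ultimately show ?case using Suc by (simp only:)
qed

lemma sum_inverse_between_le:
  fixes x y :: real
  assumes "0 < x" "x \<le> y"
  shows "(\<Sum>v | 1 \<le> v \<and> x < real v \<and> real v \<le> y. 1 / real v) \<le> 1 + ln (y / x)"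
proof -
  define m n where "m = nat \<lfloor>x\<rfloor> + 1" and "n = nat \<lfloor>y\<rfloor>"
  have m: "real m > x" "m \<ge> 1" using assms unfolding m_def by linarith+
  have sub: "{v. 1 \<le> v \<and> x < real v \<and> real v \<le> y} \<subseteq> {m..n}"
  proof
    fix v assume "v \<in> {v. 1 \<le> v \<and> x < real v \<and> real v \<le> y}"
    then have "x < real v" "real v \<le> y" by auto
    then have "m \<le> v" "v \<le> n" unfolding m_def n_def using assms by linarith+
    then show "v \<in> {m..n}" by simp
  qed
  then have "(\<Sum>v | 1 \<le> v \<and> x < real v \<and> real v \<le> y. 1 / real v) \<le> (\<Sum>v=m..n. 1 / real v)"
    by (intro sum_mono2) auto
  also have "\<dots> \<le> 1 + ln (y / x)"
  proof (cases "m \<le> n")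
    case True
    have "real n \<le> y" using assms unfolding n_def by linarith
    then have "ln (real n) \<le> ln y" using True m assms by (intro ln_mono) auto
    moreover have "ln x \<le> ln (real m)" using m assms by (intro ln_mono) auto
    moreover have "ln (y / x) = ln y - ln x" using assms by (intro ln_divide_pos) auto
    ultimately show ?thesis using sum_inverse_from_le[OF m(2) True] by linarith
  next
    case False
    have "ln (y / x) \<ge> 0" using assms by (intro ln_ge_zero) auto
    then show ?thesis using False by simp
  qed
  finally show ?thesis .
qed

text \<open>The lower bound on \<open>u\<close> forces \<open>s \<le> Z * sqrt N\<close>, the one on
  \<open>s\<close> forces \<open>v \<le> x2\<close>. For \<open>v \<le> x1\<close> the first bound
  on \<open>s\<close> gives \<open>2 * N / k\<close> in total; beyond \<open>x1\<close> the bound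
  \<open>N / (k * v)\<close> gives a harmonic sum over a range of ratio
  \<open>Z\<^sup>2 * sqrt k\<close>, hence only logarithms of \<open>Z\<close> and
  \<open>k\<close>.\<close>

lemma card_middle_splits_le:
  fixes Z :: real
  assumes k: "1 \<le> k" and N: "N \<ge> 1" and Z: "Z \<ge> 1"
  shows "real (card {(s,t,u,v)\<in>coprime_splits k N. sqrt (real N / real k) / Z < real s \<and> sqrt (real N) / Z < real u})
    \<le> 2 * real N / real k * (2 + 2 * ln Z + ln (real k))"
proof -
  \<comment> \<open>At \<open>v = x1\<close> the two bounds \<open>Z * q\<close> and
    \<open>N / (k * v)\<close> for \<open>s\<close> coincide.\<close>
  define q x1 x2 where "q = sqrt (real N)" and "x1 = q / (real k * Z)" and "x2 = Z * sqrt (real N / real k)"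
  have q: "q > 0" "q * q = real N" using N by (auto simp: q_def)
  have rk: "real k \<ge> 1" "sqrt (real k) \<ge> 1" "sqrt (real k) * sqrt (real k) = real k" using k by auto
  have x2: "x2 = Z * q / sqrt (real k)" by (simp add: x2_def q_def real_sqrt_divide)
  have x1: "x1 > 0" using q Z rk by (simp add: x1_def)
  have ratio: "x2 / x1 = Z * Z * sqrt (real k)"
    unfolding x1_def x2 using q Z rk by (simp add: field_simps)
  have "1 * 1 * 1 \<le> Z * Z * sqrt (real k)"
    using Z rk by (intro mult_mono) auto
  then have r1: "1 \<le> Z * Z * sqrt (real k)" by simp
  let ?X = "{(s,t,u,v)\<in>coprime_splits k N. sqrt (real N / real k) / Z < real s \<and> sqrt (real N) / Z < real u}"
  define V where "V = {v::nat. 1 \<le> v \<and> real v \<le> x2}"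
  define V1 where "V1 = {v::nat. 1 \<le> v \<and> real v \<le> x1}"
  define V2 where "V2 = {v::nat. 1 \<le> v \<and> x1 < real v \<and> real v \<le> x2}"
  define T where "T = (\<lambda>v. min (nat \<lfloor>Z * q\<rfloor>) (N div (k * v)))"
  have x12: "x1 \<le> x2" using ratio r1 x1 by (metis le_divide_eq_1_pos)
  have fin: "finite {v::nat. 1 \<le> v \<and> real v \<le> x}" for x
    by (rule finite_subset[of _ "{..nat \<lfloor>x\<rfloor>}"]) (auto simp: le_nat_floor)
  have finV: "finite V" "finite V1" "finite V2"
    using fin[of x1] fin[of x2] by (auto simp: V_def V1_def V2_def intro: rev_finite_subset)
  have Vun: "V = V1 \<union> V2" "V1 \<inter> V2 = {}" using x12 by (auto simp: V_def V1_def V2_def)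
  have "card ?X \<le> (\<Sum>v\<in>V. 2 * T v)"
  proof (rule card_coprime_splits_by_v[OF finV(1)])
    fix s t u v assume "(s,t,u,v) \<in> ?X"
    then have h: "(s,t,u,v) \<in> coprime_splits k N" "sqrt (real N / real k) / Z < real s" "q / Z < real u"
      by (auto simp: q_def)
    note b = coprime_splits_bounds[OF h(1) k]
    have s0: "s > 0" using b by linarith
    have su: "real s * real u \<le> q * q" using b(9) q by (metis of_nat_le_iff of_nat_mult)
    have "real s * (q / Z) \<le> real s * real u" using h(3) by (intro mult_left_mono) auto
    then have "(real s / Z) * q \<le> q * q" using su by simp
    then have "real s / Z \<le> q" using q(1) by (simp only: mult_le_cancel_right_pos)
    then have "real s \<le> Z * q" using Z by (simp add: pos_divide_le_eq mult.commute)
    then have 1: "s \<le> nat \<lfloor>Z * q\<rfloor>" by (simp add: le_nat_floor)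
    have 2: "s \<le> N div (k * v)" using b k by (simp add: less_eq_div_iff_mult_less_eq)
    have "real s * (real k * real v) \<le> real N" using b(10) by (metis of_nat_le_iff of_nat_mult)
    moreover have "(sqrt (real N / real k) / Z) * (real k * real v) \<le> real s * (real k * real v)"
      using h(2) by (intro mult_right_mono) auto
    ultimately have 3: "(sqrt (real N / real k) / Z) * (real k * real v) \<le> real N" by linarith
    define y where "y = sqrt (real N / real k)"
    have y: "y > 0" "y * y * real k = real N" using N k by (auto simp: y_def)
    have "(y * real k) * real v \<le> (y * real k) * (Z * y)"
      using 3 Z y(2) unfolding y_def[symmetric] by (simp add: field_simps)
    then have "real v \<le> x2" using y k by (simp add: x2_def y_def[symmetric])
    then show "v \<in> V \<and> s \<le> T v" using b 1 2 by (simp add: V_def T_def)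
  qed (auto simp: V_def)
  then have "real (card ?X) \<le> real (\<Sum>v\<in>V. 2 * T v)" by (simp only: of_nat_le_iff)
  also have "\<dots> = (\<Sum>v\<in>V1. 2 * real (T v)) + (\<Sum>v\<in>V2. 2 * real (T v))"
    unfolding Vun(1) using finV Vun(2) by (simp add: sum.union_disjoint)
  also have "(\<Sum>v\<in>V1. 2 * real (T v)) \<le> (\<Sum>v\<in>V1. 2 * (Z * q))"
  proof (rule sum_mono)
    fix v
    have "real (T v) \<le> real (nat \<lfloor>Z * q\<rfloor>)" by (simp add: T_def)
    also have "\<dots> \<le> Z * q" using Z q by (intro of_nat_floor) auto
    finally show "2 * real (T v) \<le> 2 * (Z * q)" by simp
  qed
  also have "\<dots> \<le> x1 * (2 * (Z * q))"
  proof -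
    have "V1 \<subseteq> {1..nat \<lfloor>x1\<rfloor>}" by (auto simp: V1_def le_nat_floor)
    then have "card V1 \<le> nat \<lfloor>x1\<rfloor>" using card_mono[of "{1..nat \<lfloor>x1\<rfloor>}" V1] by simp
    then have "real (card V1) \<le> x1" using x1 by linarith
    then show ?thesis using Z q by (simp add: mult_right_mono)
  qed
  also have "\<dots> = 2 * real N / real k" using Z q rk unfolding x1_def by (simp add: field_simps)
  also have "(\<Sum>v\<in>V2. 2 * real (T v)) \<le> (\<Sum>v\<in>V2. 2 * real N / real k * (1 / real v))"
  proof (rule sum_mono)
    fix v
    have "real (T v) \<le> real (N div (k * v))" by (simp add: T_def)
    then show "2 * real (T v) \<le> 2 * real N / real k * (1 / real v)"
      using real_of_div_mult_le[of N k v] by simp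
  qed
  also have "\<dots> = 2 * real N / real k * (\<Sum>v\<in>V2. 1 / real v)" by (simp only: sum_distrib_left)
  also have "\<dots> \<le> 2 * real N / real k * (1 + ln (x2 / x1))"
    unfolding V2_def by (intro mult_left_mono sum_inverse_between_le x1 x12) simp
  also have "ln (x2 / x1) = 2 * ln Z + ln (real k) / 2"
  proof -
    have "ln (Z * Z * sqrt (real k)) = ln (Z * Z) + ln (sqrt (real k))" using Z rk by (intro ln_mult_pos) auto
    also have "ln (Z * Z) = ln Z + ln Z" using Z by (intro ln_mult_pos) auto
    also have "ln (sqrt (real k)) = ln (real k) / 2" using rk by (intro ln_sqrt) auto
    finally show ?thesis unfolding ratio by simp
  qed
  finally have "real (card ?X) \<le> 2 * real N / real k + 2 * real N / real k * (1 + (2 * ln Z + ln (real k) / 2))" by simp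
  also have "\<dots> = 2 * real N / real k * (2 + 2 * ln Z + ln (real k) / 2)" by (simp add: algebra_simps)
  also have "\<dots> \<le> 2 * real N / real k * (2 + 2 * ln Z + ln (real k))"
    using rk by (intro mult_left_mono) auto
  finally show ?thesis .
qed

section \<open>Asymptotics for the number of splittings\<close>

lemma card_Sigma_image:
  assumes "finite A" "\<And>a. a \<in> A \<Longrightarrow> finite (B a)" "inj_on f (Sigma A B)" "X = f ` Sigma A B"
  shows "card X = (\<Sum>a\<in>A. card (B a))"
  using assms by (simp add: card_image card_SigmaI)

lemma finite_split_set:
  assumes "a \<ge> 1" "b \<ge> 1"
  shows "finite {(x,y). 1 \<le> y \<and> c * y \<le> x \<and> coprime x y \<and> a * x + b * y = (N::nat)}"
proof (rule finite_subset)
  show "{(x,y). 1 \<le> y \<and> c * y \<le> x \<and> coprime x y \<and> a * x + b * y = N} \<subseteq> {..N} \<times> {..N}"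
  proof
    fix q assume "q \<in> {(x,y). 1 \<le> y \<and> c * y \<le> x \<and> coprime x y \<and> a * x + b * y = N}"
    then obtain x y where q: "q = (x,y)" "a * x + b * y = N" by auto
    have "x \<le> a * x" "y \<le> b * y" using assms by auto
    then have "x \<le> N" "y \<le> N" using q by linarith+
    then show "q \<in> {..N} \<times> {..N}" using q by simp
  qed
qed simp

lemma card_splits_small_s:
  assumes k: "1 \<le> k"
  shows "card {(s,t,u,v)\<in>coprime_splits k N. s \<le> n} = (\<Sum>(s,t)\<in>coprime_ratio_pairs 1 n. split_count k s t N)"
proof -
  let ?B = "\<lambda>(s,t). {(x,y). 1 \<le> y \<and> k * y \<le> x \<and> coprime x y \<and> s * x + t * y = N}"
  have "card {(s,t,u,v)\<in>coprime_splits k N. s \<le> n} = (\<Sum>p\<in>coprime_ratio_pairs 1 n. card (?B p))"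
  proof (rule card_Sigma_image[where f = "\<lambda>((s,t),(u,v)). (s,t,u,v)"])
    show "finite (coprime_ratio_pairs 1 n)" by (rule finite_coprime_ratio_pairs) simp
    show "finite (?B p)" if "p \<in> coprime_ratio_pairs 1 n" for p
    proof -
      obtain s t where "p = (s,t)" by (cases p)
      moreover from this have "s \<ge> 1" "t \<ge> 1" using that by (auto simp: coprime_ratio_pairs_def ratio_pairs_def)
      ultimately show ?thesis using finite_split_set[of s t k N] by simp
    qed
    show "inj_on (\<lambda>((s,t),(u,v)). (s,t,u,v)) (Sigma (coprime_ratio_pairs 1 n) ?B)" by (auto simp: inj_on_def)
    show "{(s,t,u,v)\<in>coprime_splits k N. s \<le> n} = (\<lambda>((s,t),(u,v)). (s,t,u,v)) ` (Sigma (coprime_ratio_pairs 1 n) ?B)"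
      by (force simp: coprime_splits_def coprime_ratio_pairs_def ratio_pairs_def image_iff)
  qed
  then show ?thesis by (simp add: split_count_def case_prod_unfold)
qed

lemma card_splits_small_u:
  assumes k: "1 \<le> k"
  shows "card {(s,t,u,v)\<in>coprime_splits k N. u \<le> n} = (\<Sum>(u,v)\<in>coprime_ratio_pairs k n. split_count 1 u v N)"
proof -
  let ?B = "\<lambda>(u,v). {(x,y). 1 \<le> y \<and> 1 * y \<le> x \<and> coprime x y \<and> u * x + v * y = N}"
  have "card {(s,t,u,v)\<in>coprime_splits k N. u \<le> n} = (\<Sum>p\<in>coprime_ratio_pairs k n. card (?B p))"
  proof (rule card_Sigma_image[where f = "\<lambda>((u,v),(s,t)). (s,t,u,v)"])
    show "finite (coprime_ratio_pairs k n)" using k by (rule finite_coprime_ratio_pairs)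
    show "finite (?B p)" if "p \<in> coprime_ratio_pairs k n" for p
    proof -
      obtain s t where "p = (s,t)" by (cases p)
      moreover from this have "s \<ge> 1" "t \<ge> 1" using that by (auto simp: coprime_ratio_pairs_def ratio_pairs_def)
      ultimately show ?thesis using finite_split_set[of s t 1 N] by simp
    qed
    show "inj_on (\<lambda>((u,v),(s,t)). (s,t,u,v)) (Sigma (coprime_ratio_pairs k n) ?B)" by (auto simp: inj_on_def)
    show "{(s,t,u,v)\<in>coprime_splits k N. u \<le> n} = (\<lambda>((u,v),(s,t)). (s,t,u,v)) ` (Sigma (coprime_ratio_pairs k n) ?B)"
    proof (rule set_eqI)
      fix q :: "nat \<times> nat \<times> nat \<times> nat"
      obtain s t u v where q: "q = (s,t,u,v)" by (cases q) auto
      have "u \<ge> 1" if "1 \<le> v" "k * v \<le> u"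
      proof -
        have "1 * 1 \<le> k * v" using that k by (intro mult_le_mono) auto
        then show ?thesis using that by linarith
      qed
      then show "q \<in> {(s,t,u,v)\<in>coprime_splits k N. u \<le> n} \<longleftrightarrow>
          q \<in> (\<lambda>((u,v),(s,t)). (s,t,u,v)) ` (Sigma (coprime_ratio_pairs k n) ?B)"
        unfolding q
        by (auto simp: coprime_splits_def coprime_ratio_pairs_def ratio_pairs_def image_iff mult.commute)
    qed
  qed
  then show ?thesis by (simp add: split_count_def case_prod_unfold)
qed

text \<open>A crude bound for the total weight. It only multiplies the sieve tail, which is small
  enough to pay for the factor \<open>1 + ln N\<close>.\<close>

lemma sum_pair_weight_le:
  assumes e: "e \<ge> 1" and c: "c \<ge> 1" and n: "n \<le> N" and N: "N \<ge> 1"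
  shows "0 \<le> sum (pair_weight c) (coprime_ratio_pairs e n)"
    and "sum (pair_weight c) (coprime_ratio_pairs e n) \<le> (1 + ln (real N)) / real (c * e)"
proof -
  show "0 \<le> sum (pair_weight c) (coprime_ratio_pairs e n)"
    by (rule sum_nonneg) (auto simp: pair_weight_def)
  have "sum (pair_weight c) (coprime_ratio_pairs e n) \<le> sum (pair_weight c) (ratio_pairs e n)"
    using finite_ratio_pairs[OF e] by (intro sum_mono2) (auto simp: coprime_ratio_pairs_def pair_weight_def)
  also have "\<dots> = (\<Sum>s=1..n. (\<Sum>t=1..s div e. 1 / (real (c * s) + real t)) / real s)"
    by (rule sum_ratio_pairs_nested[OF e c])
  also have "\<dots> \<le> (\<Sum>s=1..n. 1 / real (c * e) * (1 / real s))"
  proof (rule sum_mono)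
    fix s assume s: "s \<in> {1..n}"
    have "(\<Sum>t=1..s div e. 1 / (real (c * s) + real t)) \<le> (\<Sum>t=1..s div e. 1 / real (c * s))"
      using s c by (intro sum_mono divide_left_mono) (auto intro!: add_pos_nonneg mult_pos_pos)
    also have "\<dots> = real (s div e) * (1 / real (c * s))" by simp
    also have "\<dots> \<le> real s / real e * (1 / real (c * s))"
      by (intro mult_right_mono of_nat_div_le_divide) simp
    also have "\<dots> = 1 / real (c * e)" using s c e by (simp add: field_simps)
    finally show "(\<Sum>t=1..s div e. 1 / (real (c * s) + real t)) / real s \<le> 1 / real (c * e) * (1 / real s)"
      using divide_right_mono[of _ _ "real s"] by fastforce
  qed
  also have "\<dots> = 1 / real (c * e) * (\<Sum>s=1..n. 1 / real s)" by (simp only: sum_distrib_left)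
  also have "\<dots> \<le> 1 / real (c * e) * (1 + ln (real N))"
  proof (intro mult_left_mono)
    have "(\<Sum>s=1..n. 1 / real s) \<le> (\<Sum>s=1..N. 1 / real s)" using n by (intro sum_mono2) auto
    then show "(\<Sum>s=1..n. 1 / real s) \<le> 1 + ln (real N)" using harmonic_le_ln[OF N] by linarith
  qed simp
  finally show "sum (pair_weight c) (coprime_ratio_pairs e n) \<le> (1 + ln (real N)) / real (c * e)" by simp
qed

lemma card_coprime_ratio_pairs_le:
  assumes e: "e \<ge> 1"
  shows "real (card (coprime_ratio_pairs e n)) \<le> real n * real n / real e"
proof -
  have "card (coprime_ratio_pairs e n) \<le> card (ratio_pairs e n)"
    using finite_ratio_pairs[OF e] by (intro card_mono) (auto simp: coprime_ratio_pairs_def)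
  also have "\<dots> = (\<Sum>s=1..n. s div e)" unfolding ratio_pairs_Sigma[OF e] by (subst card_SigmaI) auto
  also have "\<dots> \<le> (\<Sum>s=1..n. n div e)" by (intro sum_mono div_le_mono) auto
  also have "\<dots> = n * (n div e)" by simp
  finally have "real (card (coprime_ratio_pairs e n)) \<le> real (n * (n div e))" by (simp only: of_nat_le_iff)
  also have "\<dots> = real n * real (n div e)" by simp
  also have "\<dots> \<le> real n * (real n / real e)" by (intro mult_left_mono of_nat_div_le_divide) simp
  finally show ?thesis by simp
qed

text \<open>Two errors add up: at most \<open>2 * Z\<close> for each of at most
  \<open>n * n / e\<close> pairs, held at \<open>2 * N / (c * e)\<close> by \<open>nZ\<close>, and
  twice the tail times the total weight, held at \<open>4 * N / (c * e)\<close> by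
  \<open>\<tau>\<close>.\<close>

lemma sum_split_count_sieve:
  assumes e: "e \<ge> 1" and c: "c \<ge> 1" and n: "n \<le> N" and N: "N \<ge> 1"
    and J: "real (sieve_terms r N) \<le> Z" and \<tau>: "sieve_tail r N * (1 + ln (real N)) \<le> 2"
    and nZ: "real n * real n / real e * Z \<le> real N / real (c * e)"
  shows "\<bar>real (\<Sum>(s,t)\<in>coprime_ratio_pairs e n. split_count c s t N)
      - real (totient N) * sum (pair_weight c) (coprime_ratio_pairs e n)\<bar> \<le> 6 * real N / real (c * e)"
proof -
  let ?P = "coprime_ratio_pairs e n"
  let ?W = "sum (pair_weight c) ?P"
  have tail0: "sieve_tail r N \<ge> 0" unfolding sieve_tail_def by (intro sum_nonneg) (auto simp: prod_nonneg)
  have "real (\<Sum>(s,t)\<in>?P. split_count c s t N) - real (totient N) * ?W =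
     (\<Sum>q\<in>?P. real (case q of (s,t) \<Rightarrow> split_count c s t N) - real (totient N) * pair_weight c q)"
    by (simp add: sum_subtractf sum_distrib_left)
  also have "\<bar>\<dots>\<bar> \<le> (\<Sum>q\<in>?P. \<bar>real (case q of (s,t) \<Rightarrow> split_count c s t N) - real (totient N) * pair_weight c q\<bar>)"
    by (rule sum_abs)
  also have "\<dots> \<le> (\<Sum>q\<in>?P. 2 * Z + 2 * real N * sieve_tail r N * pair_weight c q)"
  proof (rule sum_mono)
    fix q assume "q \<in> ?P"
    then obtain s t where q: "q = (s,t)" and st: "coprime s t" "s \<ge> 1" "t \<ge> 1"
      by (auto simp: coprime_ratio_pairs_def ratio_pairs_def)
    have "\<bar>real (split_count c s t N) - real (totient N) / real (s * (c * s + t))\<bar>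
           \<le> 2 * real (sieve_terms r N) + 2 * (real N / real (s * (c * s + t))) * sieve_tail r N"
      using N by (intro split_count_sieve st) auto
    then show "\<bar>real (case q of (s,t) \<Rightarrow> split_count c s t N) - real (totient N) * pair_weight c q\<bar>
        \<le> 2 * Z + 2 * real N * sieve_tail r N * pair_weight c q"
      unfolding q pair_weight_def prod.case using J by (simp add: mult_ac)
  qed
  also have "\<dots> = 2 * (real (card ?P) * Z) + 2 * real N * (sieve_tail r N * ?W)"
    by (simp add: sum.distrib sum_distrib_left mult_ac)
  also have "real (card ?P) * Z \<le> real n * real n / real e * Z"
    using J by (intro mult_right_mono card_coprime_ratio_pairs_le e) linarith
  also have "\<dots> \<le> real N / real (c * e)" by (rule nZ)
  also have "sieve_tail r N * ?W \<le> sieve_tail r N * ((1 + ln (real N)) / real (c * e))"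
    by (intro mult_left_mono sum_pair_weight_le assms tail0)
  also have "\<dots> = sieve_tail r N * (1 + ln (real N)) / real (c * e)" by simp
  also have "\<dots> \<le> 2 / real (c * e)" using \<tau> by (intro divide_right_mono) auto
  finally show ?thesis by (simp add: mult_left_mono)
qed

text \<open>Rounding down changes the logarithm by at most \<open>ln 2\<close> if
  \<open>x \<ge> 1\<close>. Otherwise the sum is empty, and the main term is harmless because
  \<open>x \<ge> 1 / Z\<close> keeps \<open>ln x\<close> above \<open>- ln Z\<close>; so the cutoffs
  may fall below 1.\<close>

lemma floor_main_term:
  fixes G :: "nat \<Rightarrow> real"
  assumes G0: "G 0 = 0" and G: "\<And>n. n \<ge> 1 \<Longrightarrow> \<bar>G n - c * a * ln (real n)\<bar> \<le> E"
    and c: "0 \<le> c" "c \<le> 1" and a: "0 \<le> a" and E: "E \<ge> 0" and x: "x \<ge> 1 / Z" and Z: "Z \<ge> 1"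
  shows "\<bar>G (nat \<lfloor>x\<rfloor>) - c * a * ln x\<bar> \<le> E + a * (1 + ln Z)"
proof -
  have ca: "0 \<le> c * a" "c * a \<le> a" using c a mult_right_mono[of c 1 a] by auto
  have x0: "x > 0" using x Z by (meson divide_pos_pos less_le_trans zero_less_one)
  have lnZ: "ln Z \<ge> 0" using Z by simp
  have "\<bar>G (nat \<lfloor>x\<rfloor>) - c * a * ln x\<bar> \<le> E + c * a * (1 + ln Z)"
  proof (cases "x \<ge> 1")
    case True
    define n where "n = nat \<lfloor>x\<rfloor>"
    have n1: "n \<ge> 1" "real n \<le> x" "x \<le> real n + 1" using True unfolding n_def by linarith+
    moreover have "real n \<ge> 1" using n1 by simp
    ultimately have n: "n \<ge> 1" "real n \<le> x" "x \<le> 2 * real n" by linarith+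
    have "ln (real n) \<le> ln x" using n by (intro ln_mono) auto
    moreover have "ln x \<le> ln (2 * real n)" using n True by (intro ln_mono) auto
    moreover have "ln (2 * real n) = ln 2 + ln (real n)" using n by (intro ln_mult_pos) auto
    moreover have "ln 2 \<le> (1::real)" using ln_add_one_self_le_self[of 1] by simp
    ultimately have "\<bar>ln (real n) - ln x\<bar> \<le> 1 + ln Z" using lnZ by linarith
    then have "c * a * \<bar>ln (real n) - ln x\<bar> \<le> c * a * (1 + ln Z)" using ca by (intro mult_left_mono)
    moreover have "\<bar>c * a * ln (real n) - c * a * ln x\<bar> = c * a * \<bar>ln (real n) - ln x\<bar>"
      unfolding right_diff_distrib[symmetric] abs_mult using c a by simp
    ultimately show ?thesis using G[OF n(1)] unfolding n_def by linarith
  next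
    case False
    then have "nat \<lfloor>x\<rfloor> = 0" using x0 by linarith
    have "ln (1 / Z) \<le> ln x" using x Z by (intro ln_mono) auto
    then have "- ln Z \<le> ln x" using Z by (simp add: ln_div)
    moreover have "ln x \<le> 0" using False x0 by simp
    ultimately have "\<bar>ln x\<bar> \<le> 1 + ln Z" using lnZ by linarith
    then have "c * a * \<bar>ln x\<bar> \<le> c * a * (1 + ln Z)" using ca by (intro mult_left_mono)
    moreover have "\<bar>c * a * ln x\<bar> = c * a * \<bar>ln x\<bar>" unfolding abs_mult using ca c a by simp
    ultimately show ?thesis using G0 E \<open>nat \<lfloor>x\<rfloor> = 0\<close> by simp
  qed
  also have "c * a * (1 + ln Z) \<le> a * (1 + ln Z)" using ca lnZ by (intro mult_right_mono) auto
  finally show ?thesis by simp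
qed

text \<open>Small \<open>s\<close> and small \<open>u\<close> are disjoint ranges that the sieve
  evaluates; the rest is the middle range. The cutoffs satisfy
  \<open>ln x + ln y = ln N - ln k / 2 - 2 * ln Z\<close>, so the two main terms combine to the full
  \<open>ln N\<close>, up to logarithms that the error already contains.\<close>

lemma card_coprime_splits_asymptotic:
  fixes Z :: real
  assumes k: "1 \<le> k" "k \<le> N" and N: "N \<ge> 1" and Z: "Z \<ge> 2"
    and J: "real (sieve_terms r N) \<le> Z" and \<tau>: "sieve_tail r N * (1 + ln (real N)) \<le> 2"
  shows "\<bar>real (card (coprime_splits k N)) - real (totient N) * (6 / pi\<^sup>2 * ln (1 + 1 / real k) * ln (real N))\<bar>
    \<le> real N / real k * (94 + 8 * ln Z + 7 * ln (real k))"
proof -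
  \<comment> \<open>The divisor \<open>Z\<close> makes the number of pairs times the sieve error
    \<open>Z\<close> at most \<open>N / k\<close> in both ranges.\<close>
  define x y where "x = sqrt (real N / real k) / Z" and "y = sqrt (real N) / Z"
  define S0 U0 where "S0 = nat \<lfloor>x\<rfloor>" and "U0 = nat \<lfloor>y\<rfloor>"
  define a c where "a = ln (1 + 1 / real k)" and "c = 6 / pi\<^sup>2"
  have a: "0 \<le> a" "a \<le> 1 / real k" using ln_1_plus_inverse_bounds[OF k(1)] by (auto simp: a_def)
  have c: "0 \<le> c" "c \<le> 1"
  proof -
    have "pi\<^sup>2 \<ge> 3\<^sup>2" using pi_gt3 by (intro power_mono) auto
    then show "c \<le> 1" by (simp add: c_def divide_simps)
  qed (simp add: c_def)
  have lk: "ln (real k) \<ge> 0" and lZ: "ln Z \<ge> 0" using k Z by auto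
  have rk: "real k \<ge> 1" "real k \<le> real N" using k by auto
  have sN: "sqrt (real N) \<ge> 1" "sqrt (real N) * sqrt (real N) = real N" using N by auto
  have q: "sqrt (real N / real k) \<ge> 1" "sqrt (real N / real k) * sqrt (real N / real k) = real N / real k"
    "sqrt (real N / real k) \<le> sqrt (real N)"
    using rk by (auto simp: field_simps)
  have x: "x \<ge> 1 / Z" "x > 0" and y: "y \<ge> 1 / Z" "y > 0"
    using q sN Z by (auto simp: x_def y_def divide_right_mono intro!: divide_pos_pos)
  have S0x: "real S0 \<le> x" and U0y: "real U0 \<le> y" using x y unfolding S0_def U0_def by linarith+
  have xx: "x * x = real N / real k / (Z * Z)" and yy: "y * y = real N / (Z * Z)"
    using q sN by (simp_all add: x_def y_def)
  have sN2: "sqrt (real N) \<le> real N" using sN by (metis mult.right_neutral mult_left_mono order_trans zero_le_one)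
  have "y \<le> sqrt (real N) / 1" unfolding y_def using Z sN by (intro divide_left_mono) auto
  then have yN: "y \<le> real N" using sN2 by simp
  have "x \<le> y" unfolding x_def y_def using q Z by (intro divide_right_mono) auto
  then have S0N: "S0 \<le> N" and U0N: "U0 \<le> N" using S0x U0y yN by linarith+
  let ?C = "coprime_splits k N"
  define A where "A = {(s,t,u,v)\<in>?C. s \<le> S0}"
  define B where "B = {(s,t,u,v)\<in>?C. u \<le> U0}"
  define X where "X = {(s,t,u,v)\<in>?C. sqrt (real N / real k) / Z < real s \<and> sqrt (real N) / Z < real u}"
  have fin: "finite ?C" using k(1) by (rule finite_coprime_splits)
  have finA: "finite A" "finite B" "finite X"
    using fin by (auto simp: A_def B_def X_def intro: rev_finite_subset)
  \<comment> \<open>In both ranges at once, \<open>N \<le> 2 * s * u\<close> would be at most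
    \<open>2 * N / Z\<^sup>2\<close>; this is what \<open>Z \<ge> 2\<close> excludes.\<close>
  have AB: "A \<inter> B = {}"
  proof (rule ccontr)
    assume "A \<inter> B \<noteq> {}"
    then obtain s t u v where h: "(s,t,u,v) \<in> ?C" "s \<le> S0" "u \<le> U0" by (auto simp: A_def B_def)
    note b = coprime_splits_bounds[OF h(1) k(1)]
    have "real N \<le> 2 * (real s * real u)" using b(11) by (metis of_nat_le_iff of_nat_mult of_nat_numeral)
    also have "\<dots> \<le> 2 * (y * y)"
      using h S0x U0y \<open>x \<le> y\<close> by (intro mult_left_mono mult_mono) auto
    also have "\<dots> = 2 * real N / (Z * Z)" by (simp add: yy)
    also have "\<dots> < real N"
    proof -
      have "2 * 2 \<le> Z * Z" using Z by (intro mult_mono) auto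
      then have "2 < Z * Z" by simp
      then show ?thesis using N by (simp add: pos_divide_less_eq)
    qed
    finally show False by simp
  qed
  have "?C = A \<union> B \<union> X"
  proof -
    have "real s > x" if "\<not> s \<le> S0" for s using that unfolding S0_def by linarith
    moreover have "real u > y" if "\<not> u \<le> U0" for u using that unfolding U0_def by linarith
    ultimately show ?thesis by (auto simp: A_def B_def X_def x_def y_def)
  qed
  then have "card ?C \<le> card A + card B + card X"
    by (metis card_Un_le add_le_mono1 order_trans)
  moreover have "card A + card B \<le> card ?C"
    using AB fin finA by (subst card_Un_disjoint[symmetric]) (auto intro!: card_mono simp: A_def B_def)
  moreover have "real (card X) \<le> 2 * real N / real k * (2 + 2 * ln Z + ln (real k))"
    unfolding X_def using k N Z by (intro card_middle_splits_le) auto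
  ultimately have 1: "\<bar>real (card ?C) - (real (card A) + real (card B))\<bar> \<le> 2 * real N / real k * (2 + 2 * ln Z + ln (real k))"
    by linarith
  define GA where "GA = sum (pair_weight k) (coprime_ratio_pairs 1 S0)"
  define GB where "GB = sum (pair_weight 1) (coprime_ratio_pairs k U0)"
  have "real S0 * real S0 \<le> x * x" "real U0 * real U0 \<le> y * y"
    using S0x U0y by (auto intro!: mult_mono)
  then have SZ: "real S0 * real S0 * Z \<le> x * x * Z" "real U0 * real U0 * Z \<le> y * y * Z"
    using Z by (auto intro!: mult_right_mono)
  have "x * x * Z = real N / real k / Z" "y * y * Z = real N / Z" unfolding xx yy using Z by (auto simp: field_simps)
  moreover have "real N / real k / Z \<le> real N / real k / 1" "real N / Z \<le> real N / 1"
    using Z by (intro divide_left_mono; simp)+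
  ultimately have SZ': "real S0 * real S0 * Z \<le> real N / real k" "real U0 * real U0 * Z \<le> real N"
    using SZ by auto
  have nzB: "real U0 * real U0 / real k * Z \<le> real N / real k"
    using divide_right_mono[OF SZ'(2), of "real k"] by simp
  have 2: "\<bar>real (card A) - real (totient N) * GA\<bar> \<le> 6 * real N / real k"
    unfolding A_def card_splits_small_s[OF k(1)] GA_def
    using sum_split_count_sieve[OF order_refl k(1) S0N N J \<tau>] SZ' by simp
  have 3: "\<bar>real (card B) - real (totient N) * GB\<bar> \<le> 6 * real N / real k"
    unfolding B_def card_splits_small_u[OF k(1)] GB_def
    using sum_split_count_sieve[OF k(1) order_refl U0N N J \<tau>] nzB by simp
  have 4: "\<bar>GA - c * a * ln x\<bar> \<le> 32 / real k + a * (1 + ln Z)"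
  proof -
    have G: "\<bar>sum (pair_weight k) (coprime_ratio_pairs 1 n) - c * a * ln (real n)\<bar> \<le> 32 / real k"
      if "n \<ge> 1" for n using coprime_pair_sum_left[OF k(1) that] by (simp add: a_def c_def)
    have G0: "sum (pair_weight k) (coprime_ratio_pairs 1 0) = 0"
      by (rule sum.neutral) (auto simp: coprime_ratio_pairs_def ratio_pairs_def)
    show ?thesis unfolding GA_def S0_def using Z
      by (intro floor_main_term[where G = "\<lambda>n. sum (pair_weight k) (coprime_ratio_pairs 1 n)"] G0 G c a x) auto
  qed
  have 5: "\<bar>GB - c * a * ln y\<bar> \<le> 4 * (11 + ln (real k)) / real k + a * (1 + ln Z)"
  proof -
    have E: "4 * (11 + ln (real k)) / real k \<ge> 0" using lk by simp
    have G: "\<bar>sum (pair_weight 1) (coprime_ratio_pairs k n) - c * a * ln (real n)\<bar> \<le> 4 * (11 + ln (real k)) / real k"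
      if "n \<ge> 1" for n using coprime_pair_sum_right[OF k(1) that] by (simp add: a_def c_def)
    have G0: "sum (pair_weight 1) (coprime_ratio_pairs k 0) = 0"
      by (rule sum.neutral) (auto simp: coprime_ratio_pairs_def ratio_pairs_def)
    show ?thesis unfolding GB_def U0_def using Z
      by (intro floor_main_term[where G = "\<lambda>n. sum (pair_weight 1) (coprime_ratio_pairs k n)"] G0 G c a E y) auto
  qed
  have lxy: "ln x + ln y = ln (real N) - (ln (real k) / 2 + 2 * ln Z)"
  proof -
    have "ln x = ln (sqrt (real N / real k)) - ln Z" unfolding x_def using q Z by (intro ln_divide_pos) auto
    also have "ln (sqrt (real N / real k)) = ln (real N / real k) / 2" using rk by (intro ln_sqrt) auto
    also have "ln (real N / real k) = ln (real N) - ln (real k)" using rk by (intro ln_divide_pos) auto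
    finally have "ln x = (ln (real N) - ln (real k)) / 2 - ln Z" .
    moreover have "ln y = ln (sqrt (real N)) - ln Z" unfolding y_def using sN Z by (intro ln_divide_pos) auto
    moreover have "ln (sqrt (real N)) = ln (real N) / 2" using rk by (intro ln_sqrt) auto
    ultimately show ?thesis by (simp add: field_simps)
  qed
  have ca: "0 \<le> c * a" "c * a \<le> 1 / real k" using c a mult_right_mono[of c 1 a] by auto
  define Y where "Y = c * a * (ln (real k) / 2 + 2 * ln Z)"
  have Y: "0 \<le> Y" unfolding Y_def using ca lk lZ by simp
  have Y': "Y \<le> 1 / real k * (ln (real k) / 2 + 2 * ln Z)"
    unfolding Y_def using lk lZ by (intro mult_right_mono ca) simp
  have "c * a * ln x + c * a * ln y = c * a * ln (real N) - Y"
    unfolding Y_def distrib_left[symmetric] right_diff_distrib[symmetric] lxy ..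
  moreover have aZ: "a * (1 + ln Z) \<le> 1 / real k * (1 + ln Z)" using a lZ by (intro mult_right_mono) auto
  ultimately have "\<bar>GA + GB - c * a * ln (real N)\<bar> \<le> 32 / real k + 4 * (11 + ln (real k)) / real k
      + 2 * (1 / real k * (1 + ln Z)) + 1 / real k * (ln (real k) / 2 + 2 * ln Z)"
    using 4 5 Y Y' by linarith
  also have "\<dots> = 1 / real k * (78 + 9 / 2 * ln (real k) + 4 * ln Z)" by (simp add: algebra_simps add_divide_distrib)
  also have "\<dots> \<le> 1 / real k * (78 + 5 * ln (real k) + 4 * ln Z)" using lk by (intro mult_left_mono) auto
  finally have "real (totient N) * \<bar>GA + GB - c * a * ln (real N)\<bar>
      \<le> real N * (1 / real k * (78 + 5 * ln (real k) + 4 * ln Z))"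
    using lk lZ by (intro mult_mono) (auto simp: totient_le)
  then have 6: "\<bar>real (totient N) * GA + real (totient N) * GB - real (totient N) * (c * a * ln (real N))\<bar>
      \<le> real N / real k * (78 + 5 * ln (real k) + 4 * ln Z)"
    by (simp add: distrib_left[symmetric] right_diff_distrib[symmetric] abs_mult)
  have "\<bar>real (card ?C) - real (totient N) * (c * a * ln (real N))\<bar> \<le>
     2 * real N / real k * (2 + 2 * ln Z + ln (real k)) + 12 * real N / real k +
     real N / real k * (78 + 5 * ln (real k) + 4 * ln Z)"
    using 1 2 3 6 by linarith
  also have "\<dots> = real N / real k * (94 + 8 * ln Z + 7 * ln (real k))" by (simp add: algebra_simps add_divide_distrib)
  finally show ?thesis by (simp add: a_def c_def)
qed

section \<open>Large partial quotients on average\<close>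

lemma filterlim_ln_ln: "filterlim (\<lambda>N::nat. ln (ln (real N))) at_top sequentially"
  by real_asymp

text \<open>The level \<open>r \<approx> 8 w / ln w\<close> with \<open>w = ln (ln N)\<close> makes the tail at most \<open>1 / ln N\<close> (take the
  Rankin weight \<open>\<lambda> \<approx> \<surd>w\<close>), while the number of terms is at most \<open>(3 ln N)\<^bsup>r+1\<^esup> = exp (O(w\<^sup>2 / ln w))\<close>.\<close>
lemma sieve_parameters:
  shows "\<forall>\<^sub>F N in sequentially. \<exists>r Z. Z \<ge> 2 \<and> real (sieve_terms r N) \<le> Z \<and>
      sieve_tail r N * (1 + ln (real N)) \<le> 2 \<and>
      ln Z \<le> 20 * ((ln (ln (real N)))\<^sup>2 / ln (ln (ln (real N))))"
proof -
  obtain K where K: "K > 0" "\<And>N. N \<ge> 3 \<Longrightarrow> real N / real (totient N) \<le> K * ln (ln (real N))"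
    using totient_lower_bound by blast
  \<comment> \<open>With \<open>l\<close> about \<open>sqrt w\<close>, the factor
    \<open>(K * w) ^ l\<close> of the Rankin bound is at most \<open>exp w\<close>; this fixes how
    fast \<open>l\<close> may grow.\<close>
  have "\<forall>\<^sub>F w in at_top. sqrt w * ln (K * w) \<le> (w::real)" using K(1) by real_asymp
  then have "\<forall>\<^sub>F w in at_top. sqrt w * ln (K * w) \<le> w \<and> w \<ge> 16 \<and> K * w \<ge> 1"
    using eventually_ge_at_top[of 16] eventually_ge_at_top[of "1 / K"]
    by eventually_elim (use K(1) in \<open>auto simp: field_simps\<close>)
  from eventually_compose_filterlim[OF this filterlim_ln_ln] eventually_ge_at_top[of 3]
  show ?thesis
  proof eventually_elim
    case (elim N)
    define w where "w = ln (ln (real N))"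
    have N: "N \<ge> 3" and w: "sqrt w * ln (K * w) \<le> w" "w \<ge> 16" "K * w \<ge> 1"
      using elim by (auto simp: w_def)
    have "ln 3 \<le> ln (real N)" using N by simp
    then have lnN: "ln (real N) > 1" using ln3_gt_1 by linarith
    have ew: "exp w = ln (real N)" unfolding w_def using lnN by (intro exp_ln) simp
    have lw: "ln w \<ge> 4 * ln 2"
    proof -
      have "ln (2 ^ 4) \<le> ln w" using w by (intro ln_mono) auto
      then show ?thesis by (simp only: ln_realpow[of 2] zero_less_numeral)
    qed
    have lw0: "ln w > 0" using w by simp
    have lww: "ln w \<le> w" using w by (intro ln_bound) auto
    define l where "l = nat \<lfloor>sqrt w\<rfloor>"
    have sw: "sqrt w \<ge> 4" using real_sqrt_le_mono[OF w(2)] by simp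
    have l: "real l \<le> sqrt w" "real l \<ge> sqrt w / 2" "l \<ge> 1" using sw unfolding l_def by linarith+
    have ll: "ln (real l) \<ge> ln w / 4"
    proof -
      have "ln (sqrt w / 2) \<le> ln (real l)" using l sw w(2) by (intro ln_mono) auto
      moreover have "ln (sqrt w / 2) = ln (sqrt w) - ln 2" using w(2) by (intro ln_divide_pos) auto
      moreover have "ln (sqrt w) = ln w / 2" using w by (intro ln_sqrt) auto
      ultimately show ?thesis using lw by linarith
    qed
    \<comment> \<open>As \<open>ln l \<ge> ln w / 4\<close>, the factor 8 makes
      \<open>(r + 1) * ln l\<close> at least \<open>2 * w\<close>. One \<open>w\<close> pays for
      \<open>(K * w) ^ l\<close>, the other leaves \<open>exp (- w) = 1 / ln N\<close>.\<close>
    define r where "r = nat \<lceil>8 * w / ln w\<rceil>"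
    have wlw: "w / ln w \<ge> 1" using lww lw0 by simp
    have r: "real r + 1 \<ge> 8 * (w / ln w)" "real r + 1 \<le> 10 * (w / ln w)"
    proof -
      have "8 * w / ln w \<ge> 0" using w lw0 by simp
      then have "real r \<ge> 8 * w / ln w" "real r \<le> 8 * w / ln w + 1" unfolding r_def by linarith+
      then show "real r + 1 \<ge> 8 * (w / ln w)" "real r + 1 \<le> 10 * (w / ln w)" using wlw by auto
    qed
    \<comment> \<open>At most \<open>2 * ln N\<close> primes divide \<open>N\<close>; together with
      the choice of no prime this is at most \<open>3 * ln N\<close> options per step in
      \<open>card_subsets_le\<close>.\<close>
    define Z where "Z = (3 * ln (real N)) ^ (r + 1)"
    have Z: "Z \<ge> 2"
    proof -
      have "3 * ln (real N) \<le> Z" unfolding Z_def using lnN by (intro self_le_power) auto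
      then show ?thesis using lnN by linarith
    qed
    have J: "real (sieve_terms r N) \<le> Z"
    proof -
      have "sieve_terms r N \<le> (card (prime_factors N) + 1) ^ Suc r"
        unfolding sieve_terms_def by (rule card_subsets_le) simp
      then have "real (sieve_terms r N) \<le> real ((card (prime_factors N) + 1) ^ Suc r)" by (simp only: of_nat_le_iff)
      also have "\<dots> = (real (card (prime_factors N)) + 1) ^ (r + 1)"
        by (simp only: of_nat_power of_nat_add of_nat_1 Suc_eq_plus1)
      also have "\<dots> \<le> Z" unfolding Z_def
        using card_prime_factors_le_ln[of N] lnN N by (intro power_mono) auto
      finally show ?thesis .
    qed
    have tail: "sieve_tail r N * (1 + ln (real N)) \<le> 2"
    proof -
      have l0: "real l > 0" using l by simp
      have "sieve_tail r N \<le> (real N / real (totient N)) ^ l / real l ^ (r + 1)"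
        using N l by (intro sieve_tail_bound) auto
      also have "\<dots> \<le> (K * w) ^ l / real l ^ (r + 1)"
        using K(2)[OF N] by (intro divide_right_mono power_mono) (auto simp: w_def)
      also have "\<dots> \<le> 1 / ln (real N)"
      proof -
        have "ln ((K * w) ^ l / real l ^ (r + 1)) = real l * ln (K * w) - real (r + 1) * ln (real l)"
          using l0 w by (subst ln_divide_pos) (auto simp: ln_realpow simp del: power_Suc)
        moreover have "real l * ln (K * w) \<le> sqrt w * ln (K * w)"
          using l w by (intro mult_right_mono) auto
        moreover have "real (r + 1) * ln (real l) \<ge> 8 * (w / ln w) * (ln w / 4)"
          using r ll lw0 w by (intro mult_mono) auto
        moreover have "8 * (w / ln w) * (ln w / 4) = 2 * w" using lw0 by simp
        ultimately have "ln ((K * w) ^ l / real l ^ (r + 1)) \<le> - w" using w by linarith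
        moreover have "(K * w) ^ l / real l ^ (r + 1) > 0" using l0 w by (intro divide_pos_pos zero_less_power) auto
        ultimately have "(K * w) ^ l / real l ^ (r + 1) \<le> exp (- w)"
          by (metis exp_le_cancel_iff exp_ln)
        then show ?thesis by (simp add: exp_minus ew inverse_eq_divide)
      qed
      finally have "sieve_tail r N * (1 + ln (real N)) \<le> 1 / ln (real N) * (1 + ln (real N))"
        using lnN by (intro mult_right_mono) auto
      also have "\<dots> \<le> 2" using lnN by (simp add: field_simps)
      finally show ?thesis .
    qed
    have lZ: "ln Z \<le> 20 * (w\<^sup>2 / ln w)"
    proof -
      have "ln Z = real (r + 1) * ln (3 * ln (real N))" unfolding Z_def by (rule ln_realpow)
      also have "ln (3 * ln (real N)) = ln 3 + w" unfolding w_def using lnN by (intro ln_mult_pos) auto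
      also have "real (r + 1) * (ln 3 + w) \<le> 10 * (w / ln w) * (2 * w)"
      proof (intro mult_mono)
        show "real (r + 1) \<le> 10 * (w / ln w)" using r by simp
        show "ln 3 + w \<le> 2 * w" using ln_bound[of 3] w by simp
        show "0 \<le> ln 3 + w" using w ln3_gt_1 by linarith
      qed (use wlw in auto)
      also have "\<dots> = 20 * (w\<^sup>2 / ln w)" by (simp add: power2_eq_square)
      finally show ?thesis .
    qed
    show ?case using Z J tail lZ unfolding w_def[symmetric] by blast
  qed
qed

lemma digits_ge_mean_upper:
  obtains K where "K > 0"
    "\<And>N k. N \<ge> 3 \<Longrightarrow> 1 \<le> k \<Longrightarrow> \<bar>digits_ge_mean k N\<bar> \<le> K * ln (real N) * ln (ln (real N)) / real k"
proof -
  obtain K where K: "K > 0" "\<And>N. N \<ge> 3 \<Longrightarrow> real N / real (totient N) \<le> K * ln (ln (real N))"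
    using totient_lower_bound by blast
  show ?thesis
  proof (rule that[of "12 * K"])
    show "12 * K > 0" using K by simp
    fix N k :: nat assume N: "N \<ge> 3" and k: "1 \<le> k"
    have "ln 3 \<le> ln (real N)" using N by simp
    then have lnN: "ln (real N) > 1" using ln3_gt_1 by linarith
    have phi: "real (totient N) > 0" using N by simp
    define M where "M = digits_ge_mean k N * real (totient N)"
    have "\<bar>M\<bar> \<le> 2 * real (card (coprime_splits k N)) + 4 * real N / real k"
      using digits_ge_mean_coprime_splits[of N k] N k by (simp add: M_def)
    also have "\<dots> \<le> 2 * (2 * real N / real k * (1 + ln (real N))) + 4 * real N / real k"
      using card_coprime_splits_le[OF k, of N] N by simp
    also have "\<dots> = real N / real k * (8 + 4 * ln (real N))" by (simp add: algebra_simps add_divide_distrib)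
    also have "\<dots> \<le> real N / real k * (12 * ln (real N))" using lnN by (intro mult_left_mono) auto
    finally have "\<bar>M\<bar> / real (totient N) \<le> real N / real k * (12 * ln (real N)) / real (totient N)"
      using phi by (intro divide_right_mono) auto
    also have "\<dots> = real N / real (totient N) * (12 * ln (real N) / real k)" by simp
    also have "\<dots> \<le> K * ln (ln (real N)) * (12 * ln (real N) / real k)"
      using K(2)[OF N] lnN by (intro mult_right_mono) auto
    finally have "\<bar>M / real (totient N)\<bar> \<le> 12 * K * ln (real N) * ln (ln (real N)) / real k"
      using phi by (simp add: abs_divide mult_ac)
    then show "\<bar>digits_ge_mean k N\<bar> \<le> 12 * K * ln (real N) * ln (ln (real N)) / real k"
      using phi by (simp add: M_def)
  qed
qed

text \<open>The sieve parameters depend on \<open>N\<close> only, so the estimate is uniform in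
  \<open>k\<close>. The last clause provides \<open>ln (ln N) \<ge> exp 1\<close>, the range in
  which \<open>square_over_ln_mono\<close> applies.\<close>

lemma digits_ge_mean_asymptotic:
  obtains K N0 where "K > 0"
    "\<And>N k. N \<ge> N0 \<Longrightarrow> 1 \<le> k \<Longrightarrow> k \<le> N \<Longrightarrow>
      \<bar>digits_ge_mean k N - 12 / pi\<^sup>2 * ln (1 + 1 / real k) * ln (real N)\<bar>
        \<le> K * ((ln (ln (real N)))\<^sup>2 / ln (ln (ln (real N))) + ln (real k)) * ln (ln (real N)) / real k"
    "\<And>N. N \<ge> N0 \<Longrightarrow> ln (ln (real N)) \<ge> exp 1"
proof -
  obtain K where K: "K > 0" "\<And>N. N \<ge> 3 \<Longrightarrow> real N / real (totient N) \<le> K * ln (ln (real N))"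
    using totient_lower_bound by blast
  have "\<forall>\<^sub>F N::nat in sequentially. ln (ln (real N)) \<ge> exp 1"
    using eventually_compose_filterlim[OF eventually_ge_at_top filterlim_ln_ln] .
  from eventually_conj[OF sieve_parameters eventually_conj[OF this eventually_ge_at_top[of 3]]]
  obtain N0 where N0: "\<And>N. N \<ge> N0 \<Longrightarrow> \<exists>r Z. Z \<ge> 2 \<and> real (sieve_terms r N) \<le> Z \<and>
      sieve_tail r N * (1 + ln (real N)) \<le> 2 \<and> ln Z \<le> 20 * ((ln (ln (real N)))\<^sup>2 / ln (ln (ln (real N))))"
    "\<And>N. N \<ge> N0 \<Longrightarrow> ln (ln (real N)) \<ge> exp 1" "\<And>N. N \<ge> N0 \<Longrightarrow> N \<ge> 3"
    unfolding eventually_sequentially by blast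
  show ?thesis
  proof (rule that[of "512 * K" N0])
    show "512 * K > 0" using K by simp
    show "\<And>N. N \<ge> N0 \<Longrightarrow> ln (ln (real N)) \<ge> exp 1" by (rule N0(2))
    fix N k :: nat assume N: "N \<ge> N0" and k: "1 \<le> k" "k \<le> N"
    have N3: "N \<ge> 3" using N0(3)[OF N] .
    define w where "w = ln (ln (real N))"
    define L where "L = w\<^sup>2 / ln w"
    have w: "w \<ge> exp 1" using N0(2)[OF N] by (simp add: w_def)
    have w1: "w \<ge> 1" using w exp_ge_add_one_self[of "1::real"] by linarith
    have lw: "ln w \<ge> 1" using w w1 by (simp add: ln_ge_iff)
    have L1: "L \<ge> 1"
    proof -
      have "ln w \<le> w" using w1 by (intro ln_bound) auto
      also have "w \<le> w\<^sup>2" using w1 by (intro self_le_power) auto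
      finally show ?thesis using lw by (simp add: L_def)
    qed
    obtain r Z where rZ: "Z \<ge> 2" "real (sieve_terms r N) \<le> Z" "sieve_tail r N * (1 + ln (real N)) \<le> 2"
      "ln Z \<le> 20 * L"
      using N0(1)[OF N] unfolding L_def w_def by blast
    have lk: "ln (real k) \<ge> 0" using k by simp
    define m where "m = 6 / pi\<^sup>2 * ln (1 + 1 / real k) * ln (real N)"
    have phi: "real (totient N) > 0" using N3 by simp
    define M where "M = digits_ge_mean k N * real (totient N)"
    have "\<bar>M - real (totient N) * (2 * m)\<bar> \<le> 4 * real N / real k + 2 * (real N / real k * (94 + 8 * ln Z + 7 * ln (real k)))"
      using digits_ge_mean_coprime_splits[of N k] k N3
        card_coprime_splits_asymptotic[OF k _ rZ(1-3)] unfolding m_def[symmetric] M_def by simp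
    also have "\<dots> = real N / real k * (192 + 16 * ln Z + 14 * ln (real k))"
      by (simp add: algebra_simps add_divide_distrib)
    \<comment> \<open>Here \<open>192 + 16 * 20 = 512\<close>, using \<open>1 \<le> L\<close> and
      \<open>ln Z \<le> 20 * L\<close>.\<close>
    also have "\<dots> \<le> real N / real k * (512 * (L + ln (real k)))"
      using rZ(4) L1 lk by (intro mult_left_mono) auto
    finally have "\<bar>M - real (totient N) * (2 * m)\<bar> / real (totient N) \<le>
        real N / real k * (512 * (L + ln (real k))) / real (totient N)"
      using phi by (intro divide_right_mono) auto
    also have "\<dots> = real N / real (totient N) * (512 * (L + ln (real k)) / real k)" by simp
    also have "\<dots> \<le> K * w * (512 * (L + ln (real k)) / real k)"
      using K(2)[OF N3] L1 lk by (intro mult_right_mono) (auto simp: w_def)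
    finally have "\<bar>(M - real (totient N) * (2 * m)) / real (totient N)\<bar> \<le> 512 * K * (L + ln (real k)) * w / real k"
      using phi by (simp add: abs_divide mult_ac)
    moreover have "(M - real (totient N) * (2 * m)) / real (totient N) = digits_ge_mean k N - 2 * m"
      using phi by (simp add: M_def diff_divide_distrib)
    moreover have "2 * m = 12 / pi\<^sup>2 * ln (1 + 1 / real k) * ln (real N)" by (simp add: m_def)
    ultimately show "\<bar>digits_ge_mean k N - 12 / pi\<^sup>2 * ln (1 + 1 / real k) * ln (real N)\<bar>
        \<le> 512 * K * ((ln (ln (real N)))\<^sup>2 / ln (ln (ln (real N))) + ln (real k)) * ln (ln (real N)) / real k"
      unfolding w_def[symmetric] L_def[symmetric] by (simp only:)
  qed
qed

section \<open>Partial summation from threshold counts to the mean\<close>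

lemma euclid_sum_sum:
  "euclid_sum (\<lambda>m. \<Sum>i\<in>I. g i m) u v = (\<Sum>i\<in>I. euclid_sum (g i) u v)"
proof (induction v arbitrary: u rule: less_induct)
  case (less v)
  show ?case
    by (cases "v = 0") (use less[of "u mod v" v] in \<open>auto simp: euclid_sum.simps[of _ u v] sum.distrib\<close>)
qed

lemma euclid_sum_scale_diff:
  "euclid_sum (\<lambda>m. c * (g m - h m)) u v = c * (euclid_sum g u v - euclid_sum h u v)"
proof (induction v arbitrary: u rule: less_induct)
  case (less v)
  show ?case
    by (cases "v = 0") (use less[of "u mod v" v] in \<open>auto simp: euclid_sum.simps[of _ u v] algebra_simps\<close>)
qed

text \<open>The indicator of \<open>d = m\<close> is the difference of the indicators of
  \<open>m \<le> d\<close> and \<open>Suc m \<le> d\<close>, and \<open>euclid_sum\<close> is linear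
  in its weight.\<close>

lemma mean_S_eq:
  assumes N: "N \<ge> 2"
  shows "mean_S f \<eta> \<theta> N = (\<Sum>m=\<eta>..\<theta>. f m * (digits_ge_mean m N - digits_ge_mean (Suc m) N))"
proof -
  have pt: "of_bool (\<eta> \<le> d \<and> d \<le> \<theta>) * f d = (\<Sum>m=\<eta>..\<theta>. f m * (of_bool (m \<le> d) - of_bool (Suc m \<le> d)))" for d
  proof -
    have "(\<Sum>m=\<eta>..\<theta>. f m * (of_bool (m \<le> d) - of_bool (Suc m \<le> d))) = (\<Sum>m=\<eta>..\<theta>. if m = d then f m else 0)"
      by (intro sum.cong) auto
    also have "\<dots> = of_bool (\<eta> \<le> d \<and> d \<le> \<theta>) * f d" by simp
    finally show ?thesis by simp
  qed
  have "S_restricted f \<eta> \<theta> (real a / real N) =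
      (\<Sum>m=\<eta>..\<theta>. f m * (euclid_sum (\<lambda>d. of_bool (m \<le> d)) N a - euclid_sum (\<lambda>d. of_bool (Suc m \<le> d)) N a))"
    if "a \<in> totatives N" for a
  proof -
    have "a < N" using totatives_less[OF that] N by linarith
    then have "S_restricted f \<eta> \<theta> (real a / real N) = euclid_sum (\<lambda>m. of_bool (\<eta> \<le> m \<and> m \<le> \<theta>) * f m) N a"
      unfolding S_restricted_def by (rule sum_list_partial_quotients)
    then show ?thesis unfolding pt euclid_sum_sum euclid_sum_scale_diff .
  qed
  then have "mean_S f \<eta> \<theta> N = 1 / real (totient N) * (\<Sum>a\<in>totatives N. \<Sum>m=\<eta>..\<theta>.
     f m * (euclid_sum (\<lambda>d. of_bool (m \<le> d)) N a - euclid_sum (\<lambda>d. of_bool (Suc m \<le> d)) N a))"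
    unfolding mean_S_def by (intro arg_cong2[of _ _ _ _ "(*)"] sum.cong refl)
  also have "\<dots> = (\<Sum>m=\<eta>..\<theta>. f m * (digits_ge_mean m N - digits_ge_mean (Suc m) N))"
    unfolding digits_ge_mean_def
    by (subst sum.swap) (simp add: sum_distrib_left[symmetric] sum_subtractf sum_divide_distrib[symmetric] diff_divide_distrib[symmetric])
  finally show ?thesis .
qed

text \<open>Because \<open>f\<close> is non-decreasing, partial summation gives \<open>e\<close>
  non-negative coefficients, apart from the boundary term at \<open>Suc \<theta>\<close>. Each
  \<open>e k\<close> may thus be replaced by \<open>E / k\<close> and the summation undone, which is
  why the bound has the same shape as the sum. The boundary term is added and removed, hence its
  factor 2.\<close>

lemma abel_summation_bound:
  fixes f e :: "nat \<Rightarrow> real"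
  assumes f: "\<And>m. 1 \<le> m \<Longrightarrow> 0 \<le> f m" "\<And>m. 1 \<le> m \<Longrightarrow> f m \<le> f (Suc m)"
    and e: "\<And>k. \<eta> \<le> k \<Longrightarrow> k \<le> Suc \<theta> \<Longrightarrow> \<bar>e k\<bar> \<le> E / real k"
    and h: "1 \<le> \<eta>" "\<eta> \<le> \<theta>"
  shows "\<bar>\<Sum>m=\<eta>..\<theta>. f m * (e m - e (Suc m))\<bar>
     \<le> E * ((\<Sum>m=\<eta>..\<theta>. f m * (1 / real m - 1 / real (Suc m))) + 2 * f \<theta> / real (Suc \<theta>))"
proof -
  \<comment> \<open>After adding \<open>f j * e (Suc j)\<close>, the coefficients of
    \<open>e\<close> are \<open>f \<eta>\<close> and the increments of \<open>f\<close>, all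
    non-negative.\<close>
  have "\<bar>(\<Sum>m=\<eta>..j. f m * (e m - e (Suc m))) + f j * e (Suc j)\<bar>
     \<le> E * ((\<Sum>m=\<eta>..j. f m * (1 / real m - 1 / real (Suc m))) + f j / real (Suc j))"
    if "\<eta> \<le> j" "j \<le> \<theta>" for j
    using that
  proof (induction j rule: nat_induct_at_least)
    case base
    have "\<bar>f \<eta> * e \<eta>\<bar> \<le> f \<eta> * (E / real \<eta>)" unfolding abs_mult
      using f(1)[OF h(1)] e[of \<eta>] h by (intro mult_mono) auto
    then show ?case by (simp add: algebra_simps)
  next
    case (Suc j)
    define d where "d = f (Suc j) - f j"
    have d: "d \<ge> 0" using f(2)[of j] Suc h by (simp add: d_def)
    have e1: "(\<Sum>m=\<eta>..Suc j. f m * (e m - e (Suc m))) + f (Suc j) * e (Suc (Suc j)) =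
      ((\<Sum>m=\<eta>..j. f m * (e m - e (Suc m))) + f j * e (Suc j)) + d * e (Suc j)"
      using Suc by (simp add: d_def algebra_simps)
    have e2: "(\<Sum>m=\<eta>..Suc j. f m * (1 / real m - 1 / real (Suc m))) + f (Suc j) / real (Suc (Suc j)) =
      ((\<Sum>m=\<eta>..j. f m * (1 / real m - 1 / real (Suc m))) + f j / real (Suc j)) + d / real (Suc j)"
    proof -
      have "(\<Sum>m=\<eta>..Suc j. f m * (1 / real m - 1 / real (Suc m))) =
         (\<Sum>m=\<eta>..j. f m * (1 / real m - 1 / real (Suc m))) + f (Suc j) * (1 / real (Suc j) - 1 / real (Suc (Suc j)))"
        using Suc by (simp del: of_nat_Suc)
      then show ?thesis by (simp add: d_def right_diff_distrib diff_divide_distrib del: of_nat_Suc)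
    qed
    have "\<bar>d * e (Suc j)\<bar> \<le> d * (E / real (Suc j))" unfolding abs_mult
      using d e[of "Suc j"] Suc by (intro mult_mono) auto
    also have "\<dots> = E * (d / real (Suc j))" by simp
    finally have 1: "\<bar>d * e (Suc j)\<bar> \<le> E * (d / real (Suc j))" .
    have 2: "\<bar>(\<Sum>m=\<eta>..j. f m * (e m - e (Suc m))) + f j * e (Suc j)\<bar>
     \<le> E * ((\<Sum>m=\<eta>..j. f m * (1 / real m - 1 / real (Suc m))) + f j / real (Suc j))" using Suc by simp
    show ?case unfolding e1 e2 distrib_left[of E _ "d / real (Suc j)"]
      by (rule order_trans[OF abs_triangle_ineq add_mono[OF 2 1]])
  qed
  from this[of \<theta>] have "\<bar>(\<Sum>m=\<eta>..\<theta>. f m * (e m - e (Suc m))) + f \<theta> * e (Suc \<theta>)\<bar>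
     \<le> E * ((\<Sum>m=\<eta>..\<theta>. f m * (1 / real m - 1 / real (Suc m))) + f \<theta> / real (Suc \<theta>))" using h by simp
  moreover have "\<bar>f \<theta> * e (Suc \<theta>)\<bar> \<le> E * (f \<theta> / real (Suc \<theta>))"
  proof -
    have "\<bar>f \<theta> * e (Suc \<theta>)\<bar> \<le> f \<theta> * (E / real (Suc \<theta>))" unfolding abs_mult
      using f(1)[of \<theta>] e[of "Suc \<theta>"] h by (intro mult_mono) auto
    then show ?thesis by (simp add: mult.commute)
  qed
  moreover have "E * ((\<Sum>m=\<eta>..\<theta>. f m * (1 / real m - 1 / real (Suc m))) + 2 * f \<theta> / real (Suc \<theta>)) =
    E * ((\<Sum>m=\<eta>..\<theta>. f m * (1 / real m - 1 / real (Suc m))) + f \<theta> / real (Suc \<theta>)) + E * (f \<theta> / real (Suc \<theta>))"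
    by (simp add: algebra_simps)
  ultimately show ?thesis by linarith
qed

lemma ln_1_plus_mult_eq:
  assumes "m \<ge> 1"
  shows "ln (1 + 1 / (real m * (real m + 2))) = ln (1 + 1 / real m) - ln (1 + 1 / real (Suc m))"
proof -
  have m: "real m > 0" using assms by simp
  have "ln (1 + 1 / real m) - ln (1 + 1 / real (Suc m)) = ln ((1 + 1 / real m) / (1 + 1 / real (Suc m)))"
    using m by (intro ln_divide_pos[symmetric] add_pos_nonneg) auto
  also have "(1 + 1 / real m) / (1 + 1 / real (Suc m)) = 1 + 1 / (real m * (real m + 2))"
    using m by (simp add: divide_simps) (simp add: algebra_simps)
  finally show ?thesis by simp
qed

lemma one_le_12_over_pi_squared: "12 / pi\<^sup>2 \<ge> 1"
proof -
  have "pi \<le> 3.2" using pi_approx by simp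
  then have "pi\<^sup>2 \<le> 3.2\<^sup>2" by (intro power_mono) auto
  then show ?thesis by (simp add: power2_eq_square)
qed

text \<open>Translates the bound of partial summation into \<open>A_const\<close>. From
  \<open>ln y \<ge> 1 - 1 / y\<close> the logarithm is at least \<open>1 / (m + 1)\<^sup>2\<close>,
  which is at least half of \<open>1 / (m * (m + 1))\<close>; the prefactor
  \<open>12 / pi\<^sup>2\<close> exceeds 1.\<close>

lemma A_const_ge:
  assumes f: "\<And>m. 1 \<le> m \<Longrightarrow> 0 \<le> f m" and h: "1 \<le> \<eta>"
  shows "(\<Sum>m=\<eta>..\<theta>. f m * (1 / real m - 1 / real (Suc m))) \<le> 2 * A_const f \<eta> \<theta>"
proof -
  have "(\<Sum>m=\<eta>..\<theta>. f m * (1 / real m - 1 / real (Suc m))) \<le> (\<Sum>m=\<eta>..\<theta>. 2 * (f m * ln (1 + 1 / (real m * (real m + 2)))))"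
  proof (rule sum_mono)
    fix m assume "m \<in> {\<eta>..\<theta>}"
    then have m: "m \<ge> 1" using h by simp
    define x where "x = real m"
    have x: "x \<ge> 1" using m by (simp add: x_def)
    have "1 / x - 1 / (x + 1) = 1 / (x * (x + 1))" using x by (simp add: field_simps)
    also have "\<dots> \<le> 2 / ((x + 1) * (x + 1))"
    proof -
      have "(x + 1) * (x + 1) \<le> 2 * (x * (x + 1))" using x mult_right_mono[of "x + 1" "2 * x" "x + 1"] by (simp add: algebra_simps)
      then show ?thesis using x by (simp add: divide_simps)
    qed
    also have "\<dots> \<le> 2 * ln (1 + 1 / (x * (x + 2)))"
    proof -
      let ?y = "1 + 1 / (x * (x + 2))"
      have y: "?y = (x + 1) * (x + 1) / (x * (x + 2))"
      proof -
        have "(x + 1) * (x + 1) = x * (x + 2) + 1" by (simp add: algebra_simps)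
        moreover have "x * (x + 2) \<noteq> 0" using x by simp
        ultimately show ?thesis by (metis add_divide_distrib divide_self)
      qed
      have "?y > 0" using x by (simp add: add_pos_nonneg)
      then have "ln (1 / ?y) \<le> 1 / ?y - 1" by (intro ln_le_minus_one) simp
      moreover have "ln (1 / ?y) = - ln ?y" using \<open>?y > 0\<close> by (simp add: ln_divide_pos)
      moreover have "1 / ?y - 1 = - (1 / ((x + 1) * (x + 1)))"
        unfolding y using x by (simp add: divide_simps) (simp add: algebra_simps)
      ultimately have "1 / ((x + 1) * (x + 1)) \<le> ln ?y" by linarith
      then show ?thesis by simp
    qed
    finally have "1 / real m - 1 / real (Suc m) \<le> 2 * ln (1 + 1 / (real m * (real m + 2)))"
      by (simp add: x_def add.commute)
    then have "f m * (1 / real m - 1 / real (Suc m)) \<le> f m * (2 * ln (1 + 1 / (real m * (real m + 2))))"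
      using f[OF m] by (intro mult_left_mono)
    then show "f m * (1 / real m - 1 / real (Suc m)) \<le> 2 * (f m * ln (1 + 1 / (real m * (real m + 2))))"
      by simp
  qed
  also have "\<dots> = 2 * (1 * (\<Sum>m=\<eta>..\<theta>. f m * ln (1 + 1 / (real m * (real m + 2)))))"
    by (simp add: sum_distrib_left)
  also have "\<dots> \<le> 2 * A_const f \<eta> \<theta>"
    unfolding A_const_def
    using f h one_le_12_over_pi_squared by (intro mult_left_mono mult_right_mono sum_nonneg mult_nonneg_nonneg) auto
  finally show ?thesis .
qed

lemma A_const_nonneg:
  assumes f: "\<And>m. 1 \<le> m \<Longrightarrow> 0 \<le> f m" and h: "1 \<le> \<eta>"
  shows "0 \<le> A_const f \<eta> \<theta>"
  unfolding A_const_def using f h by (intro mult_nonneg_nonneg sum_nonneg) auto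

section \<open>Restricted sums of partial quotients\<close>

text \<open>Explains the form of \<open>B_const\<close>: \<open>A_const\<close> dominates the sum
  and \<open>f \<theta> / \<theta>\<close> the boundary term left by partial summation.\<close>

lemma B_const_ge:
  assumes f: "\<And>m. 1 \<le> m \<Longrightarrow> 0 \<le> f m" and h: "1 \<le> \<eta>" "\<eta> \<le> \<theta>"
  shows "(\<Sum>m=\<eta>..\<theta>. f m * (1 / real m - 1 / real (Suc m))) + 2 * f \<theta> / real (Suc \<theta>) \<le> 2 * B_const f \<eta> \<theta>"
proof -
  have "2 * f \<theta> / real (Suc \<theta>) \<le> 2 * f \<theta> / real \<theta>"
    using f[of \<theta>] h by (intro divide_left_mono) auto
  then show ?thesis using A_const_ge[of f \<eta> \<theta>, OF f h(1)] by (simp add: B_const_def)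
qed

lemma A_const_telescope:
  assumes h: "1 \<le> \<eta>"
  shows "A_const f \<eta> \<theta> =
    (\<Sum>m=\<eta>..\<theta>. f m * (12 / pi\<^sup>2 * ln (1 + 1 / real m) - 12 / pi\<^sup>2 * ln (1 + 1 / real (Suc m))))"
  unfolding A_const_def sum_distrib_left
proof (rule sum.cong)
  fix m assume "m \<in> {\<eta>..\<theta>}"
  then have "m \<ge> 1" using h by simp
  show "12 / pi\<^sup>2 * (f m * ln (1 + 1 / (real m * (real m + 2)))) =
    f m * (12 / pi\<^sup>2 * ln (1 + 1 / real m) - 12 / pi\<^sup>2 * ln (1 + 1 / real (Suc m)))"
    unfolding ln_1_plus_mult_eq[OF \<open>m \<ge> 1\<close>] right_diff_distrib by (simp only: mult.left_commute)
qed simp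

text \<open>Replacing \<open>f m\<close> by \<open>f \<theta>\<close> makes the sum telescope. Its
  purpose is an upper bound for \<open>B_const\<close>, hence a lower bound for
  \<open>C_const\<close>.\<close>

lemma A_const_le:
  assumes f: "\<And>m. 1 \<le> m \<Longrightarrow> 0 \<le> f m" "\<And>m. 1 \<le> m \<Longrightarrow> m \<le> \<theta> \<Longrightarrow> f m \<le> f \<theta>"
    and h: "1 \<le> \<eta>" "\<eta> \<le> \<theta>"
  shows "A_const f \<eta> \<theta> \<le> 4 / 3 * f \<theta>"
proof -
  define g where "g = (\<lambda>m. ln (1 + 1 / real m))"
  have "(\<Sum>m=\<eta>..\<theta>. f m * ln (1 + 1 / (real m * (real m + 2)))) \<le> (\<Sum>m=\<eta>..\<theta>. f \<theta> * (g m - g (Suc m)))"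
  proof (rule sum_mono)
    fix m assume m: "m \<in> {\<eta>..\<theta>}"
    then have m1: "m \<ge> 1" using h by simp
    have "f m * ln (1 + 1 / (real m * (real m + 2))) \<le> f \<theta> * ln (1 + 1 / (real m * (real m + 2)))"
      using f(2)[OF m1] m by (intro mult_right_mono) auto
    then show "f m * ln (1 + 1 / (real m * (real m + 2))) \<le> f \<theta> * (g m - g (Suc m))"
      unfolding g_def ln_1_plus_mult_eq[OF m1] .
  qed
  also have "\<dots> = f \<theta> * (\<Sum>m=\<eta>..\<theta>. g m - g (Suc m))" by (simp only: sum_distrib_left)
  also have "(\<Sum>m=\<eta>..\<theta>. g m - g (Suc m)) = g \<eta> - g (Suc \<theta>)"
    using h(2) by (induction \<theta> rule: dec_induct) auto
  also have "f \<theta> * (g \<eta> - g (Suc \<theta>)) \<le> f \<theta> * 1"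
  proof (rule mult_left_mono)
    have "g (Suc \<theta>) \<ge> 0" unfolding g_def by (rule ln_1_plus_inverse_bounds) simp
    moreover have "g \<eta> \<le> 1 / real \<eta>" unfolding g_def using h(1) by (rule ln_1_plus_inverse_bounds)
    moreover have "1 / real \<eta> \<le> 1" using h by simp
    ultimately show "g \<eta> - g (Suc \<theta>) \<le> 1" by linarith
    show "0 \<le> f \<theta>" using f(1)[of \<theta>] h by simp
  qed
  finally have "A_const f \<eta> \<theta> \<le> 12 / pi\<^sup>2 * f \<theta>" unfolding A_const_def by (intro mult_left_mono) auto
  also have "\<dots> \<le> 4 / 3 * f \<theta>"
  proof (rule mult_right_mono)
    have "pi\<^sup>2 \<ge> 3\<^sup>2" using pi_gt3 by (intro power_mono) auto
    then show "12 / pi\<^sup>2 \<le> 4 / 3" by (simp add: divide_simps)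
    show "0 \<le> f \<theta>" using f(1)[of \<theta>] h by simp
  qed
  finally show ?thesis .
qed

text \<open>Follows from the decrease of \<open>ln x / x\<close> beyond \<open>exp 1\<close>. It
  allows the sieve error, expressed in \<open>ln (ln N)\<close>, to be replaced by the same
  expression in the larger \<open>ln (C * ln N)\<close>.\<close>

lemma square_over_ln_mono:
  fixes w y :: real
  assumes w: "w \<ge> exp 1" and wy: "w \<le> y"
  shows "w\<^sup>2 / ln w \<le> y\<^sup>2 / ln y"
proof -
  have w0: "w > 0" using w by (meson exp_gt_zero less_le_trans)
  have lw: "ln w \<ge> 1" using w w0 by (simp add: ln_ge_iff)
  have ly: "ln y \<ge> 1" using lw wy w0 ln_mono[of w y] by linarith
  have "ln (y / w) \<le> y / w - 1" using w0 wy by (intro ln_le_minus_one) auto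
  moreover have "ln (y / w) = ln y - ln w" using w0 wy by (intro ln_divide_pos) auto
  moreover have "(y / w - 1) * 1 \<le> (y / w - 1) * ln w" using lw w0 wy by (intro mult_left_mono) auto
  ultimately have "ln y \<le> y / w * ln w" by (simp add: algebra_simps)
  then have "w * ln y \<le> y * ln w" using w0 by (simp add: field_simps)
  then have "w * (w * ln y) \<le> w * (y * ln w)" using w0 by (intro mult_left_mono) auto
  also have "\<dots> \<le> y * (y * ln w)"
  proof (rule mult_right_mono[OF wy])
    show "0 \<le> y * ln w" using wy w0 lw by (intro mult_nonneg_nonneg) linarith+
  qed
  finally have "w\<^sup>2 * ln y \<le> y\<^sup>2 * ln w" by (simp add: power2_eq_square mult.assoc)
  then show ?thesis using lw ly by (simp add: divide_simps)
qed

lemma mean_S_upper: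
  obtains K where "K > 0" "\<And>N \<eta> \<theta> f. N \<ge> 3 \<Longrightarrow> 1 \<le> \<eta> \<Longrightarrow> \<eta> \<le> \<theta> \<Longrightarrow> \<forall>m\<ge>1. 0 \<le> f m \<Longrightarrow> mono_on {1..} f \<Longrightarrow>
     \<bar>mean_S f \<eta> \<theta> N\<bar> \<le> K * (B_const f \<eta> \<theta> * ln (real N) * ln (ln (real N)))"
proof -
  obtain K where K: "K > 0"
    "\<And>N k. N \<ge> 3 \<Longrightarrow> 1 \<le> k \<Longrightarrow> \<bar>digits_ge_mean k N\<bar> \<le> K * ln (real N) * ln (ln (real N)) / real k"
    using digits_ge_mean_upper by blast
  show ?thesis
  proof (rule that[of "2 * K"])
    show "2 * K > 0" using K by simp
    fix N \<eta> \<theta> :: nat and f :: "nat \<Rightarrow> real"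
    assume N: "N \<ge> 3" and h: "1 \<le> \<eta>" "\<eta> \<le> \<theta>" and f: "\<forall>m\<ge>1. 0 \<le> f m" "mono_on {1..} f"
    define E where "E = K * ln (real N) * ln (ln (real N))"
    have "ln (ln (real N)) \<ge> 0" using ln_ln_3_pos ln_ln_ge_ln_ln_3[OF N] by linarith
    then have E0: "E \<ge> 0"
      unfolding E_def using K(1) N by (intro mult_nonneg_nonneg) auto
    have mono: "f m \<le> f (Suc m)" if "1 \<le> m" for m using f(2) that by (auto simp: mono_on_def)
    have "\<bar>mean_S f \<eta> \<theta> N\<bar> = \<bar>\<Sum>m=\<eta>..\<theta>. f m * (digits_ge_mean m N - digits_ge_mean (Suc m) N)\<bar>"
      using N by (subst mean_S_eq) auto
    also have "\<dots> \<le> E * ((\<Sum>m=\<eta>..\<theta>. f m * (1 / real m - 1 / real (Suc m))) + 2 * f \<theta> / real (Suc \<theta>))"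
      by (rule abel_summation_bound) (use f mono h K(2)[OF N] in \<open>auto simp: E_def\<close>)
    also have "\<dots> \<le> E * (2 * B_const f \<eta> \<theta>)"
      using f h by (intro mult_left_mono B_const_ge E0) auto
    finally show "\<bar>mean_S f \<eta> \<theta> N\<bar> \<le> 2 * K * (B_const f \<eta> \<theta> * ln (real N) * ln (ln (real N)))"
      by (simp add: E_def mult_ac)
  qed
qed

text \<open>The factor 5 in \<open>C_const\<close> is large enough: \<open>B_const\<close> is at
  most \<open>(4/3 + 1) * f \<theta>\<close>, so \<open>C_const\<close> is at least 2. Since
  \<open>N \<ge> 9\<close> gives \<open>ln N > 2\<close>, the argument \<open>C * ln N\<close>
  exceeds 3, hence \<open>y > 1\<close> and \<open>ln y\<close> is positive. The bound
  \<open>\<theta> + 1 \<le> N\<close> covers the largest threshold in the partial summation.\<close>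

lemma error_term_bounds:
  assumes N: "sqrt (real N) > real \<theta> + 2" and h: "1 \<le> \<eta>" "\<eta> \<le> \<theta>"
    and f: "\<forall>m\<ge>1. 0 \<le> f m" "mono_on {1..} f" "0 < f \<theta>"
  defines "y \<equiv> ln (C_const f \<eta> \<theta> * ln (real N))"
  shows "\<theta> + 1 \<le> N" "N \<ge> 3" "B_const f \<eta> \<theta> > 0" "ln (ln (real N)) \<le> y" "1 \<le> y\<^sup>2 / ln y"
proof -
  have s3: "sqrt (real N) > 3" using N h by linarith
  have "sqrt (real N) * 1 \<le> sqrt (real N) * sqrt (real N)" using s3 by (intro mult_left_mono) linarith+
  then have sN: "sqrt (real N) \<le> real N" by simp
  then show "\<theta> + 1 \<le> N" using N by linarith
  have "3 * 3 \<le> sqrt (real N) * sqrt (real N)" using s3 by (intro mult_mono) auto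
  then have N9: "real N \<ge> 9" by simp
  then show "N \<ge> 3" by simp
  have fm: "f m \<le> f \<theta>" if "1 \<le> m" "m \<le> \<theta>" for m using f(2) that by (auto simp: mono_on_def)
  have A0: "0 \<le> A_const f \<eta> \<theta>" using f h by (intro A_const_nonneg) auto
  have A1: "A_const f \<eta> \<theta> \<le> 4 / 3 * f \<theta>" using f h fm by (intro A_const_le) auto
  have t: "0 < f \<theta> / real \<theta>" using f h by simp
  have t1: "f \<theta> / real \<theta> \<le> f \<theta> / 1" using f(3) h by (intro divide_left_mono) auto
  show B0: "B_const f \<eta> \<theta> > 0" using A0 t by (simp add: B_const_def)
  have "B_const f \<eta> \<theta> * 2 \<le> 5 * f \<theta>" using A1 t1 f(3) by (simp add: B_const_def)
  then have C: "C_const f \<eta> \<theta> \<ge> 2" using B0 by (simp add: C_const_def pos_le_divide_eq mult.commute)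
  have "ln (3 * 3) \<le> ln (real N)" using N9 by (intro ln_mono) auto
  moreover have "ln (3 * 3 :: real) = ln 3 + ln 3" by (intro ln_mult_pos) auto
  ultimately have lnN: "ln (real N) > 2" using ln3_gt_1 by linarith
  have CN: "2 * ln (real N) \<le> C_const f \<eta> \<theta> * ln (real N)" using C lnN by (intro mult_right_mono) auto
  then show "ln (ln (real N)) \<le> y" unfolding y_def using lnN by (intro ln_mono) auto
  have "3 \<le> C_const f \<eta> \<theta> * ln (real N)" using CN lnN by linarith
  then have "ln 3 \<le> y" unfolding y_def by (intro ln_mono) auto
  then have y: "y > 1" using ln3_gt_1 by linarith
  have "ln y \<le> y" using y by (intro ln_bound) auto
  also have "y \<le> y\<^sup>2" using y by (intro self_le_power) auto
  finally show "1 \<le> y\<^sup>2 / ln y" using y by simp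
qed

theorem theorem5:
  "(\<exists>K>0. \<forall>(N::nat) (\<eta>::nat) (\<theta>::nat) (f::nat \<Rightarrow> real).
      N \<ge> 3 \<and> 1 \<le> \<eta> \<and> \<eta> \<le> \<theta> \<and> (\<forall>m\<ge>1. 0 \<le> f m) \<and> mono_on {1..} f \<and> 0 < f \<theta> \<longrightarrow>
      \<bar>mean_S f \<eta> \<theta> N\<bar> \<le> K * (B_const f \<eta> \<theta> * ln (real N) * ln (ln (real N)))) \<and>
   (\<exists>K>0. \<forall>(N::nat) (\<eta>::nat) (\<theta>::nat) (f::nat \<Rightarrow> real).
      N \<ge> 3 \<and> 1 \<le> \<eta> \<and> \<eta> \<le> \<theta> \<and> (\<forall>m\<ge>1. 0 \<le> f m) \<and> mono_on {1..} f \<and> 0 < f \<theta> \<and> sqrt (real N) > real \<theta> + 2 \<longrightarrow>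
      \<bar>mean_S f \<eta> \<theta> N - A_const f \<eta> \<theta> * ln (real N)\<bar>
        \<le> K * (B_const f \<eta> \<theta> *
               ((ln (C_const f \<eta> \<theta> * ln (real N)))\<^sup>2 / ln (ln (C_const f \<eta> \<theta> * ln (real N)))
                 + ln (real \<theta>)) * ln (ln (real N))))"
proof (rule conjI)
  obtain K1 where K1: "K1 > 0" "\<And>N \<eta> \<theta> f. N \<ge> 3 \<Longrightarrow> 1 \<le> \<eta> \<Longrightarrow> \<eta> \<le> \<theta> \<Longrightarrow> \<forall>m\<ge>1. 0 \<le> f m \<Longrightarrow>
     mono_on {1..} f \<Longrightarrow> \<bar>mean_S f \<eta> \<theta> N\<bar> \<le> K1 * (B_const f \<eta> \<theta> * ln (real N) * ln (ln (real N)))"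
    using mean_S_upper by blast
  then show "\<exists>K>0. \<forall>(N::nat) (\<eta>::nat) (\<theta>::nat) (f::nat \<Rightarrow> real).
      N \<ge> 3 \<and> 1 \<le> \<eta> \<and> \<eta> \<le> \<theta> \<and> (\<forall>m\<ge>1. 0 \<le> f m) \<and> mono_on {1..} f \<and> 0 < f \<theta> \<longrightarrow>
      \<bar>mean_S f \<eta> \<theta> N\<bar> \<le> K * (B_const f \<eta> \<theta> * ln (real N) * ln (ln (real N)))"
    by (intro exI[of _ K1]) blast
  obtain K2 N0 where K2: "K2 > 0"
    "\<And>N k. N \<ge> N0 \<Longrightarrow> 1 \<le> k \<Longrightarrow> k \<le> N \<Longrightarrow>
      \<bar>digits_ge_mean k N - 12 / pi\<^sup>2 * ln (1 + 1 / real k) * ln (real N)\<bar>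
        \<le> K2 * ((ln (ln (real N)))\<^sup>2 / ln (ln (ln (real N))) + ln (real k)) * ln (ln (real N)) / real k"
    "\<And>N. N \<ge> N0 \<Longrightarrow> ln (ln (real N)) \<ge> exp 1"
    using digits_ge_mean_asymptotic by blast
  \<comment> \<open>Covers the finitely many \<open>N < N0\<close>: there \<open>ln N\<close> is
    bounded, so the first estimate and the main term are each a constant times
    \<open>B * w\<close>.\<close>
  define K3 where "K3 = (K1 + 1 / ln (ln 3)) * ln (real (N0 + 3))"
  define K where "K = 4 * K2 + K3"
  have K3: "K3 > 0" using K1(1) ln_ln_3_pos by (simp add: K3_def add_pos_pos)
  show "\<exists>K>0. \<forall>(N::nat) (\<eta>::nat) (\<theta>::nat) (f::nat \<Rightarrow> real).
      N \<ge> 3 \<and> 1 \<le> \<eta> \<and> \<eta> \<le> \<theta> \<and> (\<forall>m\<ge>1. 0 \<le> f m) \<and> mono_on {1..} f \<and> 0 < f \<theta> \<and> sqrt (real N) > real \<theta> + 2 \<longrightarrow>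
      \<bar>mean_S f \<eta> \<theta> N - A_const f \<eta> \<theta> * ln (real N)\<bar>
        \<le> K * (B_const f \<eta> \<theta> *
               ((ln (C_const f \<eta> \<theta> * ln (real N)))\<^sup>2 / ln (ln (C_const f \<eta> \<theta> * ln (real N)))
                 + ln (real \<theta>)) * ln (ln (real N)))"
  proof (intro exI[of _ K] conjI allI impI; (elim conjE)?)
    show "K > 0" using K2(1) K3 by (simp add: K_def)
    fix N \<eta> \<theta> :: nat and f :: "nat \<Rightarrow> real"
    assume h: "1 \<le> \<eta>" "\<eta> \<le> \<theta>" and f: "\<forall>m\<ge>1. 0 \<le> f m" "mono_on {1..} f" "0 < f \<theta>"
      and N: "sqrt (real N) > real \<theta> + 2"
    define w y B H where "w = ln (ln (real N))" and "y = ln (C_const f \<eta> \<theta> * ln (real N))"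
      and "B = B_const f \<eta> \<theta>" and "H = y\<^sup>2 / ln y"
    have b: "\<theta> + 1 \<le> N" "N \<ge> 3" "B > 0" "w \<le> y" "1 \<le> H"
      using error_term_bounds[OF N h f] by (auto simp: w_def y_def B_def H_def)
    have "w \<ge> ln (ln 3)" unfolding w_def by (rule ln_ln_ge_ln_ln_3[OF b(2)])
    then have w0: "w \<ge> ln (ln 3)" "ln (ln (3::real)) > 0" "w > 0"
      using ln_ln_3_pos by linarith+
    have lt: "ln (real \<theta>) \<ge> 0" using h by simp
    have lnN: "ln (real N) \<ge> 0" using b by simp
    have "\<bar>mean_S f \<eta> \<theta> N - A_const f \<eta> \<theta> * ln (real N)\<bar> \<le> K * (B * (H + ln (real \<theta>)) * w)"
    proof (cases "N \<ge> N0")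
      case True
      define L where "L = w\<^sup>2 / ln w"
      have LH: "L \<le> H" unfolding L_def H_def using K2(3)[OF True] b(4)
        by (intro square_over_ln_mono) (auto simp: w_def)
      define E where "E = K2 * (2 * (H + ln (real \<theta>))) * w"
      have E0: "E \<ge> 0" using K2(1) b lt w0 by (simp add: E_def)
      define e where "e = (\<lambda>k. digits_ge_mean k N - 12 / pi\<^sup>2 * ln (1 + 1 / real k) * ln (real N))"
      have mono: "f m \<le> f (Suc m)" if "1 \<le> m" for m using f(2) that by (auto simp: mono_on_def)
      have e: "\<bar>e k\<bar> \<le> E / real k" if k: "\<eta> \<le> k" "k \<le> Suc \<theta>" for k
      proof -
        have k1: "1 \<le> k" "k \<le> N" using k h b by auto
        have "\<bar>e k\<bar> \<le> K2 * (L + ln (real k)) * w / real k"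
          using K2(2)[OF True k1] unfolding e_def L_def w_def .
        also have "\<dots> \<le> K2 * (2 * (H + ln (real \<theta>))) * w / real k"
        proof (intro divide_right_mono mult_right_mono mult_left_mono)
          \<comment> \<open>Partial summation reaches the threshold \<open>\<theta> + 1\<close>; the
            excess of its logarithm over \<open>ln \<theta>\<close> is at most 1 and is absorbed by
            \<open>1 \<le> H\<close>.\<close>
          have "ln (real k) \<le> ln (real \<theta> + 1)" using k k1 by (intro ln_mono) auto
          also have "\<dots> \<le> ln (real \<theta>) + 1 / real \<theta>" using ln_succ_diff(2)[of "real \<theta>"] h by simp
          also have "\<dots> \<le> ln (real \<theta>) + 1" using h by simp
          finally have "ln (real k) \<le> ln (real \<theta>) + 1" .
          then have "L + ln (real k) \<le> H + (ln (real \<theta>) + H)" using LH b(5) by (intro add_mono) auto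
          also have "\<dots> \<le> 2 * (H + ln (real \<theta>))" using lt by simp
          finally show "L + ln (real k) \<le> 2 * (H + ln (real \<theta>))" .
        qed (use K2(1) w0 in auto)
        finally show ?thesis by (simp add: E_def)
      qed
      have "mean_S f \<eta> \<theta> N - A_const f \<eta> \<theta> * ln (real N) = (\<Sum>m=\<eta>..\<theta>. f m * (e m - e (Suc m)))"
      proof -
        have "mean_S f \<eta> \<theta> N = (\<Sum>m=\<eta>..\<theta>. f m * (digits_ge_mean m N - digits_ge_mean (Suc m) N))"
          using b by (intro mean_S_eq) simp
        then show ?thesis unfolding A_const_telescope[OF h(1)] sum_distrib_right e_def
          by (simp only: sum_subtractf[symmetric]) (intro sum.cong refl, simp only: algebra_simps)
      qed
      also have "\<bar>\<dots>\<bar> \<le> E * ((\<Sum>m=\<eta>..\<theta>. f m * (1 / real m - 1 / real (Suc m))) + 2 * f \<theta> / real (Suc \<theta>))"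
        using f(1) by (intro abel_summation_bound mono e h) auto
      also have "\<dots> \<le> E * (2 * B)"
        unfolding B_def using f h by (intro mult_left_mono B_const_ge E0) auto
      also have "\<dots> = 4 * K2 * (B * (H + ln (real \<theta>)) * w)" by (simp add: E_def mult_ac)
      also have "\<dots> \<le> K * (B * (H + ln (real \<theta>)) * w)"
        using K3 b lt w0 by (intro mult_right_mono) (auto simp: K_def)
      finally show ?thesis .
    next
      case False
      \<comment> \<open>For small \<open>N\<close> nothing asymptotic is needed: mean and main term
        are estimated separately, and \<open>1 \<le> H\<close> supplies the missing factor.\<close>
      have A: "0 \<le> A_const f \<eta> \<theta>" "A_const f \<eta> \<theta> \<le> B"
        using A_const_nonneg[of f \<eta> \<theta>] f h by (auto simp: B_def B_const_def)
      have "\<bar>mean_S f \<eta> \<theta> N\<bar> \<le> K1 * (B * ln (real N) * w)"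
        using K1(2)[OF b(2) h f(1,2)] by (simp add: B_def w_def)
      moreover have "\<bar>A_const f \<eta> \<theta> * ln (real N)\<bar> \<le> 1 / ln (ln 3) * (B * ln (real N) * w)"
      proof -
        have "\<bar>A_const f \<eta> \<theta> * ln (real N)\<bar> \<le> B * ln (real N) * 1"
          unfolding abs_mult using A lnN by (simp add: mult_right_mono)
        also have "\<dots> \<le> B * ln (real N) * (w / ln (ln 3))"
          using w0 b lnN by (intro mult_left_mono) auto
        finally show ?thesis by (simp add: mult_ac)
      qed
      ultimately have "\<bar>mean_S f \<eta> \<theta> N - A_const f \<eta> \<theta> * ln (real N)\<bar> \<le>
          K1 * (B * ln (real N) * w) + 1 / ln (ln 3) * (B * ln (real N) * w)" by linarith
      also have "\<dots> = (K1 + 1 / ln (ln 3)) * ln (real N) * (B * 1 * w)" by (simp add: algebra_simps)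
      also have "\<dots> \<le> K3 * (B * (H + ln (real \<theta>)) * w)"
      proof (rule mult_mono)
        have "ln (real N) \<le> ln (real (N0 + 3))" using False b by (intro ln_mono) auto
        then show "(K1 + 1 / ln (ln 3)) * ln (real N) \<le> K3"
          unfolding K3_def using K1(1) w0 by (intro mult_left_mono) auto
        show "B * 1 * w \<le> B * (H + ln (real \<theta>)) * w"
          using b lt w0 by (intro mult_right_mono mult_left_mono) auto
      qed (use K3 b w0 in auto)
      also have "\<dots> \<le> K * (B * (H + ln (real \<theta>)) * w)"
        using K2(1) b lt w0 by (intro mult_right_mono) (auto simp: K_def)
      finally show ?thesis .
    qed
    then show "\<bar>mean_S f \<eta> \<theta> N - A_const f \<eta> \<theta> * ln (real N)\<bar>
        \<le> K * (B_const f \<eta> \<theta> *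
               ((ln (C_const f \<eta> \<theta> * ln (real N)))\<^sup>2 / ln (ln (C_const f \<eta> \<theta> * ln (real N)))
                 + ln (real \<theta>)) * ln (ln (real N)))"
      unfolding B_def H_def y_def w_def .
  qed
qed

end
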